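(* There exist constants $c_0,c_1>0$ such that the following holds. Let $z^\star=x^\star+iy^\star\in\mathbb{C}^n$ be nonzero ($x^\star,y^\star\in\mathbb{R}^n$), let $a_1,\dots,a_m$ be independent random vectors sampled from the standard complex Gaussian distribution $\mathbb{C}\mathcal{N}(0,I_n)$, let $b_j=|a_j^Hz^\star|$ for $j=1,\dots,m$, and define $f:\mathbb{R}^n\times\mathbb{R}^n\to\mathbb{R}$ by $$f(x,y)=\frac{1}{2m}\sum_{j=1}^m\left(|a_j^H(x+iy)|^2-b_j^2\right)^2 .$$ Let $\mathcal{X}^\star=\{(x^\star\cos\phi-y^\star\sin\phi,\ x^\star\sin\phi+y^\star\cos\phi):\phi\in[0,2\pi)\}$. If $m\ge c_0n\log^3 n$, then with probability at least $1-c_1m^{-1}$ the following holds: with any arbitrary initial point $(x^0,y^0)\in\mathbb{R}^n\times\mathbb{R}^n$, the sequence of iterates $\{(x^k,y^k)\}_{k\ge 0}$ generated by the cubic regularization (CR) method for minimizing $f$ over $\mathbb{R}^n\times\mathbb{R}^n$ converges at least Q-quadratically to an element of $\mathcal{X}^\star$.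
   Context: $a^H$ denotes the Hermitian (conjugate) transpose. A vector distributed as $\mathbb{C}\mathcal{N}(0,I_n)$ has independent entries whose real and imaginary parts are independent real Gaussians with mean $0$ and variance $1/2$ (so $\mathbb{E}[aa^H]=I_n$). Identify $\mathbb{R}^n\times\mathbb{R}^n$ with $\mathbb{R}^{2n}$ with the Euclidean norm; matrix norms are operator norms. Write $u=(x,y)\in\mathbb{R}^{2n}$. Cubic model: for $\sigma>0$ and $u,p\in\mathbb{R}^{2n}$, $$f_\sigma(p;u)=f(u)+\nabla f(u)^T(p-u)+\tfrac12(p-u)^T\nabla^2 f(u)(p-u)+\tfrac{\sigma}{6}\|p-u\|^3,$$ $\bar f_\sigma(u)=\min_{p}f_\sigma(p;u)$, and $p_\sigma(u)$ denotes a global minimizer of $f_\sigma(\cdot\,;u)$. CR method: given the initial point $u^0$, let $L>0$ be such that $\|\nabla^2 f(u)-\nabla^2 f(v)\|\le L\|u-v\|$ for all $u,v$ in some closed convex set $\mathcal{F}$ whose interior contains the level set $\{v: f(v)\le f(u^0)\}$, and let $\bar\sigma\in(0,L]$. For $k=0,1,2,\dots$ find $\sigma_k\in[\bar\sigma,2L]$ such that $f(p_{\sigma_k}(u^k))\le\bar f_{\sigma_k}(u^k)$, and set $u^{k+1}=p_{\sigma_k}(u^k)$. A sequence $\{w^k\}$ converges (at least) Q-quadratically to $w^\infty$ if $w^k\to w^\infty$ and there exists $M>0$ such that $\|w^{k+1}-w^\infty\|\le M\|w^k-w^\infty\|^2$ for all sufficiently large $k$. *)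

theory Defs
  imports
    "HOL-Probability.Probability"
    "Jordan_Normal_Form.Matrix"
begin

(* Dimensions vary inside the statement, so vectors are those of Jordan_Normal_Form;
   the clashing notation for type-indexed vectors and type-class inner products is switched off. *)
hide_type (open) Finite_Cartesian_Product.vec
hide_const (open) Finite_Cartesian_Product.vec Finite_Cartesian_Product.mat
no_notation Finite_Cartesian_Product.vec_nth (infixl \<open>$\<close> 90)
no_notation inner (infix \<open>\<bullet>\<close> 70)


section \<open>Euclidean structure on real vectors of dimension \<open>N\<close>\<close>

definition vec_enorm :: "real vec \<Rightarrow> real" where
  "vec_enorm v = L2_set (\<lambda>i. v $ i) {..<dim_vec v}"

(* The dimension is an explicit argument because the locale Metric_space demands symmetry of the
   distance on the whole type. *)
definition vec_dist :: "nat \<Rightarrow> real vec \<Rightarrow> real vec \<Rightarrow> real" where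
  "vec_dist N u v = vec_enorm (vec N (\<lambda>i. u $ i - v $ i))"

lemma vec_dist_L2_set: "vec_dist N u v = L2_set (\<lambda>i. u $ i - v $ i) {..<N}"
  unfolding vec_dist_def vec_enorm_def by (rule L2_set_cong) auto

lemma vec_dist_eq_enorm:
  assumes "u \<in> carrier_vec N" "v \<in> carrier_vec N"
  shows "vec_dist N u v = vec_enorm (u - v)"
  using assms by (auto simp: vec_dist_def vec_enorm_def intro!: L2_set_cong)

lemma Metric_space_vec: "Metric_space (carrier_vec N) (vec_dist N)"
proof
  fix x y z :: "real vec"
  show "0 \<le> vec_dist N x y"
    by (simp add: vec_dist_def vec_enorm_def)
  show "vec_dist N x y = vec_dist N y x"
    by (simp add: vec_dist_def vec_enorm_def L2_set_def power2_commute)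
  assume x: "x \<in> carrier_vec N" and y: "y \<in> carrier_vec N"
  show "vec_dist N x y = 0 \<longleftrightarrow> x = y"
    using x y by (auto simp: vec_dist_def vec_enorm_def L2_set_eq_0_iff)
  assume "z \<in> carrier_vec N"
  show "vec_dist N x z \<le> vec_dist N x y + vec_dist N y z"
    using L2_set_triangle_ineq[of "\<lambda>i. x $ i - y $ i" "\<lambda>i. y $ i - z $ i" "{..<N}"]
    by (simp add: vec_dist_L2_set)
qed

abbreviation vec_topology :: "nat \<Rightarrow> real vec topology" where
  "vec_topology N \<equiv> Metric_space.mtopology (carrier_vec N) (vec_dist N)"

definition convex_vec :: "real vec set \<Rightarrow> bool" where
  "convex_vec S \<longleftrightarrow>
     (\<forall>u\<in>S. \<forall>v\<in>S. \<forall>s\<ge>0. \<forall>t\<ge>0. s + t = 1 \<longrightarrow> s \<cdot>\<^sub>v u + t \<cdot>\<^sub>v v \<in> S)"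

(* The set is never empty (it contains the zero vector) and always bounded above. *)
definition mat_op_norm :: "real mat \<Rightarrow> real" where
  "mat_op_norm A =
     (SUP v\<in>{v \<in> carrier_vec (dim_col A). vec_enorm v \<le> 1}. vec_enorm (A *\<^sub>v v))"


section \<open>Gradient and Hessian\<close>

definition partial_deriv :: "nat \<Rightarrow> nat \<Rightarrow> (real vec \<Rightarrow> real) \<Rightarrow> real vec \<Rightarrow> real" where
  "partial_deriv N i F u = deriv (\<lambda>t. F (u + t \<cdot>\<^sub>v unit_vec N i)) 0"

definition gradient :: "nat \<Rightarrow> (real vec \<Rightarrow> real) \<Rightarrow> real vec \<Rightarrow> real vec" where
  "gradient N F u = vec N (\<lambda>i. partial_deriv N i F u)"

definition hessian :: "nat \<Rightarrow> (real vec \<Rightarrow> real) \<Rightarrow> real vec \<Rightarrow> real mat" where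
  "hessian N F u = mat N N (\<lambda>(i, j). partial_deriv N i (partial_deriv N j F) u)"


section \<open>Cubic regularization\<close>

definition cubic_model ::
    "nat \<Rightarrow> (real vec \<Rightarrow> real) \<Rightarrow> real \<Rightarrow> real vec \<Rightarrow> real vec \<Rightarrow> real" where
  "cubic_model N F \<sigma> u p =
     F u + gradient N F u \<bullet> (p - u) + (1/2) * ((p - u) \<bullet> (hessian N F u *\<^sub>v (p - u)))
       + \<sigma> / 6 * vec_enorm (p - u) ^ 3"

(* For \<sigma> > 0 the model is continuous and coercive in p, so this infimum is a minimum. *)
definition cubic_model_min :: "nat \<Rightarrow> (real vec \<Rightarrow> real) \<Rightarrow> real \<Rightarrow> real vec \<Rightarrow> real" where
  "cubic_model_min N F \<sigma> u = (INF p\<in>carrier_vec N. cubic_model N F \<sigma> u p)"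

definition CR_setup ::
    "nat \<Rightarrow> (real vec \<Rightarrow> real) \<Rightarrow> real vec \<Rightarrow> real vec set \<Rightarrow> real \<Rightarrow> real \<Rightarrow> bool" where
  "CR_setup N F u0 S L \<sigma>min \<longleftrightarrow>
     closedin (vec_topology N) S \<and> convex_vec S \<and>
     {v \<in> carrier_vec N. F v \<le> F u0} \<subseteq> vec_topology N interior_of S \<and>
     L > 0 \<and>
     (\<forall>u\<in>S. \<forall>v\<in>S. mat_op_norm (hessian N F u - hessian N F v) \<le> L * vec_dist N u v) \<and>
     0 < \<sigma>min \<and> \<sigma>min \<le> L"

definition CR_sequence :: "nat \<Rightarrow> (real vec \<Rightarrow> real) \<Rightarrow> real vec \<Rightarrow> (nat \<Rightarrow> real vec) \<Rightarrow> bool" where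
  "CR_sequence N F u0 u \<longleftrightarrow>
     u 0 = u0 \<and>
     (\<exists>S L \<sigma>min \<sigma>. CR_setup N F u0 S L \<sigma>min \<and>
        (\<forall>k. \<sigma>min \<le> \<sigma> k \<and> \<sigma> k \<le> 2 * L \<and>
             is_arg_min (cubic_model N F (\<sigma> k) (u k)) (\<lambda>p. p \<in> carrier_vec N) (u (Suc k)) \<and>
             F (u (Suc k)) \<le> cubic_model_min N F (\<sigma> k) (u k)))"

definition Q_quadratic_convergent :: "nat \<Rightarrow> (nat \<Rightarrow> real vec) \<Rightarrow> real vec \<Rightarrow> bool" where
  "Q_quadratic_convergent N w l \<longleftrightarrow>
     limitin (vec_topology N) w l sequentially \<and>
     (\<exists>M>0. \<forall>\<^sub>F k in sequentially. vec_dist N (w (Suc k)) l \<le> M * (vec_dist N (w k) l)\<^sup>2)"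


section \<open>Complex Gaussian vectors\<close>

definition std_complex_normal :: "complex measure" where
  "std_complex_normal =
     (let g = density lborel (normal_density 0 (sqrt (1/2)))
      in distr (g \<Otimes>\<^sub>M g) borel (\<lambda>(s, t). Complex s t))"

definition std_complex_normal_vec :: "nat \<Rightarrow> complex vec measure" where
  "std_complex_normal_vec n = embed_measure (\<Pi>\<^sub>M i\<in>{..<n}. std_complex_normal) (vec n)"

definition complex_normal_sample :: "nat \<Rightarrow> nat \<Rightarrow> (nat \<Rightarrow> complex vec) measure" where
  "complex_normal_sample m n = (\<Pi>\<^sub>M j\<in>{1..m}. std_complex_normal_vec n)"

lemma prob_space_std_complex_normal: "prob_space std_complex_normal"
proof -
  let ?g = "density lborel (normal_density 0 (sqrt (1/2)))"
  interpret g: prob_space ?g by (rule prob_space_normal_density) simp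
  interpret gg: pair_prob_space ?g ?g ..
  have "(\<lambda>(s, t). Complex s t) \<in> borel_measurable (?g \<Otimes>\<^sub>M ?g)"
    by (simp add: borel_measurable_complex_iff case_prod_beta)
  then show ?thesis
    unfolding std_complex_normal_def Let_def by (rule gg.prob_space_distr)
qed

lemma inj_on_vec_PiM: "inj_on (vec n) (space (\<Pi>\<^sub>M i\<in>{..<n}. M i))"
proof (rule inj_onI)
  fix f g :: "nat \<Rightarrow> 'a"
  assume f: "f \<in> space (\<Pi>\<^sub>M i\<in>{..<n}. M i)" and g: "g \<in> space (\<Pi>\<^sub>M i\<in>{..<n}. M i)"
    and eq: "vec n f = vec n g"
  have "f i = g i" if "i < n" for i
    using arg_cong[OF eq, of "\<lambda>v. v $ i"] that by simp
  then show "f = g"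
    using f g by (intro PiE_ext[of f "{..<n}" _ g]) (auto simp: space_PiM)
qed

lemma prob_space_std_complex_normal_vec: "prob_space (std_complex_normal_vec n)"
proof -
  let ?P = "\<Pi>\<^sub>M i\<in>{..<n}. std_complex_normal"
  interpret P: prob_space ?P
    by (intro prob_space_PiM prob_space_std_complex_normal)
  have "std_complex_normal_vec n = distr ?P (std_complex_normal_vec n) (vec n)"
    unfolding std_complex_normal_vec_def by (rule embed_measure_eq_distr'[OF inj_on_vec_PiM])
  moreover have "vec n \<in> measurable ?P (std_complex_normal_vec n)"
    unfolding std_complex_normal_vec_def by (rule measurable_embed_measure2'[OF inj_on_vec_PiM])
  ultimately show ?thesis
    using P.prob_space_distr by metis
qed

lemma prob_space_complex_normal_sample: "prob_space (complex_normal_sample m n)"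
  unfolding complex_normal_sample_def
  by (intro prob_space_PiM prob_space_std_complex_normal_vec)


section \<open>Phase retrieval\<close>

definition complex_of_pair :: "nat \<Rightarrow> real vec \<Rightarrow> complex vec" where
  "complex_of_pair n u =
     vec n (\<lambda>i. Complex (vec_first u n $ i) (vec_last u n $ i))"

(* z \<bullet>c a = z \<bullet> conjugate a, which is a^H z. *)
definition phase_retrieval_objective ::
    "nat \<Rightarrow> nat \<Rightarrow> (nat \<Rightarrow> complex vec) \<Rightarrow> (nat \<Rightarrow> real) \<Rightarrow> real vec \<Rightarrow> real" where
  "phase_retrieval_objective m n a b u =
     1 / (2 * real m) *
       (\<Sum>j=1..m. ((cmod (complex_of_pair n u \<bullet>c a j))\<^sup>2 - (b j)\<^sup>2)\<^sup>2)"

definition phase_orbit :: "real vec \<Rightarrow> real vec \<Rightarrow> real vec set" where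
  "phase_orbit x y =
     (\<lambda>\<phi>. (cos \<phi> \<cdot>\<^sub>v x - sin \<phi> \<cdot>\<^sub>v y) @\<^sub>v (sin \<phi> \<cdot>\<^sub>v x + cos \<phi> \<cdot>\<^sub>v y)) ` {0..<2 * pi}"

end

theory Submission
  imports Defs "HOL-Real_Asymp.Real_Asymp"
begin

text \<open>
  Let \<open>x\<close> be the normalised signal and, for a sample \<open>a\<close> and a point \<open>z\<close> whose phase is aligned with
  \<open>x\<close>, put \<open>p = a\<^sup>H x\<close>, \<open>q = a\<^sup>H (z - x)\<close> and \<open>r = Re (cnj p q)\<close>. The derivative of the loss at
  \<open>z\<close> in the direction \<open>z - x\<close> is twice the mean of
  \<open>(|q|\<^sup>2 + r) (|q|\<^sup>2 + 2 r) = (|q|\<^sup>2 + 3/2 r)\<^sup>2 - r\<^sup>2 / 4\<close>. Fourth powers of Gaussian linear forms do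
  not concentrate from above uniformly over directions when there are only about \<open>n\<close> samples up to
  logarithms, but the mean of a square concentrates from below; the subtracted term is at most
  \<open>|p|\<^sup>2 |q|\<^sup>2 / 4\<close>, whose mean is a quadratic form in \<open>z - x\<close> and concentrates from above as well.
  The derivative is therefore almost as large as in the limit of infinitely many samples. There it
  is at least a multiple of \<open>|z - x|\<^sup>2\<close>, except at points where the mean curvature along \<open>x\<close> and
  \<open>\<i> x\<close> is clearly negative; this curvature again involves only the quadratic form and the mean of
  \<open>|p|\<^sup>4\<close> (\<open>population_gap\<close>, \<open>landscape\<close>). So a point that is almost second-order critical is as close to the
  orbit of the signal as its gradient is small. One inequality serves both as the absence of spurious
  minimisers and as the local error bound.

  For the method, global optimality of a cubic step yields a decrease by the cube of the step
  length, a gradient at the new iterate of second order in the step length and a negative curvature of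
  at most first order. Steps thus tend to zero, and eventually the landscape bounds the distance of the new
  iterate to the orbit by a multiple of the squared step. Conversely, stationarity of the model
  bounds a step by a multiple of the distance to any point of the orbit (\<open>cubic_step_length\<close>).
  Together these give quadratic convergence to one point of the orbit (\<open>cubic_iterates_converge\<close>), although
  the solutions are not isolated.

  The two uniform estimates (\<open>regular_sample\<close>) come from exponential moments for a fixed direction
  and a union bound over a grid on the sphere. Squares have Gaussian lower tails
  (\<open>mixed_sum_tail\<close>); for the quadratic form, \<open>|p|\<^sup>2\<close> is capped at a multiple of \<open>ln m\<close>, which costs one
  logarithm in the exponent (\<open>capped_sum_tail\<close>). Moments of pairs of linear forms
  follow by polarisation from the fourth moment of a single one. A constant times \<open>n (ln m)\<^sup>2\<close>
  samples suffice, and the hypothesis of the theorem provides them.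

  Directions and iterates are represented by functions on \<open>{..<n}\<close>, which keeps sums and scalings free of
  dimension conditions.
\<close>

section \<open>Hermitian products of coordinate functions\<close>

definition ip :: "nat \<Rightarrow> (nat \<Rightarrow> complex) \<Rightarrow> (nat \<Rightarrow> complex) \<Rightarrow> complex" where
  "ip n x z = (\<Sum>i<n. cnj (x i) * z i)"

abbreviation cmod2 :: "complex \<Rightarrow> real" where
  "cmod2 z \<equiv> (cmod z)\<^sup>2"

definition nsq :: "nat \<Rightarrow> (nat \<Rightarrow> complex) \<Rightarrow> real" where
  "nsq n z = (\<Sum>i<n. cmod2 (z i))"

definition nrm :: "nat \<Rightarrow> (nat \<Rightarrow> complex) \<Rightarrow> real" where
  "nrm n z = sqrt (nsq n z)"

lemma ip_add: "ip n x (\<lambda>i. z i + w i) = ip n x z + ip n x w"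
  by (simp add: ip_def algebra_simps sum.distrib)

lemma ip_diff: "ip n x (\<lambda>i. z i - w i) = ip n x z - ip n x w"
  by (simp add: ip_def algebra_simps sum_subtractf)

lemma ip_scale: "ip n x (\<lambda>i. c * z i) = c * ip n x z"
  by (simp add: ip_def algebra_simps sum_distrib_left)

lemma ip_minus: "ip n x (\<lambda>i. - z i) = - ip n x z"
  by (simp add: ip_def sum_negf)

lemma ip_add_left: "ip n (\<lambda>i. z i + w i) x = ip n z x + ip n w x"
  by (simp add: ip_def algebra_simps sum.distrib)

lemma ip_cnj: "cnj (ip n x z) = ip n z x"
  by (simp add: ip_def mult.commute)

lemma ip_self: "ip n z z = of_real (nsq n z)"
  by (simp add: ip_def nsq_def complex_norm_square mult.commute del: of_real_power)

lemma ip_cong: "(\<And>i. i < n \<Longrightarrow> z i = w i) \<Longrightarrow> ip n x z = ip n x w"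
  by (simp add: ip_def)

lemma nsq_cong: "(\<And>i. i < n \<Longrightarrow> z i = w i) \<Longrightarrow> nsq n z = nsq n w"
  by (simp add: nsq_def)

lemma nsq_nonneg [simp]: "nsq n z \<ge> 0"
  by (simp add: nsq_def sum_nonneg)

lemma nrm_nonneg [simp]: "nrm n z \<ge> 0"
  by (simp add: nrm_def)

lemma nrm_sq: "(nrm n z)\<^sup>2 = nsq n z"
  by (simp add: nrm_def)

lemma nsq_scale: "nsq n (\<lambda>i. c * z i) = cmod2 c * nsq n z"
  by (simp add: nsq_def norm_mult power_mult_distrib sum_distrib_left)

lemma nsq_add: "nsq n (\<lambda>i. z i + w i) = nsq n z + 2 * Re (ip n z w) + nsq n w"
proof -
  have "cmod2 (z i + w i) = cmod2 (z i) + 2 * Re (cnj (z i) * w i) + cmod2 (w i)" for i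
    by (simp add: cmod_power2) (simp add: power2_eq_square algebra_simps)
  then show ?thesis
    by (simp add: nsq_def ip_def sum.distrib sum_distrib_left)
qed

lemma nsq_diff: "nsq n (\<lambda>i. z i - w i) = nsq n z - 2 * Re (ip n z w) + nsq n w"
  using nsq_add[of n z "\<lambda>i. - w i"] by (simp add: ip_minus nsq_def)

lemma nrm_L2: "nrm n z = L2_set (\<lambda>i. cmod (z i)) {..<n}"
  by (simp add: nrm_def nsq_def L2_set_def)

lemma nrm_triangle: "nrm n (\<lambda>i. z i + w i) \<le> nrm n z + nrm n w"
proof -
  have "L2_set (\<lambda>i. cmod (z i + w i)) {..<n} \<le> L2_set (\<lambda>i. cmod (z i) + cmod (w i)) {..<n}"
    by (rule L2_set_mono) (auto simp: norm_triangle_ineq)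
  also have "\<dots> \<le> L2_set (\<lambda>i. cmod (z i)) {..<n} + L2_set (\<lambda>i. cmod (w i)) {..<n}"
    by (rule L2_set_triangle_ineq)
  finally show ?thesis by (simp add: nrm_L2)
qed

lemma abs_Re_cnj_le: "\<bar>Re (cnj u * v)\<bar> \<le> cmod u * cmod v"
  using abs_Re_le_cmod[of "cnj u * v"] by (simp add: norm_mult)

lemma nrm_scale: "nrm n (\<lambda>i. c * z i) = cmod c * nrm n z"
  by (simp add: nrm_def nsq_scale real_sqrt_mult)

lemma nrm_minus_commute: "nrm n (\<lambda>i. z i - w i) = nrm n (\<lambda>i. w i - z i)"
  by (simp add: nrm_def nsq_def norm_minus_commute)

lemma ip_CS: "cmod (ip n x z) \<le> nrm n x * nrm n z"
proof -
  have "cmod (ip n x z) \<le> (\<Sum>i<n. \<bar>cmod (x i)\<bar> * \<bar>cmod (z i)\<bar>)"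
    unfolding ip_def by (rule order.trans[OF norm_sum]) (simp add: norm_mult)
  also have "\<dots> \<le> L2_set (\<lambda>i. cmod (x i)) {..<n} * L2_set (\<lambda>i. cmod (z i)) {..<n}"
    by (rule L2_set_mult_ineq)
  finally show ?thesis by (simp add: nrm_L2)
qed

section \<open>The landscape of the loss for a regular sample\<close>

text \<open>This is where the population landscape is seen to be benign. With \<open>D\<close> the squared error and \<open>t\<close> its
  component along the signal, the left-hand side of the conclusion bounds the directional derivative along
  the error from below; by itself it is negative for some \<open>t\<close>, and the curvature hypothesis cuts
  these \<open>t\<close> away.\<close>

lemma population_gap:
  fixes D t :: real
  assumes D: "D \<ge> 0" and t: "-1 \<le> t"
    and curv: "1 + D + t\<^sup>2 + 4 * t \<ge> - (D + 3) / 100"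
  shows "7/8 * D + 25/8 * t\<^sup>2 + 6 * t * D + 2 * D\<^sup>2 \<ge> 4/100 * (D + D\<^sup>2)"
proof (cases "t \<ge> 0")
  case True
  have "t * D \<ge> 0" using True D by simp
  then show ?thesis
    using D zero_le_power2[of t] zero_le_power2[of D] by (simp only: ring_distribs)
next
  case False
  define u where "u = - t"
  have u: "0 \<le> u" "u \<le> 1" using False t by (auto simp: u_def)
  \<comment> \<open>With \<open>u = - t\<close>, four fifths of \<open>D\<close> times the curvature hypothesis leaves a positive definite form in \<open>u, D\<close>.\<close>
  have sq: "25/8 * u\<^sup>2 - 18/5 * u * D + 27/25 * D\<^sup>2 \<ge> 0"
  proof -
    have "25/8 * u\<^sup>2 - 18/5 * u * D + 27/25 * D\<^sup>2
        = 25/8 * (u - 72/125 * D)\<^sup>2 + (27/25 - 25/8 * (72/125)\<^sup>2) * D\<^sup>2"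
      by (simp add: power2_eq_square algebra_simps)
    also have "\<dots> \<ge> 0" by (intro add_nonneg_nonneg mult_nonneg_nonneg) (auto simp: power2_eq_square)
    finally show ?thesis .
  qed
  have c: "D * (1 + D + u\<^sup>2 - 4 * u) \<ge> D * (- (D + 3) / 100)"
    using curv D by (intro mult_left_mono) (auto simp: u_def)
  have c': "D + D\<^sup>2 + D * u\<^sup>2 - 4 * (u * D) \<ge> - (D\<^sup>2 + 3 * D) / 100"
    using c by (simp add: algebra_simps power2_eq_square)
  have du: "D * u\<^sup>2 \<le> u * D"
    using mult_left_mono[of "u\<^sup>2" u D] u D by (simp add: power2_eq_square mult_left_le mult.commute)
  have "0 \<le> D\<^sup>2" by simp
  then have "7/8 * D + 25/8 * u\<^sup>2 - 6 * (u * D) + 2 * D\<^sup>2 \<ge> 4/100 * (D + D\<^sup>2)"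
    using sq c' du D by argo
  then show ?thesis by (simp add: u_def)
qed


text \<open>The expectation of \<open>mixed_square \<tau> p q\<close> below for \<open>p = a\<^sup>H x\<close> and \<open>q = a\<^sup>H e\<close>, where \<open>x\<close> and
  \<open>e\<close> are unit vectors with product \<open>w\<close> and \<open>a\<close> is a standard complex Gaussian vector.\<close>

definition mixed_moment :: "real \<Rightarrow> complex \<Rightarrow> real" where
  "mixed_moment \<tau> w = 2 * \<tau>\<^sup>2 + 6 * \<tau> * (1 - \<tau>) * Re w
     + 9/4 * (1 - \<tau>)\<^sup>2 * (1/2 + 2 * (Re w)\<^sup>2 - cmod2 w / 2)"

text \<open>The quantity \<open>(|q|\<^sup>2 + 3/2 Re (cnj p q))\<^sup>2\<close> mixes two degrees of homogeneity in \<open>q\<close>. For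
  \<open>q = d q'\<close> it equals \<open>(d (1 + d))\<^sup>2\<close> times the following expression at \<open>q'\<close> with
  \<open>\<tau> = d / (1 + d)\<close>, so that unit vectors and \<open>\<tau> \<in> [0, 1]\<close> cover all scales.\<close>

definition mixed_square :: "real \<Rightarrow> complex \<Rightarrow> complex \<Rightarrow> real" where
  "mixed_square \<tau> p q = (\<tau> * cmod2 q + (1 - \<tau>) * (3/2) * Re (cnj p * q))\<^sup>2"

text \<open>All that is used of the randomness. The first sums are empirical quadratic forms and are bounded above;
  the second are sums of squares and are bounded below only, because a uniform upper bound on fourth powers
  would need far more samples.\<close>

definition regular_sample ::
    "nat \<Rightarrow> nat \<Rightarrow> (nat \<Rightarrow> nat \<Rightarrow> complex) \<Rightarrow> (nat \<Rightarrow> complex) \<Rightarrow> bool" where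
  "regular_sample n m a x \<longleftrightarrow>
     (\<forall>e. nsq n e = 1 \<longrightarrow>
        (\<Sum>j=1..m. cmod2 (ip n (a j) x) * cmod2 (ip n (a j) e))
          \<le> real m * (1 + cmod2 (ip n x e) + 1/100)) \<and>
     (\<forall>e \<tau>. nsq n e = 1 \<longrightarrow> 0 \<le> \<tau> \<longrightarrow> \<tau> \<le> 1 \<longrightarrow>
        (\<Sum>j=1..m. mixed_square \<tau> (ip n (a j) x) (ip n (a j) e))
          \<ge> real m * (mixed_moment \<tau> (ip n x e) - 1/100))"

lemma nsq_zero_ip: "nsq n h = 0 \<Longrightarrow> ip n x h = 0"
  using ip_CS[of n x h] by (simp add: nrm_def)

lemma unit_decomposition:
  assumes "nsq n h \<noteq> 0"
  obtains e where "nsq n e = 1" "\<And>x. ip n x h = of_real (nrm n h) * ip n x e"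
proof
  have pos: "nrm n h > 0" using assms nsq_nonneg[of n h] by (simp add: nrm_def less_le)
  show "nsq n (\<lambda>i. of_real (1 / nrm n h) * h i) = 1"
    using pos by (subst nsq_scale) (simp add: norm_divide power_divide nrm_sq[symmetric])
  show "ip n x h = of_real (nrm n h) * ip n x (\<lambda>i. of_real (1 / nrm n h) * h i)" for x
    using pos by (subst ip_scale) simp
qed

lemma regular_weighted_upper:
  assumes "regular_sample n m a x"
  shows "(\<Sum>j=1..m. cmod2 (ip n (a j) x) * cmod2 (ip n (a j) h))
          \<le> real m * (101/100 * nsq n h + cmod2 (ip n x h))"
proof (cases "nsq n h = 0")
  case True
  then show ?thesis by (simp add: nsq_zero_ip)
next
  case False
  then obtain e where e: "nsq n e = 1" "\<And>x. ip n x h = of_real (nrm n h) * ip n x e"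
    by (rule unit_decomposition) blast
  have "(\<Sum>j=1..m. cmod2 (ip n (a j) x) * cmod2 (ip n (a j) h))
     = nsq n h * (\<Sum>j=1..m. cmod2 (ip n (a j) x) * cmod2 (ip n (a j) e))"
    by (simp add: e(2) norm_mult power_mult_distrib nrm_sq sum_distrib_left mult_ac)
  also have "\<dots> \<le> nsq n h * (real m * (1 + cmod2 (ip n x e) + 1/100))"
    using assms e(1) by (intro mult_left_mono) (auto simp: regular_sample_def)
  also have "\<dots> = real m * (101/100 * nsq n h + cmod2 (ip n x h))"
    by (simp add: e(2) norm_mult power_mult_distrib nrm_sq algebra_simps)
  finally show ?thesis .
qed

lemma regular_quartic_lower:
  assumes "regular_sample n m a x"
  shows "(\<Sum>j=1..m. (cmod (ip n (a j) h)) ^ 4) \<ge> real m * (199/100) * (nsq n h)\<^sup>2"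
proof (cases "nsq n h = 0")
  case True
  then show ?thesis by (simp add: nsq_zero_ip)
next
  case False
  then obtain e where e: "nsq n e = 1" "\<And>x. ip n x h = of_real (nrm n h) * ip n x e"
    by (rule unit_decomposition) blast
  have "real m * (mixed_moment 1 (ip n x e) - 1/100)
      \<le> (\<Sum>j=1..m. mixed_square 1 (ip n (a j) x) (ip n (a j) e))"
    using assms e(1) by (auto simp: regular_sample_def)
  then have "real m * (199/100) \<le> (\<Sum>j=1..m. (cmod (ip n (a j) e)) ^ 4)"
    by (simp add: mixed_moment_def mixed_square_def)
  then have "(nsq n h)\<^sup>2 * (real m * (199/100)) \<le> (nsq n h)\<^sup>2 * (\<Sum>j=1..m. (cmod (ip n (a j) e)) ^ 4)"
    by (intro mult_left_mono) auto
  also have "\<dots> = (\<Sum>j=1..m. (nsq n h)\<^sup>2 * (cmod (ip n (a j) e)) ^ 4)"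
    by (simp add: sum_distrib_left)
  also have "\<dots> = (\<Sum>j=1..m. (cmod (ip n (a j) h)) ^ 4)"
    by (simp add: e(2) norm_mult power_mult_distrib nrm_sq[symmetric])
  finally show ?thesis by (simp add: mult_ac)
qed

text \<open>The error term is relative to \<open>nsq n h\<close>, so this is as useful close to the signal as far from it.\<close>

lemma regular_mixed_lower:
  assumes "regular_sample n m a x"
  defines "w \<equiv> \<lambda>h. ip n x h"
  shows "(\<Sum>j=1..m. (cmod2 (ip n (a j) h) + 3/2 * Re (cnj (ip n (a j) x) * ip n (a j) h))\<^sup>2)
    \<ge> real m * (2 * (nsq n h)\<^sup>2 + 6 * nsq n h * Re (w h)
        + 9/4 * (nsq n h / 2 + 2 * (Re (w h))\<^sup>2 - cmod2 (w h) / 2)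
        - 2/100 * (nsq n h + (nsq n h)\<^sup>2))"
proof (cases "nsq n h = 0")
  case True
  then show ?thesis by (simp add: nsq_zero_ip w_def)
next
  case False
  then obtain e where e: "nsq n e = 1" "\<And>x. ip n x h = of_real (nrm n h) * ip n x e"
    by (rule unit_decomposition) blast
  define d where "d = nrm n h"
  have d: "d > 0" using False nsq_nonneg[of n h] by (simp add: d_def nrm_def less_le)
  \<comment> \<open>With this \<open>\<tau>\<close> the expression for \<open>h\<close> is \<open>d (1 + d)\<close> times the one for the unit vector \<open>e\<close>.\<close>
  define \<tau> where "\<tau> = d / (1 + d)"
  have \<tau>: "0 \<le> \<tau>" "\<tau> \<le> 1" using d by (auto simp: \<tau>_def)
  have \<tau>1: "(1 + d) * \<tau> = d" "(1 + d) * (1 - \<tau>) = 1"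
    using d by (simp_all add: \<tau>_def field_simps)
  define c where "c = d * (1 + d)"
  have sq: "(cmod2 (ip n (a j) h) + 3/2 * Re (cnj (ip n (a j) x) * ip n (a j) h))\<^sup>2
      = c\<^sup>2 * mixed_square \<tau> (ip n (a j) x) (ip n (a j) e)" for j
  proof -
    let ?q = "cmod2 (ip n (a j) e)" and ?r = "Re (cnj (ip n (a j) x) * ip n (a j) e)"
    have "cmod2 (ip n (a j) h) + 3/2 * Re (cnj (ip n (a j) x) * ip n (a j) h) = d\<^sup>2 * ?q + 3/2 * d * ?r"
      by (simp add: e(2) d_def[symmetric] norm_mult power_mult_distrib algebra_simps)
    also have "\<dots> = d * ((1 + d) * \<tau>) * ?q + d * ((1 + d) * (1 - \<tau>)) * (3/2) * ?r"
      by (simp add: \<tau>1 power2_eq_square)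
    also have "\<dots> = c * (\<tau> * ?q + (1 - \<tau>) * (3/2) * ?r)"
    proof -
      have "d * ((1 + d) * \<tau>) * Q + d * ((1 + d) * (1 - \<tau>)) * (3/2) * R
          = d * (1 + d) * (\<tau> * Q + (1 - \<tau>) * (3/2) * R)" for Q R
        by (simp add: field_simps)
      then show ?thesis by (simp only: c_def)
    qed
    finally show ?thesis by (simp only: mixed_square_def power_mult_distrib)
  qed
  have "real m * (mixed_moment \<tau> (ip n x e) - 1/100)
      \<le> (\<Sum>j=1..m. mixed_square \<tau> (ip n (a j) x) (ip n (a j) e))"
    using assms e(1) \<tau> by (auto simp: regular_sample_def)
  then have "c\<^sup>2 * (real m * (mixed_moment \<tau> (ip n x e) - 1/100))
      \<le> c\<^sup>2 * (\<Sum>j=1..m. mixed_square \<tau> (ip n (a j) x) (ip n (a j) e))"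
    by (intro mult_left_mono) auto
  then have lower: "real m * (c\<^sup>2 * mixed_moment \<tau> (ip n x e) - c\<^sup>2 / 100)
      \<le> (\<Sum>j=1..m. (cmod2 (ip n (a j) h) + 3/2 * Re (cnj (ip n (a j) x) * ip n (a j) h))\<^sup>2)"
    unfolding sq sum_distrib_left[symmetric] by (simp add: algebra_simps)
  have "c\<^sup>2 * mixed_moment \<tau> (ip n x e) = 2 * (nsq n h)\<^sup>2 + 6 * nsq n h * Re (w h)
        + 9/4 * (nsq n h / 2 + 2 * (Re (w h))\<^sup>2 - cmod2 (w h) / 2)"
  proof -
    let ?e = "ip n x e"
    have "c\<^sup>2 * mixed_moment \<tau> ?e = d\<^sup>2 * (2 * ((1 + d) * \<tau>)\<^sup>2 + 6 * ((1 + d) * \<tau>) * ((1 + d) * (1 - \<tau>)) * Re ?e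
        + 9/4 * ((1 + d) * (1 - \<tau>))\<^sup>2 * (1/2 + 2 * (Re ?e)\<^sup>2 - cmod2 ?e / 2))"
    proof -
      have "(d * (1 + d))\<^sup>2 * (2 * \<tau>\<^sup>2 + 6 * \<tau> * (1 - \<tau>) * R + 9/4 * (1 - \<tau>)\<^sup>2 * Q)
        = d\<^sup>2 * (2 * ((1 + d) * \<tau>)\<^sup>2 + 6 * ((1 + d) * \<tau>) * ((1 + d) * (1 - \<tau>)) * R
            + 9/4 * ((1 + d) * (1 - \<tau>))\<^sup>2 * Q)" for R Q
        by (simp add: power2_eq_square field_simps)
      then show ?thesis unfolding c_def mixed_moment_def .
    qed
    also have "\<dots> = d\<^sup>2 * (2 * d\<^sup>2 + 6 * d * Re ?e + 9/4 * (1/2 + 2 * (Re ?e)\<^sup>2 - cmod2 ?e / 2))"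
      by (simp only: \<tau>1) simp
    also have "\<dots> = 2 * (d\<^sup>2)\<^sup>2 + 6 * d\<^sup>2 * (d * Re ?e)
        + 9/4 * (d\<^sup>2 / 2 + 2 * (d * Re ?e)\<^sup>2 - (d * cmod ?e)\<^sup>2 / 2)"
      by (simp add: power2_eq_square field_simps)
    finally show ?thesis
      using d by (simp add: w_def e(2) d_def[symmetric] norm_mult nrm_sq[symmetric])
  qed
  moreover have "c\<^sup>2 \<le> 2 * (nsq n h + (nsq n h)\<^sup>2)"
  proof -
    have "c\<^sup>2 = d\<^sup>2 * (1 + d)\<^sup>2" by (simp add: c_def power_mult_distrib)
    also have "\<dots> \<le> d\<^sup>2 * (2 * (1 + d\<^sup>2))"
      using zero_le_power2[of "d - 1"] by (intro mult_left_mono) (auto simp: power2_eq_square algebra_simps)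
    also have "\<dots> = 2 * (nsq n h + (nsq n h)\<^sup>2)"
      by (simp add: d_def nrm_sq[symmetric] power2_eq_square algebra_simps)
    finally show ?thesis .
  qed
  ultimately have "real m * (2 * (nsq n h)\<^sup>2 + 6 * nsq n h * Re (w h)
        + 9/4 * (nsq n h / 2 + 2 * (Re (w h))\<^sup>2 - cmod2 (w h) / 2)
        - 2/100 * (nsq n h + (nsq n h)\<^sup>2)) \<le> real m * (c\<^sup>2 * mixed_moment \<tau> (ip n x e) - c\<^sup>2 / 100)"
    by (intro mult_left_mono) auto
  then show ?thesis using lower by (rule order.trans)
qed

text \<open>The sum in the conclusion is, up to a factor, the derivative of the loss at \<open>z\<close> in the direction of
  the error, and the sum in \<open>curv\<close> is the mean curvature along \<open>x\<close> and \<open>\<i> x\<close>. The derivative is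
  a sum of squares minus an empirical quadratic form, both of which are close enough to their expectations
  for \<open>population_gap\<close> to apply.\<close>

lemma landscape_unit:
  assumes reg: "regular_sample n m a x" and x: "nsq n x = 1"
    and al: "ip n x z = of_real s" "s \<ge> 0"
    and curv: "(\<Sum>j=1..m. 2 * cmod2 (ip n (a j) z) * cmod2 (ip n (a j) x) - (cmod (ip n (a j) x)) ^ 4)
        \<ge> - real m / 100"
    and m: "m \<ge> 1"
  shows "(\<Sum>j=1..m. (cmod2 (ip n (a j) z) - cmod2 (ip n (a j) x))
              * Re (cnj (ip n (a j) z) * (ip n (a j) z - ip n (a j) x)))
     \<ge> real m / 100 * nsq n (\<lambda>i. z i - x i)"
proof -
  define h where "h = (\<lambda>i. z i - x i)"
  define D where "D = nsq n h"
  define t where "t = s - 1"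
  have D: "D \<ge> 0" by (simp add: D_def)
  have wh: "ip n x h = of_real t" using al x by (simp add: h_def ip_diff ip_self t_def)
  have z: "nsq n z = D + 2 * t + 1"
    using nsq_diff[of n z x] x ip_cnj[of n x z, symmetric] al by (simp add: D_def h_def t_def)
  have t: "t \<ge> -1" using al by (simp add: t_def)
  let ?p = "\<lambda>j. ip n (a j) x" and ?q = "\<lambda>j. ip n (a j) h" and ?z = "\<lambda>j. ip n (a j) z"
  have zpq: "?z j = ?p j + ?q j" for j by (simp add: h_def ip_diff)
  \<comment> \<open>The left-hand side is \<open>nsq n z + s\<^sup>2 - 1\<close>, which the empirical curvature controls.\<close>
  have curv': "1 + D + t\<^sup>2 + 4 * t \<ge> - (D + 3) / 100"
  proof (cases "t \<ge> 0")
    case True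
    then show ?thesis using D by (simp add: field_simps)
  next
    case False
    have "(\<Sum>j=1..m. cmod2 (?p j) * cmod2 (?z j)) \<le> real m * (101/100 * nsq n z + s\<^sup>2)"
      using regular_weighted_upper[OF reg, of z] al by simp
    moreover have "(\<Sum>j=1..m. (cmod (?p j)) ^ 4) \<ge> real m * (199/100)"
      using regular_quartic_lower[OF reg, of x] x by simp
    moreover have "(\<Sum>j=1..m. 2 * cmod2 (?z j) * cmod2 (?p j) - (cmod (?p j)) ^ 4)
        = 2 * (\<Sum>j=1..m. cmod2 (?p j) * cmod2 (?z j)) - (\<Sum>j=1..m. (cmod (?p j)) ^ 4)"
      by (simp add: sum_subtractf sum_distrib_left mult_ac)
    ultimately have "real m * (2 * (101/100 * nsq n z + s\<^sup>2) - 199/100) \<ge> real m * (- (1/100))"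
      using curv by (simp add: algebra_simps)
    then have "2 * (101/100 * nsq n z + s\<^sup>2) - 199/100 \<ge> - (1/100)"
      using m by (subst (asm) mult_le_cancel_left_pos) auto
    then show ?thesis using False by (simp add: z t_def power2_eq_square field_simps)
  qed
  \<comment> \<open>Completing the square: the negative part only involves \<open>Re (cnj p * q)\<close>, which is linear in the error.\<close>
  have id: "(cmod2 (?z j) - cmod2 (?p j)) * Re (cnj (?z j) * (?z j - ?p j))
     = (cmod2 (?q j) + 3/2 * Re (cnj (?p j) * ?q j))\<^sup>2 - (Re (cnj (?p j) * ?q j))\<^sup>2 / 4" for j
    unfolding zpq by (simp add: cmod_power2) (simp add: power2_eq_square field_simps)
  have rho: "(Re (cnj (?p j) * ?q j))\<^sup>2 \<le> cmod2 (?p j) * cmod2 (?q j)" for j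
    using abs_Re_le_cmod[of "cnj (?p j) * ?q j"]
    by (metis abs_le_square_iff abs_norm_cancel complex_mod_cnj norm_mult power_mult_distrib)
  have "(\<Sum>j=1..m. (cmod2 (?z j) - cmod2 (?p j)) * Re (cnj (?z j) * (?z j - ?p j)))
     \<ge> (\<Sum>j=1..m. (cmod2 (?q j) + 3/2 * Re (cnj (?p j) * ?q j))\<^sup>2
           - cmod2 (?p j) * cmod2 (?q j) / 4)" (is "?L \<ge> _")
    by (intro sum_mono) (use rho id in \<open>smt (verit) divide_right_mono\<close>)
  then have "?L \<ge> (\<Sum>j=1..m. (cmod2 (?q j) + 3/2 * Re (cnj (?p j) * ?q j))\<^sup>2)
           - (\<Sum>j=1..m. cmod2 (?p j) * cmod2 (?q j)) / 4"
    by (simp add: sum_subtractf sum_divide_distrib)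
  moreover have "(\<Sum>j=1..m. cmod2 (?p j) * cmod2 (?q j)) \<le> real m * (101/100 * D + t\<^sup>2)"
    using regular_weighted_upper[OF reg, of h] by (simp add: D_def wh)
  moreover have "(\<Sum>j=1..m. (cmod2 (?q j) + 3/2 * Re (cnj (?p j) * ?q j))\<^sup>2)
      \<ge> real m * (2 * D\<^sup>2 + 6 * D * t + 9/4 * (D / 2 + 3/2 * t\<^sup>2) - 2/100 * (D + D\<^sup>2))"
    using regular_mixed_lower[OF reg, of h] by (simp add: D_def wh add_ac)
  note sums = calculation this
  from sums have "?L \<ge> real m * (2 * D\<^sup>2 + 6 * D * t + 9/4 * (D / 2 + 3/2 * t\<^sup>2) - 2/100 * (D + D\<^sup>2))
      - real m * (101/100 * D + t\<^sup>2) / 4"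
  proof -
    have "S1 - S2 / 4 \<le> L \<Longrightarrow> S2 \<le> B \<Longrightarrow> A \<le> S1 \<Longrightarrow> A - B / 4 \<le> L" for L S1 S2 A B :: real
      by linarith
    from this[OF sums] show ?thesis .
  qed
  moreover have "real m * (2 * D\<^sup>2 + 6 * D * t + 9/4 * (D / 2 + 3/2 * t\<^sup>2) - 2/100 * (D + D\<^sup>2))
      - real m * (101/100 * D + t\<^sup>2) / 4
     = real m * (7/8 * D + 25/8 * t\<^sup>2 + 6 * t * D + 2 * D\<^sup>2 - 2/100 * (D + D\<^sup>2) - D / 400)"
    by (simp add: field_simps)
  moreover have "real m * (7/8 * D + 25/8 * t\<^sup>2 + 6 * t * D + 2 * D\<^sup>2 - 2/100 * (D + D\<^sup>2) - D / 400)
     \<ge> real m * (D / 100)"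
  proof (intro mult_left_mono)
    have "0 \<le> D\<^sup>2" by simp
    then show "D / 100 \<le> 7/8 * D + 25/8 * t\<^sup>2 + 6 * t * D + 2 * D\<^sup>2 - 2/100 * (D + D\<^sup>2) - D / 400"
      using population_gap[OF D t curv'] D by argo
  qed simp
  ultimately show ?thesis by (simp add: D_def h_def)
qed


definition pr_loss where
  "pr_loss n m a b z = 1 / (2 * real m) * (\<Sum>j=1..m. (cmod2 (ip n (a j) z) - (b j)\<^sup>2)\<^sup>2)"
  for b :: "nat \<Rightarrow> real"

text \<open>The first and second derivatives of the loss, as forms in the directions \<open>h\<close> and \<open>k\<close>.\<close>

definition pr_D1 where
  "pr_D1 n m a b z h = 1 / real m * (\<Sum>j=1..m. (cmod2 (ip n (a j) z) - (b j)\<^sup>2)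
      * (2 * Re (cnj (ip n (a j) z) * ip n (a j) h)))"
  for b :: "nat \<Rightarrow> real"

definition pr_D2 where
  "pr_D2 n m a b z h k = 1 / real m * (\<Sum>j=1..m.
      4 * Re (cnj (ip n (a j) z) * ip n (a j) h) * Re (cnj (ip n (a j) z) * ip n (a j) k)
      + 2 * (cmod2 (ip n (a j) z) - (b j)\<^sup>2) * Re (cnj (ip n (a j) h) * ip n (a j) k))"
  for b :: "nat \<Rightarrow> real"

lemma phase_align:
  obtains c :: complex and r where "cmod c = 1" "w = of_real r * c" "r \<ge> 0"
proof (cases "w = 0")
  case True
  then show ?thesis using that[of 1 0] by simp
next
  case False
  then show ?thesis using that[of "sgn w" "cmod w"] False by (simp add: norm_divide sgn_eq)
qed

text \<open>A point without strong negative curvature along the signal or its rotation by \<open>\<i>\<close> has a gradient at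
  least proportional to its distance to some phase multiple of the signal. This excludes spurious
  second-order critical points and is at the same time an error bound near the solutions.\<close>

lemma landscape:
  assumes m: "m \<ge> 1" and \<rho>: "\<rho> > 0" and x: "nsq n x = 1"
    and reg: "regular_sample n m a x"
  defines "zs \<equiv> \<lambda>i. of_real \<rho> * x i"
  defines "b \<equiv> \<lambda>j. cmod (ip n (a j) zs)"
  assumes curv: "pr_D2 n m a b z zs zs + pr_D2 n m a b z (\<lambda>i. \<i> * zs i) (\<lambda>i. \<i> * zs i) \<ge> - (\<rho> ^ 4 / 25)"
  shows "\<exists>c. cmod c = 1 \<and>
      pr_D1 n m a b z (\<lambda>i. z i - c * zs i) \<ge> \<rho>\<^sup>2 / 50 * nsq n (\<lambda>i. z i - c * zs i)"
proof -
  obtain c r where c: "cmod c = 1" and r: "ip n x z = of_real r * c" "r \<ge> 0"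
    by (rule phase_align)
  have cc: "cnj c * c = 1" "c * cnj c = 1"
    using c complex_norm_square[of c] by (simp_all add: mult.commute)
  \<comment> \<open>Dividing by the modulus of the signal and by the phase \<open>c\<close> reduces to a unit signal and an aligned point.\<close>
  define w where "w = (\<lambda>i. cnj c / of_real \<rho> * z i)"
  let ?p = "\<lambda>j. ip n (a j) x" and ?w = "\<lambda>j. ip n (a j) w"
  have zw: "z i = of_real \<rho> * c * w i" for i
  proof -
    have "of_real \<rho> * c * w i = (c * cnj c) * z i" using \<rho> by (simp add: w_def)
    then show ?thesis by (simp only: cc mult_1_left)
  qed
  have az: "ip n (a j) z = of_real \<rho> * c * ?w j" for j
  proof -
    have "z = (\<lambda>i. of_real \<rho> * c * w i)" by (rule ext) (rule zw)
    then show ?thesis by (subst \<open>z = _\<close>) (rule ip_scale)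
  qed
  have azs: "ip n (a j) zs = of_real \<rho> * ?p j" for j
    unfolding zs_def by (rule ip_scale)
  have nz: "cmod (ip n (a j) z) = \<rho> * cmod (?w j)" for j
    using c \<rho> by (simp add: az norm_mult)
  have nb: "b j = \<rho> * cmod (?p j)" for j
    using \<rho> by (simp add: b_def azs norm_mult)
  have ipw: "ip n x w = of_real (r / \<rho>)"
  proof -
    have "ip n x w = (cnj c * c) * of_real (r / \<rho>)"
      unfolding w_def ip_scale r by simp
    then show ?thesis by (simp only: cc) simp
  qed
  have D2: "pr_D2 n m a b z zs zs + pr_D2 n m a b z (\<lambda>i. \<i> * zs i) (\<lambda>i. \<i> * zs i)
     = 4 * \<rho> ^ 4 / real m * (\<Sum>j=1..m. 2 * cmod2 (?w j) * cmod2 (?p j) - (cmod (?p j)) ^ 4)"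
  proof -
    have *: "4 * Re (cnj (ip n (a j) z) * ip n (a j) zs) * Re (cnj (ip n (a j) z) * ip n (a j) zs)
      + 2 * (cmod2 (ip n (a j) z) - (b j)\<^sup>2) * Re (cnj (ip n (a j) zs) * ip n (a j) zs)
      + (4 * Re (cnj (ip n (a j) z) * (\<i> * ip n (a j) zs)) * Re (cnj (ip n (a j) z) * (\<i> * ip n (a j) zs))
      + 2 * (cmod2 (ip n (a j) z) - (b j)\<^sup>2) * Re (cnj (\<i> * ip n (a j) zs) * (\<i> * ip n (a j) zs)))
      = 4 * \<rho> ^ 4 * (2 * cmod2 (?w j) * cmod2 (?p j) - (cmod (?p j)) ^ 4)" for j
    proof -
      let ?A = "ip n (a j) z" and ?B = "ip n (a j) zs"
      have "4 * Re (cnj ?A * ?B) * Re (cnj ?A * ?B) + 2 * (cmod2 ?A - (b j)\<^sup>2) * Re (cnj ?B * ?B)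
        + (4 * Re (cnj ?A * (\<i> * ?B)) * Re (cnj ?A * (\<i> * ?B))
        + 2 * (cmod2 ?A - (b j)\<^sup>2) * Re (cnj (\<i> * ?B) * (\<i> * ?B)))
        = 4 * cmod2 ?A * cmod2 ?B + 4 * (cmod2 ?A - (b j)\<^sup>2) * cmod2 ?B"
        by (simp add: cmod_power2) (simp add: power2_eq_square algebra_simps)
      also have "\<dots> = 4 * (\<rho> * cmod (?w j))\<^sup>2 * (\<rho> * cmod (?p j))\<^sup>2
          + 4 * ((\<rho> * cmod (?w j))\<^sup>2 - (\<rho> * cmod (?p j))\<^sup>2) * (\<rho> * cmod (?p j))\<^sup>2"
        by (simp only: nz nb[unfolded b_def] b_def)
      also have "\<dots> = 4 * \<rho> ^ 4 * (2 * cmod2 (?w j) * cmod2 (?p j) - (cmod (?p j)) ^ 4)"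
      proof -
        have "4 * (\<rho> * W)\<^sup>2 * (\<rho> * P)\<^sup>2 + 4 * ((\<rho> * W)\<^sup>2 - (\<rho> * P)\<^sup>2) * (\<rho> * P)\<^sup>2
            = 4 * \<rho> ^ 4 * (2 * W\<^sup>2 * P\<^sup>2 - P ^ 4)" for W P
          by (simp add: power2_eq_square power4_eq_xxxx algebra_simps)
        then show ?thesis .
      qed
      finally show ?thesis .
    qed
    have "pr_D2 n m a b z zs zs + pr_D2 n m a b z (\<lambda>i. \<i> * zs i) (\<lambda>i. \<i> * zs i)
       = 1 / real m * (\<Sum>j=1..m. 4 * \<rho> ^ 4 * (2 * cmod2 (?w j) * cmod2 (?p j) - (cmod (?p j)) ^ 4))"
      unfolding pr_D2_def ip_scale *[symmetric] by (simp only: sum.distrib distrib_left)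
    then show ?thesis by (simp add: sum_distrib_left[symmetric])
  qed
  have "(\<Sum>j=1..m. 2 * cmod2 (?w j) * cmod2 (?p j) - (cmod (?p j)) ^ 4) \<ge> - real m / 100"
  proof (rule mult_le_cancel_left_pos[THEN iffD1])
    show "0 < 4 * \<rho> ^ 4 / real m" using m \<rho> by simp
    show "4 * \<rho> ^ 4 / real m * (- real m / 100) \<le> 4 * \<rho> ^ 4 / real m
        * (\<Sum>j=1..m. 2 * cmod2 (?w j) * cmod2 (?p j) - (cmod (?p j)) ^ 4)"
      using curv m unfolding D2[symmetric] by simp
  qed
  from landscape_unit[OF reg x ipw _ this m] r \<rho>
  have key: "(\<Sum>j=1..m. (cmod2 (?w j) - cmod2 (?p j)) * Re (cnj (?w j) * (?w j - ?p j)))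
     \<ge> real m / 100 * nsq n (\<lambda>i. w i - x i)"
    by simp
  have diff: "ip n (a j) (\<lambda>i. z i - c * zs i) = of_real \<rho> * c * (?w j - ?p j)" for j
    by (simp only: ip_diff ip_scale az azs) (simp only: algebra_simps)
  have D1: "pr_D1 n m a b z (\<lambda>i. z i - c * zs i)
     = 2 * \<rho> ^ 4 / real m * (\<Sum>j=1..m. (cmod2 (?w j) - cmod2 (?p j)) * Re (cnj (?w j) * (?w j - ?p j)))"
  proof -
    have *: "(cmod2 (ip n (a j) z) - (b j)\<^sup>2) * (2 * Re (cnj (ip n (a j) z) * ip n (a j) (\<lambda>i. z i - c * zs i)))
      = 2 * \<rho> ^ 4 * ((cmod2 (?w j) - cmod2 (?p j)) * Re (cnj (?w j) * (?w j - ?p j)))" for j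
    proof -
      have "cnj (of_real \<rho> * c * ?w j) * (of_real \<rho> * c * (?w j - ?p j))
          = of_real (\<rho>\<^sup>2) * (cnj c * c) * (cnj (?w j) * (?w j - ?p j))"
        by (simp add: power2_eq_square)
      also have "Re \<dots> = \<rho>\<^sup>2 * Re (cnj (?w j) * (?w j - ?p j))"
        by (simp only: cc mult_1_right times_complex.sel Re_complex_of_real Im_complex_of_real)
      finally have Re: "Re (cnj (of_real \<rho> * c * ?w j) * (of_real \<rho> * c * (?w j - ?p j)))
          = \<rho>\<^sup>2 * Re (cnj (?w j) * (?w j - ?p j))" .
      have "((\<rho> * W)\<^sup>2 - (\<rho> * P)\<^sup>2) * (2 * (\<rho>\<^sup>2 * R)) = 2 * \<rho> ^ 4 * ((W\<^sup>2 - P\<^sup>2) * R)" for W P R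
        by (simp add: power2_eq_square power4_eq_xxxx algebra_simps)
      then show ?thesis
        unfolding nz nb unfolding az diff Re .
    qed
    show ?thesis unfolding pr_D1_def * by (simp add: sum_distrib_left[symmetric])
  qed
  have nsq_wx: "\<rho>\<^sup>2 * nsq n (\<lambda>i. w i - x i) = nsq n (\<lambda>i. z i - c * zs i)"
  proof -
    have "(\<lambda>i. z i - c * zs i) = (\<lambda>i. of_real \<rho> * c * (w i - x i))"
      by (rule ext) (simp only: zw zs_def algebra_simps)
    then show ?thesis using \<rho> c by (simp add: nsq_scale norm_mult)
  qed
  have "2 * \<rho> ^ 4 / real m * (real m / 100 * nsq n (\<lambda>i. w i - x i))
     = \<rho>\<^sup>2 / 50 * nsq n (\<lambda>i. z i - c * zs i)"
    using m by (simp add: nsq_wx[symmetric] power2_eq_square power4_eq_xxxx)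
  moreover have "2 * \<rho> ^ 4 / real m * (real m / 100 * nsq n (\<lambda>i. w i - x i))
      \<le> pr_D1 n m a b z (\<lambda>i. z i - c * zs i)"
    unfolding D1 using key m \<rho> by (intro mult_left_mono) auto
  ultimately show ?thesis using c by (intro exI[of _ c]) simp
qed


text \<open>Keeps the iterates in a bounded set, on which the derivatives are Lipschitz.\<close>

lemma pr_loss_coercive:
  assumes m: "m \<ge> 1" and reg: "regular_sample n m a x"
  shows "\<exists>C. \<forall>z. (nsq n z)\<^sup>2 \<le> C + 8 * pr_loss n m a b z"
proof -
  define C where "C = 4 / real m * (\<Sum>j=1..m. (b j) ^ 4)"
  have "(nsq n z)\<^sup>2 \<le> C + 8 * pr_loss n m a b z" for z
  proof -
    have pt: "(cmod w) ^ 4 \<le> 2 * (cmod2 w - \<beta>\<^sup>2)\<^sup>2 + 2 * \<beta> ^ 4" for w and \<beta> :: real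
      using zero_le_power2[of "cmod2 w - 2 * \<beta>\<^sup>2"]
      by (simp add: power2_eq_square power4_eq_xxxx algebra_simps)
    have "real m * (nsq n z)\<^sup>2 \<le> real m * (199/100) * (nsq n z)\<^sup>2"
      by (simp add: mult_right_mono)
    also have "\<dots> \<le> (\<Sum>j=1..m. (cmod (ip n (a j) z)) ^ 4)"
      by (rule regular_quartic_lower[OF reg])
    also have "\<dots> \<le> (\<Sum>j=1..m. 2 * (cmod2 (ip n (a j) z) - (b j)\<^sup>2)\<^sup>2 + 2 * (b j) ^ 4)"
      by (intro sum_mono pt)
    also have "\<dots> = real m * (4 * pr_loss n m a b z + C / 2)"
      using m by (simp add: pr_loss_def C_def sum.distrib sum_distrib_left[symmetric] field_simps)
    finally have "(nsq n z)\<^sup>2 \<le> 4 * pr_loss n m a b z + C / 2" using m by simp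
    moreover have "pr_loss n m a b z \<ge> 0" by (simp add: pr_loss_def sum_nonneg)
    moreover have "C \<ge> 0" by (simp add: C_def sum_nonneg)
    ultimately show ?thesis by linarith
  qed
  then show ?thesis by blast
qed

section \<open>Minimisers of the cubic model\<close>

lemma average_lin:
  fixes t :: real
  shows "c * (\<Sum>j\<in>J. A j + t * B j) = c * (\<Sum>j\<in>J. A j) + t * (c * (\<Sum>j\<in>J. B j))"
  by (simp add: sum.distrib sum_distrib_left distrib_left mult_ac)

lemma pr_D1_line:
  "pr_D1 n m a b z (\<lambda>i. u i + of_real t * v i) = pr_D1 n m a b z u + t * pr_D1 n m a b z v"
proof -
  have *: "\<beta> * (2 * Re (cnj w * (p + of_real t * q)))
      = \<beta> * (2 * Re (cnj w * p)) + t * (\<beta> * (2 * Re (cnj w * q)))" for \<beta> w p q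
    by (simp add: algebra_simps)
  show ?thesis
    unfolding pr_D1_def ip_add ip_scale * by (rule average_lin)
qed

lemma pr_D2_line:
  "pr_D2 n m a b z (\<lambda>i. u i + of_real t * v i) (\<lambda>i. u i + of_real t * v i)
     = pr_D2 n m a b z u u + 2 * t * pr_D2 n m a b z u v + t\<^sup>2 * pr_D2 n m a b z v v"
proof -
  have *: "4 * Re (cnj w * (p + of_real t * q)) * Re (cnj w * (p + of_real t * q))
        + 2 * \<beta> * Re (cnj (p + of_real t * q) * (p + of_real t * q))
      = (4 * Re (cnj w * p) * Re (cnj w * p) + 2 * \<beta> * Re (cnj p * p))
      + 2 * t * (4 * Re (cnj w * p) * Re (cnj w * q) + 2 * \<beta> * Re (cnj p * q))
      + t\<^sup>2 * (4 * Re (cnj w * q) * Re (cnj w * q) + 2 * \<beta> * Re (cnj q * q))" for \<beta> w p q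
    by (simp add: power2_eq_square algebra_simps)
  show ?thesis
    unfolding pr_D2_def ip_add ip_scale * by (simp only: average_lin)
qed

lemma pr_D2_line_right:
  "pr_D2 n m a b z w (\<lambda>i. u i + of_real t * v i) = pr_D2 n m a b z w u + t * pr_D2 n m a b z w v"
proof -
  have *: "4 * Re (cnj w * r) * Re (cnj w * (p + of_real t * q)) + 2 * \<beta> * Re (cnj r * (p + of_real t * q))
      = (4 * Re (cnj w * r) * Re (cnj w * p) + 2 * \<beta> * Re (cnj r * p))
      + t * (4 * Re (cnj w * r) * Re (cnj w * q) + 2 * \<beta> * Re (cnj r * q))" for \<beta> w p q r
    by (simp add: algebra_simps)
  show ?thesis
    unfolding pr_D2_def ip_add ip_scale * by (simp only: average_lin)
qed

lemma pr_D2_sym: "pr_D2 n m a b z u v = pr_D2 n m a b z v u"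
proof -
  have *: "4 * Re (cnj w * p) * Re (cnj w * q) + 2 * \<beta> * Re (cnj p * q)
     = 4 * Re (cnj w * q) * Re (cnj w * p) + 2 * \<beta> * Re (cnj q * p)" for \<beta> w p q
    by (simp add: algebra_simps)
  show ?thesis unfolding pr_D2_def * ..
qed

lemma real_line: "(\<lambda>i. of_real t * v i :: complex) = (\<lambda>i. (\<lambda>_. 0) i + of_real t * v i)"
  by simp

lemma ip_0 [simp]: "ip n x (\<lambda>_. 0) = 0"
  by (simp add: ip_def)

lemma pr_D1_0 [simp]: "pr_D1 n m a b z (\<lambda>_. 0) = 0"
  by (simp add: pr_D1_def)

lemma pr_D2_0 [simp]: "pr_D2 n m a b z (\<lambda>_. 0) w = 0" "pr_D2 n m a b z w (\<lambda>_. 0) = 0"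
  by (simp_all add: pr_D2_def)

lemma pr_D1_scale: "pr_D1 n m a b z (\<lambda>i. of_real t * v i) = t * pr_D1 n m a b z v"
  by (subst real_line, subst pr_D1_line) simp

lemma pr_D2_scale: "pr_D2 n m a b z (\<lambda>i. of_real t * v i) (\<lambda>i. of_real t * v i) = t\<^sup>2 * pr_D2 n m a b z v v"
  by (subst (1 2) real_line, subst pr_D2_line) simp

lemma nrm_real_scale: "nrm n (\<lambda>i. of_real t * v i) = \<bar>t\<bar> * nrm n v"
  by (simp add: nrm_scale)

lemma nsq_line: "nsq n (\<lambda>i. u i + of_real t * v i) = nsq n u + 2 * t * Re (ip n u v) + t\<^sup>2 * nsq n v"
  by (simp add: nsq_add ip_scale nsq_scale)

lemma zero_of_quadratic_nonneg:
  fixes G C :: real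
  assumes "\<And>t. \<bar>t\<bar> \<le> 1 \<Longrightarrow> 0 \<le> t * G + C * t\<^sup>2"
  shows "G = 0"
proof (rule DERIV_local_min[of "\<lambda>t. t * G + C * t\<^sup>2" G 0 1])
  show "((\<lambda>t. t * G + C * t\<^sup>2) has_real_derivative G) (at 0)"
    by (auto intro!: derivative_eq_intros)
qed (use assms in auto)

text \<open>The cubic model without its constant term, in terms of the step \<open>h\<close>.\<close>

definition cmodel where
  "cmodel n m a b \<sigma> z h = pr_D1 n m a b z h + 1/2 * pr_D2 n m a b z h h + \<sigma> / 6 * nrm n h ^ 3"
  for b :: "nat \<Rightarrow> real" and \<sigma> :: real

text \<open>First-order optimality. The norm is not differentiable at \<open>s = 0\<close>, but its cube is of third order there and
  does not affect the linear term.\<close>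

lemma cmodel_stationary:
  assumes min: "\<And>h. cmodel n m a b \<sigma> z s \<le> cmodel n m a b \<sigma> z h" and \<sigma>: "\<sigma> \<ge> 0"
  shows "pr_D1 n m a b z h + pr_D2 n m a b z s h + \<sigma> / 2 * nrm n s * Re (ip n s h) = 0"
proof -
  let ?g = "pr_D1 n m a b z" and ?Q = "pr_D2 n m a b z"
  define N where "N t = nsq n s + 2 * t * Re (ip n s h) + t\<^sup>2 * nsq n h" for t
  have line: "cmodel n m a b \<sigma> z (\<lambda>i. s i + of_real t * h i)
     = ?g s + t * ?g h + 1/2 * (?Q s s + 2 * t * ?Q s h + t\<^sup>2 * ?Q h h) + \<sigma> / 6 * sqrt (N t) ^ 3" for t
    by (simp add: cmodel_def pr_D1_line pr_D2_line nrm_def nsq_line N_def)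
  define \<phi> where "\<phi> t = ?g s + t * ?g h + 1/2 * (?Q s s + 2 * t * ?Q s h + t\<^sup>2 * ?Q h h) + \<sigma> / 6 * sqrt (N t) ^ 3" for t
  have le: "\<phi> 0 \<le> \<phi> t" for t
    using min[of "\<lambda>i. s i + of_real t * h i"] unfolding line \<phi>_def
    by (simp add: cmodel_def N_def nrm_def)
  show ?thesis
  proof (cases "nsq n s = 0")
    case True
    then have ns: "nrm n s = 0" and ip: "ip n s h = 0"
      using ip_CS[of n s h] by (simp_all add: nrm_def)
    have "?g h + ?Q s h = 0"
    proof (rule zero_of_quadratic_nonneg)
      fix t :: real assume t: "\<bar>t\<bar> \<le> 1"
      have "sqrt (N t) = \<bar>t\<bar> * nrm n h" using True ip by (simp add: N_def nrm_def real_sqrt_mult)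
      moreover have "(\<bar>t\<bar> * nrm n h) ^ 3 \<le> t\<^sup>2 * nrm n h ^ 3"
        using t power_decreasing[of 2 3 "\<bar>t\<bar>"] by (simp add: power_mult_distrib mult_right_mono)
      then have "\<sigma> / 6 * (\<bar>t\<bar> * nrm n h) ^ 3 \<le> \<sigma> / 6 * (t\<^sup>2 * nrm n h ^ 3)"
        using \<sigma> by (intro mult_left_mono) auto
      moreover have "sqrt (N 0) = 0" using True by (simp add: N_def)
      ultimately show "0 \<le> t * (?g h + ?Q s h) + (1/2 * ?Q h h + \<sigma> / 6 * nrm n h ^ 3) * t\<^sup>2"
        using le[of t] by (simp add: \<phi>_def algebra_simps)
    qed
    then show ?thesis using ns by simp
  next
    case False
    then have pos: "nsq n s > 0" using nsq_nonneg[of n s] by linarith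
    have N0: "N 0 = nsq n s" by (simp add: N_def)
    have dN: "(N has_real_derivative 2 * Re (ip n s h)) (at 0)"
      unfolding N_def by (auto intro!: derivative_eq_intros)
    have "((\<lambda>t. sqrt (N t)) has_real_derivative (inverse (sqrt (N 0)) / 2) * (2 * Re (ip n s h))) (at 0)"
      by (rule DERIV_chain2[OF DERIV_real_sqrt dN]) (simp add: N0 pos)
    note d1 = this
    have "((\<lambda>t. sqrt (N t) ^ 3) has_real_derivative
        3 * sqrt (N 0) ^ 2 * ((inverse (sqrt (N 0)) / 2) * (2 * Re (ip n s h)))) (at 0)"
      by (rule DERIV_cong[OF DERIV_power[OF d1, of 3]]) simp
    also have "3 * sqrt (N 0) ^ 2 * ((inverse (sqrt (N 0)) / 2) * (2 * Re (ip n s h))) = 3 * nrm n s * Re (ip n s h)"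
      using pos by (simp add: N0 nrm_def divide_inverse[symmetric] real_div_sqrt)
    finally have d3: "((\<lambda>t. sqrt (N t) ^ 3) has_real_derivative 3 * nrm n s * Re (ip n s h)) (at 0)" .
    have "(\<phi> has_real_derivative ?g h + ?Q s h + \<sigma> / 2 * nrm n s * Re (ip n s h)) (at 0)"
    proof -
      have "((\<lambda>t. A + t * G + 1/2 * (B + 2 * t * Q + t\<^sup>2 * H) + \<sigma> / 6 * g t) has_real_derivative G + Q + \<sigma> / 6 * d) (at 0)"
        if "(g has_real_derivative d) (at 0)" for g d and A B G H Q :: real
        using that by (auto intro!: derivative_eq_intros)
      from this[OF d3] show ?thesis unfolding \<phi>_def by (rule DERIV_cong) simp
    qed
    then show ?thesis
      by (rule DERIV_local_min[where d = 1]) (use le in auto)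
  qed
qed

lemma cmodel_decrease:
  assumes min: "\<And>h. cmodel n m a b \<sigma> z s \<le> cmodel n m a b \<sigma> z h" and \<sigma>: "\<sigma> \<ge> 0"
  shows "cmodel n m a b \<sigma> z s \<le> - (\<sigma> / 12) * nrm n s ^ 3"
proof -
  have "pr_D1 n m a b z s + pr_D2 n m a b z s s + \<sigma> / 2 * nrm n s * Re (ip n s s) = 0"
    by (rule cmodel_stationary[OF min \<sigma>])
  then have st: "pr_D1 n m a b z s + pr_D2 n m a b z s s + \<sigma> / 2 * nrm n s ^ 3 = 0"
    by (simp add: ip_self nrm_sq[symmetric] power3_eq_cube power2_eq_square mult.assoc)
  \<comment> \<open>Comparing with the opposite step shows that the linear term is nonpositive.\<close>
  have "cmodel n m a b \<sigma> z s \<le> cmodel n m a b \<sigma> z (\<lambda>i. of_real (-1) * s i)"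
    by (rule min)
  then have "pr_D1 n m a b z s \<le> 0"
    unfolding cmodel_def pr_D1_scale pr_D2_scale nrm_real_scale by simp
  with st show ?thesis unfolding cmodel_def by (simp add: field_simps)
qed

text \<open>Averaging over the perturbations \<open>t h\<close> and \<open>- t h\<close>, of some length \<open>\<epsilon>\<close> not below that of the step, cancels
  the first-order terms. The cubes of the new norms are at most \<open>(2 \<epsilon>) ^ 3\<close>, and \<open>\<epsilon>\<close> may tend to the length of
  the step.\<close>

lemma cmodel_curvature:
  assumes min: "\<And>h. cmodel n m a b \<sigma> z s \<le> cmodel n m a b \<sigma> z h" and \<sigma>: "\<sigma> \<ge> 0"
  shows "pr_D2 n m a b z h h \<ge> - 3 * \<sigma> * nrm n s * nsq n h"
proof (cases "nsq n h = 0")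
  case True
  then have "ip n (a j) h = 0" for j by (rule nsq_zero_ip)
  then show ?thesis using True by (simp add: pr_D2_def)
next
  case False
  let ?Q = "pr_D2 n m a b z"
  have H: "nrm n h > 0" using False nsq_nonneg[of n h] by (simp add: nrm_def less_le)
  have bnd: "?Q h h \<ge> - 3 * \<sigma> * nsq n h * \<epsilon>" if \<epsilon>: "\<epsilon> > 0" "\<epsilon> \<ge> nrm n s" for \<epsilon>
  proof -
    define t where "t = \<epsilon> / nrm n h"
    have t: "t > 0" "t * nrm n h = \<epsilon>" using \<epsilon> H by (auto simp: t_def)
    have tri: "nrm n (\<lambda>i. s i + of_real \<tau> * h i) ^ 3 \<le> (2 * \<epsilon>) ^ 3" if "\<bar>\<tau>\<bar> = t" for \<tau>
    proof -
      have "nrm n (\<lambda>i. s i + of_real \<tau> * h i) \<le> nrm n s + \<bar>\<tau>\<bar> * nrm n h"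
        using nrm_triangle[of n s "\<lambda>i. of_real \<tau> * h i"] by (simp add: nrm_real_scale)
      also have "\<dots> \<le> 2 * \<epsilon>" using that t \<epsilon> by simp
      finally show ?thesis by (intro power_mono) auto
    qed
    have a1: "\<sigma> / 6 * nrm n (\<lambda>i. s i + of_real \<tau> * h i) ^ 3 \<le> \<sigma> / 6 * (2 * \<epsilon>) ^ 3" if "\<bar>\<tau>\<bar> = t" for \<tau>
      using \<sigma> tri[OF that] by (intro mult_left_mono) auto
    have m1: "cmodel n m a b \<sigma> z s \<le> cmodel n m a b \<sigma> z (\<lambda>i. s i + of_real t * h i)" by (rule min)
    have m2: "cmodel n m a b \<sigma> z s \<le> cmodel n m a b \<sigma> z (\<lambda>i. s i + of_real (- t) * h i)" by (rule min)
    have "0 \<le> \<sigma> / 6 * nrm n s ^ 3" using \<sigma> by simp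
    then have "0 \<le> t\<^sup>2 * ?Q h h + 2 * (\<sigma> / 6 * (2 * \<epsilon>) ^ 3)"
      using m1 m2 a1[of t] a1[of "-t"] t(1)
      unfolding cmodel_def pr_D1_line pr_D2_line by (simp add: field_simps)
    also have "2 * (\<sigma> / 6 * (2 * \<epsilon>) ^ 3) = t\<^sup>2 * (8/3 * \<sigma> * nsq n h * \<epsilon>)"
      unfolding t(2)[symmetric] nrm_sq[symmetric] by (simp add: power3_eq_cube power2_eq_square)
    finally have "0 \<le> t\<^sup>2 * (?Q h h + 8/3 * \<sigma> * nsq n h * \<epsilon>)" by (simp add: distrib_left)
    then have "0 \<le> ?Q h h + 8/3 * \<sigma> * nsq n h * \<epsilon>"
      using t by (simp add: zero_le_mult_iff)
    moreover have "0 \<le> \<sigma> * nsq n h * \<epsilon>" using \<sigma> \<epsilon> by simp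
    moreover have "8/3 * \<sigma> * nsq n h * \<epsilon> = 8/3 * (\<sigma> * nsq n h * \<epsilon>)"
        "- 3 * \<sigma> * nsq n h * \<epsilon> = - 3 * (\<sigma> * nsq n h * \<epsilon>)" by simp_all
    ultimately show ?thesis by linarith
  qed
  define K where "K = 3 * \<sigma> * nsq n h"
  have K: "K \<ge> 0" using \<sigma> by (simp add: K_def)
  have "- (K * nrm n s) \<le> ?Q h h"
  proof (rule field_le_epsilon)
    fix e :: real assume e: "e > 0"
    have "?Q h h \<ge> - 3 * \<sigma> * nsq n h * (nrm n s + e / (K + 1))"
      using e K nrm_nonneg[of n s] by (intro bnd) (auto intro: add_nonneg_pos)
    moreover have "3 * \<sigma> * nsq n h * (nrm n s + e / (K + 1)) = K * nrm n s + K * (e / (K + 1))"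
      by (simp add: K_def distrib_left)
    moreover have "K * (e / (K + 1)) \<le> e" using e K by (simp add: field_simps)
    ultimately show "- (K * nrm n s) \<le> ?Q h h + e" by linarith
  qed
  then show ?thesis by (simp add: K_def mult_ac)
qed

lemma ip_uniform_bound:
  fixes a :: "nat \<Rightarrow> nat \<Rightarrow> complex"
  obtains A where "A > 0" "\<And>j h. j \<in> {1..m} \<Longrightarrow> cmod (ip n (a j) h) \<le> A * nrm n h"
proof
  show "0 < 1 + (\<Sum>j=1..m. nrm n (a j))"
    by (simp add: add_pos_nonneg sum_nonneg)
  fix j h assume "j \<in> {1..m}"
  then have "nrm n (a j) \<le> (\<Sum>j=1..m. nrm n (a j))" by (intro member_le_sum) auto
  then have "nrm n (a j) * nrm n h \<le> (1 + (\<Sum>j=1..m. nrm n (a j))) * nrm n h"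
    by (intro mult_right_mono) auto
  with ip_CS[of n "a j" h] show "cmod (ip n (a j) h) \<le> (1 + (\<Sum>j=1..m. nrm n (a j))) * nrm n h"
    by linarith
qed

lemma average_abs_le:
  fixes X :: "nat \<Rightarrow> real"
  assumes m: "m \<ge> 1" and X: "\<And>j. j \<in> {1..m} \<Longrightarrow> \<bar>X j\<bar> \<le> B"
  shows "\<bar>1 / real m * (\<Sum>j=1..m. X j)\<bar> \<le> B"
proof -
  have "\<bar>\<Sum>j=1..m. X j\<bar> \<le> (\<Sum>j=1..m. \<bar>X j\<bar>)" by (rule sum_abs)
  also have "\<dots> \<le> real (card {1..m}) * B" by (rule sum_bounded_above) (use X in auto)
  finally show ?thesis using m by (simp add: abs_mult field_simps)
qed

text \<open>The loss is a quartic polynomial, so its Taylor remainders can be written down and estimated term by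
  term on bounded sets.\<close>

lemma pr_taylor_bounds:
  assumes m: "m \<ge> 1"
  shows "\<exists>C>0. \<forall>z s h. nrm n z \<le> R \<longrightarrow> nrm n s \<le> R \<longrightarrow>
    \<bar>pr_D1 n m a b (\<lambda>i. z i + s i) h - pr_D1 n m a b z h - pr_D2 n m a b z s h\<bar>
      \<le> C * (nrm n s)\<^sup>2 * nrm n h \<and>
    \<bar>pr_D2 n m a b (\<lambda>i. z i + s i) h h - pr_D2 n m a b z h h\<bar> \<le> C * nrm n s * nsq n h"
proof -
  obtain A where A: "A > 0" "\<And>j h. j \<in> {1..m} \<Longrightarrow> cmod (ip n (a j) h) \<le> A * nrm n h"
    using ip_uniform_bound by blast
  define C where "C = 1 + 18 * A ^ 4 * \<bar>R\<bar>"
  have C: "C > 0" using A by (simp add: C_def add_pos_nonneg)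
  show ?thesis
  proof (intro exI[of _ C] conjI allI impI C)
    fix z s h assume z: "nrm n z \<le> R" and s: "nrm n s \<le> R"
    have R: "R \<ge> 0" using z nrm_nonneg order.trans by blast
    let ?Z = "nrm n z" and ?S = "nrm n s" and ?H = "nrm n h"
    have CR: "18 * A ^ 4 * R * X \<le> C * X" if "X \<ge> 0" for X
      using that R by (intro mult_right_mono) (auto simp: C_def)
    show "\<bar>pr_D1 n m a b (\<lambda>i. z i + s i) h - pr_D1 n m a b z h - pr_D2 n m a b z s h\<bar> \<le> C * ?S\<^sup>2 * ?H"
    proof -
      let ?\<alpha> = "\<lambda>j. ip n (a j) z" and ?\<beta> = "\<lambda>j. ip n (a j) s" and ?\<gamma> = "\<lambda>j. ip n (a j) h"
      define X where "X j = 2 * cmod2 (?\<beta> j) * Re (cnj (?\<alpha> j) * ?\<gamma> j)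
        + 2 * (2 * Re (cnj (?\<alpha> j) * ?\<beta> j) + cmod2 (?\<beta> j)) * Re (cnj (?\<beta> j) * ?\<gamma> j)" for j
      have pt: "(cmod2 (\<alpha> + \<beta>) - B) * (2 * Re (cnj (\<alpha> + \<beta>) * \<gamma>))
          = (cmod2 \<alpha> - B) * (2 * Re (cnj \<alpha> * \<gamma>))
          + 1 * (4 * Re (cnj \<alpha> * \<beta>) * Re (cnj \<alpha> * \<gamma>) + 2 * (cmod2 \<alpha> - B) * Re (cnj \<beta> * \<gamma>))
          + 1 * (2 * cmod2 \<beta> * Re (cnj \<alpha> * \<gamma>)
            + 2 * (2 * Re (cnj \<alpha> * \<beta>) + cmod2 \<beta>) * Re (cnj \<beta> * \<gamma>))" for \<alpha> \<beta> \<gamma> :: complex and B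
        by (simp add: cmod_power2) (simp add: power2_eq_square algebra_simps)
      have "pr_D1 n m a b (\<lambda>i. z i + s i) h
          = pr_D1 n m a b z h + 1 * pr_D2 n m a b z s h + 1 * (1 / real m * (\<Sum>j=1..m. X j))"
        unfolding pr_D1_def pr_D2_def ip_add pt X_def by (simp only: average_lin)
      moreover have "\<bar>1 / real m * (\<Sum>j=1..m. X j)\<bar> \<le> C * ?S\<^sup>2 * ?H"
      proof (rule average_abs_le[OF m])
        fix j assume j: "j \<in> {1..m}"
        note re = abs_Re_cnj_le
        let ?u = "cmod (?\<alpha> j)" and ?v = "cmod (?\<beta> j)" and ?w = "cmod (?\<gamma> j)"
        have "\<bar>X j\<bar> \<le> 2 * ?v\<^sup>2 * (?u * ?w) + 2 * (2 * (?u * ?v) + ?v\<^sup>2) * (?v * ?w)"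
        proof -
          have "\<bar>X j\<bar> \<le> \<bar>2 * ?v\<^sup>2 * Re (cnj (?\<alpha> j) * ?\<gamma> j)\<bar>
            + \<bar>2 * (2 * Re (cnj (?\<alpha> j) * ?\<beta> j) + ?v\<^sup>2) * Re (cnj (?\<beta> j) * ?\<gamma> j)\<bar>"
            unfolding X_def by (rule abs_triangle_ineq)
          also have "\<bar>2 * ?v\<^sup>2 * Re (cnj (?\<alpha> j) * ?\<gamma> j)\<bar> \<le> 2 * ?v\<^sup>2 * (?u * ?w)"
            unfolding abs_mult by (intro mult_mono re) auto
          also have "\<bar>2 * (2 * Re (cnj (?\<alpha> j) * ?\<beta> j) + ?v\<^sup>2) * Re (cnj (?\<beta> j) * ?\<gamma> j)\<bar>
              \<le> 2 * (2 * (?u * ?v) + ?v\<^sup>2) * (?v * ?w)"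
          proof -
            have "\<bar>2 * Re (cnj (?\<alpha> j) * ?\<beta> j) + ?v\<^sup>2\<bar> \<le> 2 * (?u * ?v) + ?v\<^sup>2"
              using re[of "?\<alpha> j" "?\<beta> j"] by (intro order.trans[OF abs_triangle_ineq]) auto
            then show ?thesis unfolding abs_mult by (intro mult_mono re) auto
          qed
          finally show ?thesis by simp
        qed
        also have "\<dots> = 6 * (?u * ?v\<^sup>2 * ?w) + 2 * (?v ^ 3 * ?w)"
          by (simp add: power2_eq_square power3_eq_cube algebra_simps)
        also have "\<dots> \<le> 6 * ((A * ?Z) * (A * ?S)\<^sup>2 * (A * ?H)) + 2 * ((A * ?S) ^ 3 * (A * ?H))"
          using A j by (intro add_mono mult_left_mono mult_mono power_mono) auto
        also have "\<dots> = A ^ 4 * (6 * ?Z + 2 * ?S) * (?S\<^sup>2 * ?H)"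
          by (simp add: power2_eq_square power3_eq_cube power4_eq_xxxx algebra_simps)
        also have "\<dots> \<le> A ^ 4 * (18 * R) * (?S\<^sup>2 * ?H)"
          using z s R A by (intro mult_right_mono mult_left_mono) auto
        also have "\<dots> = 18 * A ^ 4 * R * (?S\<^sup>2 * ?H)" by simp
        also have "\<dots> \<le> C * (?S\<^sup>2 * ?H)" by (rule CR) simp
        finally show "\<bar>X j\<bar> \<le> C * ?S\<^sup>2 * ?H" by (simp add: mult.assoc)
      qed
      ultimately show ?thesis by simp
    qed
    show "\<bar>pr_D2 n m a b (\<lambda>i. z i + s i) h h - pr_D2 n m a b z h h\<bar> \<le> C * ?S * nsq n h"
    proof -
      let ?\<alpha> = "\<lambda>j. ip n (a j) z" and ?\<beta> = "\<lambda>j. ip n (a j) s" and ?\<gamma> = "\<lambda>j. ip n (a j) h"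
      define X where "X j = 4 * Re (cnj (?\<beta> j) * ?\<gamma> j) * (2 * Re (cnj (?\<alpha> j) * ?\<gamma> j) + Re (cnj (?\<beta> j) * ?\<gamma> j))
        + 2 * (2 * Re (cnj (?\<alpha> j) * ?\<beta> j) + cmod2 (?\<beta> j)) * cmod2 (?\<gamma> j)" for j
      have pt: "4 * Re (cnj (\<alpha> + \<beta>) * \<gamma>) * Re (cnj (\<alpha> + \<beta>) * \<gamma>) + 2 * (cmod2 (\<alpha> + \<beta>) - B) * Re (cnj \<gamma> * \<gamma>)
          = (4 * Re (cnj \<alpha> * \<gamma>) * Re (cnj \<alpha> * \<gamma>) + 2 * (cmod2 \<alpha> - B) * Re (cnj \<gamma> * \<gamma>))
          + 1 * (4 * Re (cnj \<beta> * \<gamma>) * (2 * Re (cnj \<alpha> * \<gamma>) + Re (cnj \<beta> * \<gamma>))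
        + 2 * (2 * Re (cnj \<alpha> * \<beta>) + cmod2 \<beta>) * cmod2 \<gamma>)" for \<alpha> \<beta> \<gamma> :: complex and B
        by (simp add: cmod_power2) (simp add: power2_eq_square algebra_simps)
      have "pr_D2 n m a b (\<lambda>i. z i + s i) h h
          = pr_D2 n m a b z h h + 1 * (1 / real m * (\<Sum>j=1..m. X j))"
        unfolding pr_D2_def ip_add pt X_def by (simp only: average_lin)
      moreover have "\<bar>1 / real m * (\<Sum>j=1..m. X j)\<bar> \<le> C * ?S * nsq n h"
      proof (rule average_abs_le[OF m])
        fix j assume j: "j \<in> {1..m}"
        note re = abs_Re_cnj_le
        let ?u = "cmod (?\<alpha> j)" and ?v = "cmod (?\<beta> j)" and ?w = "cmod (?\<gamma> j)"
        have "\<bar>X j\<bar> \<le> 4 * (?v * ?w) * (2 * (?u * ?w) + ?v * ?w) + 2 * (2 * (?u * ?v) + ?v\<^sup>2) * ?w\<^sup>2"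
        proof -
          have "\<bar>X j\<bar> \<le> \<bar>4 * Re (cnj (?\<beta> j) * ?\<gamma> j) * (2 * Re (cnj (?\<alpha> j) * ?\<gamma> j) + Re (cnj (?\<beta> j) * ?\<gamma> j))\<bar>
            + \<bar>2 * (2 * Re (cnj (?\<alpha> j) * ?\<beta> j) + ?v\<^sup>2) * ?w\<^sup>2\<bar>"
            unfolding X_def by (rule abs_triangle_ineq)
          also have "\<bar>4 * Re (cnj (?\<beta> j) * ?\<gamma> j) * (2 * Re (cnj (?\<alpha> j) * ?\<gamma> j) + Re (cnj (?\<beta> j) * ?\<gamma> j))\<bar>
             \<le> 4 * (?v * ?w) * (2 * (?u * ?w) + ?v * ?w)"
          proof -
            have "\<bar>2 * Re (cnj (?\<alpha> j) * ?\<gamma> j) + Re (cnj (?\<beta> j) * ?\<gamma> j)\<bar> \<le> 2 * (?u * ?w) + ?v * ?w"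
              using re[of "?\<alpha> j" "?\<gamma> j"] re[of "?\<beta> j" "?\<gamma> j"]
              by (intro order.trans[OF abs_triangle_ineq] add_mono) auto
            then show ?thesis unfolding abs_mult by (intro mult_mono re) auto
          qed
          also have "\<bar>2 * (2 * Re (cnj (?\<alpha> j) * ?\<beta> j) + ?v\<^sup>2) * ?w\<^sup>2\<bar>
              \<le> 2 * (2 * (?u * ?v) + ?v\<^sup>2) * ?w\<^sup>2"
          proof -
            have "\<bar>2 * Re (cnj (?\<alpha> j) * ?\<beta> j) + ?v\<^sup>2\<bar> \<le> 2 * (?u * ?v) + ?v\<^sup>2"
              using re[of "?\<alpha> j" "?\<beta> j"] by (intro order.trans[OF abs_triangle_ineq]) auto
            then show ?thesis unfolding abs_mult by (intro mult_mono) auto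
          qed
          finally show ?thesis by simp
        qed
        also have "\<dots> = 12 * (?u * ?v * ?w\<^sup>2) + 6 * (?v\<^sup>2 * ?w\<^sup>2)"
          by (simp add: power2_eq_square algebra_simps)
        also have "\<dots> \<le> 12 * ((A * ?Z) * (A * ?S) * (A * ?H)\<^sup>2) + 6 * ((A * ?S)\<^sup>2 * (A * ?H)\<^sup>2)"
          using A j by (intro add_mono mult_left_mono mult_mono power_mono) auto
        also have "\<dots> = A ^ 4 * (12 * ?Z + 6 * ?S) * (?S * ?H\<^sup>2)"
          by (simp add: power2_eq_square power4_eq_xxxx algebra_simps)
        also have "\<dots> \<le> A ^ 4 * (18 * R) * (?S * ?H\<^sup>2)"
          using z s R A by (intro mult_right_mono mult_left_mono) auto
        also have "\<dots> = 18 * A ^ 4 * R * (?S * ?H\<^sup>2)" by simp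
        also have "\<dots> \<le> C * (?S * ?H\<^sup>2)" by (rule CR) simp
        finally show "\<bar>X j\<bar> \<le> C * ?S * nsq n h" by (simp add: mult.assoc nrm_sq)
      qed
      ultimately show ?thesis by simp
    qed
  qed
qed

section \<open>Quadratic convergence of the iterates\<close>

lemma pr_stationary_at_phase:
  fixes n m :: nat and a :: "nat \<Rightarrow> nat \<Rightarrow> complex" and zs :: "nat \<Rightarrow> complex"
  assumes "cmod c = 1"
  defines "b \<equiv> \<lambda>j. cmod (ip n (a j) zs)"
  shows "pr_D1 n m a b (\<lambda>i. c * zs i) h = 0" "pr_D2 n m a b (\<lambda>i. c * zs i) h h \<ge> 0"
proof -
  have eq: "cmod (ip n (a j) (\<lambda>i. c * zs i)) = b j" for j
    using assms by (simp add: ip_scale norm_mult)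
  show "pr_D1 n m a b (\<lambda>i. c * zs i) h = 0"
    unfolding pr_D1_def eq by simp
  show "pr_D2 n m a b (\<lambda>i. c * zs i) h h \<ge> 0"
    unfolding pr_D2_def eq by (simp add: mult.assoc sum_nonneg del: times_complex.sel)
qed

text \<open>A cubic step is at most a constant times the distance to any second-order critical point \<open>X\<close>, although
  the second derivative may be singular at \<open>X\<close>: the cubic term supplies the missing convexity.\<close>

lemma cubic_step_length:
  assumes taylor: "\<And>z s h. nrm n z \<le> R \<Longrightarrow> nrm n s \<le> R \<Longrightarrow>
      \<bar>pr_D1 n m a b (\<lambda>i. z i + s i) h - pr_D1 n m a b z h - pr_D2 n m a b z s h\<bar>
        \<le> C * (nrm n s)\<^sup>2 * nrm n h \<and>
      \<bar>pr_D2 n m a b (\<lambda>i. z i + s i) h h - pr_D2 n m a b z h h\<bar> \<le> C * nrm n s * nsq n h"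
    and C: "C > 0"
    and min: "\<And>h. cmodel n m a b \<sigma> z s \<le> cmodel n m a b \<sigma> z h"
    and \<sigma>: "0 < \<sigma>\<^sub>0" "\<sigma>\<^sub>0 \<le> \<sigma>"
    and stat: "\<And>h. pr_D1 n m a b X h = 0" "\<And>h. pr_D2 n m a b X h h \<ge> 0"
    and R: "nrm n z \<le> R" "nrm n (\<lambda>i. X i - z i) \<le> R"
  shows "nrm n s \<le> (4 * C / \<sigma>\<^sub>0 + 4) * nrm n (\<lambda>i. z i - X i)"
proof (rule ccontr)
  \<comment> \<open>A step longer than the claim would dominate the curvature error \<open>C d\<close>; testing stationarity with
    \<open>h = s - y\<close> then bounds \<open>h\<close>, hence \<open>s\<close>, by a multiple of \<open>d\<close>.\<close>
  define y where "y = (\<lambda>i. X i - z i)"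
  define h where "h = (\<lambda>i. s i - y i)"
  define d S H where "d = nrm n y" and "S = nrm n s" and "H = nrm n h"
  have nn: "d \<ge> 0" "S \<ge> 0" "H \<ge> 0" by (simp_all add: d_def S_def H_def)
  have zy: "(\<lambda>i. z i + y i) = X" by (simp add: y_def)
  have s_hy: "(\<lambda>i. y i + of_real 1 * h i) = s" "(\<lambda>i. h i + y i) = s" by (simp_all add: h_def)
  assume "\<not> nrm n s \<le> (4 * C / \<sigma>\<^sub>0 + 4) * nrm n (\<lambda>i. z i - X i)"
  then have large: "S > (4 * C / \<sigma>\<^sub>0 + 4) * d"
    by (simp add: S_def d_def y_def nrm_minus_commute[of n z])
  have tri: "S \<le> H + d" using nrm_triangle[of n h y] unfolding s_hy by (simp add: S_def H_def d_def)
  have Kd: "4 * C / \<sigma>\<^sub>0 * d \<ge> 0" using C \<sigma> nn by simp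
  have S: "S > 0" and S4: "S > 4 * d" using large Kd nn by (simp_all add: distrib_right)
  have H: "H > 3 * d" using S4 tri by linarith
  have Cd: "C * d \<le> \<sigma> * S / 4"
  proof -
    have "4 * C / \<sigma>\<^sub>0 * d \<le> S" using large nn by (simp add: distrib_right)
    then have "C * d \<le> \<sigma>\<^sub>0 * S / 4" using \<sigma> by (simp add: field_simps)
    also have "\<dots> \<le> \<sigma> * S / 4" using \<sigma> nn by (simp add: mult_right_mono)
    finally show ?thesis .
  qed
  have t1: "\<bar>pr_D1 n m a b X h - pr_D1 n m a b z h - pr_D2 n m a b z y h\<bar> \<le> C * d\<^sup>2 * H"
    and t2: "\<bar>pr_D2 n m a b X h h - pr_D2 n m a b z h h\<bar> \<le> C * d * nsq n h"
    using taylor[of z y h] R unfolding zy by (simp_all add: y_def[symmetric] d_def H_def)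
  have "pr_D1 n m a b z h + pr_D2 n m a b z s h + \<sigma> / 2 * nrm n s * Re (ip n s h) = 0"
    using \<sigma> by (intro cmodel_stationary min) auto
  moreover have "pr_D2 n m a b z s h = pr_D2 n m a b z y h + pr_D2 n m a b z h h"
    using pr_D2_line_right[of n m a b z h y 1 h] unfolding s_hy by (simp add: pr_D2_sym)
  moreover have "Re (ip n s h) = H\<^sup>2 + Re (ip n y h)"
    using arg_cong[OF s_hy(2), of "\<lambda>f. ip n f h"] by (simp add: ip_add_left ip_self H_def nrm_sq flip: s_hy(2))
  ultimately have eq: "pr_D1 n m a b z h + pr_D2 n m a b z y h + pr_D2 n m a b z h h
      + \<sigma> / 2 * S * (H\<^sup>2 + Re (ip n y h)) = 0"
    by (simp add: S_def)
  have ipy: "Re (ip n y h) \<ge> - (d * H)"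
    using ip_CS[of n y h] abs_Re_le_cmod[of "ip n y h"] by (simp add: d_def H_def)
  have "\<sigma> / 2 * S * (H\<^sup>2 - d * H) \<le> \<sigma> / 2 * S * (H\<^sup>2 + Re (ip n y h))"
    using ipy \<sigma> nn by (intro mult_left_mono) auto
  then have "\<sigma> / 2 * S * (H\<^sup>2 - d * H) \<le> C * d\<^sup>2 * H + C * d * H\<^sup>2"
    using eq t1 t2 stat(1)[of h] stat(2)[of h] by (simp add: H_def nrm_sq)
  also have "\<dots> = (C * d) * (d * H + H\<^sup>2)" by (simp add: power2_eq_square algebra_simps)
  also have "\<dots> \<le> \<sigma> * S / 4 * (d * H + H\<^sup>2)" using Cd nn by (intro mult_right_mono) auto
  finally have "\<sigma> * S * H * H \<le> \<sigma> * S * H * (3 * d)" by (simp add: power2_eq_square field_simps)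
  moreover have "\<sigma> * S * H > 0" using \<sigma> S H nn by (intro mult_pos_pos) auto
  ultimately have "H \<le> 3 * d" by (simp only: mult_le_cancel_left_pos)
  with H show False by simp
qed

text \<open>Steps that keep halving sum to at most twice the first one.\<close>

lemma halving_steps_tail:
  assumes half: "\<And>k. k \<ge> K \<Longrightarrow> nrm n (\<lambda>i. Z (Suc (Suc k)) i - Z (Suc k) i) \<le> nrm n (\<lambda>i. Z (Suc k) i - Z k i) / 2"
    and k: "k \<ge> K"
  shows "nrm n (\<lambda>i. Z (k + l) i - Z k i) \<le> 2 * nrm n (\<lambda>i. Z (Suc k) i - Z k i)
      - 2 * nrm n (\<lambda>i. Z (Suc (k + l)) i - Z (k + l) i)"
proof (induction l)
  case 0
  then show ?case by (simp add: nrm_def nsq_def)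
next
  case (Suc l)
  let ?S = "\<lambda>k. nrm n (\<lambda>i. Z (Suc k) i - Z k i)"
  have "(\<lambda>i. Z (k + Suc l) i - Z k i) = (\<lambda>i. (Z (Suc (k + l)) i - Z (k + l) i) + (Z (k + l) i - Z k i))"
    by simp
  then have "nrm n (\<lambda>i. Z (k + Suc l) i - Z k i) \<le> ?S (k + l) + nrm n (\<lambda>i. Z (k + l) i - Z k i)"
    using nrm_triangle[of n "\<lambda>i. Z (Suc (k + l)) i - Z (k + l) i" "\<lambda>i. Z (k + l) i - Z k i"] by simp
  also have "\<dots> \<le> 2 * ?S k - ?S (k + l)" using Suc.IH by simp
  also have "\<dots> \<le> 2 * ?S k - 2 * ?S (k + Suc l)" using half[of "k + l"] k by simp
  finally show ?case .
qed

lemma nrm_triangle_diff: "nrm n (\<lambda>i. z i - w i) \<le> nrm n (\<lambda>i. z i - v i) + nrm n (\<lambda>i. v i - w i)"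
  using nrm_triangle[of n "\<lambda>i. z i - v i" "\<lambda>i. v i - w i"] by simp

text \<open>Steps tend to zero, so the new iterates become almost second-order critical and the landscape bounds
  their distance to the orbit by a multiple of the squared step. The next step is at most a multiple of this
  distance. Hence the step lengths converge quadratically to zero, and the iterates have a limit.\<close>

lemma cubic_iterates_converge:
  fixes n m :: nat and a :: "nat \<Rightarrow> nat \<Rightarrow> complex" and x :: "nat \<Rightarrow> complex"
    and \<rho> :: real and Z :: "nat \<Rightarrow> nat \<Rightarrow> complex" and \<sigma> :: "nat \<Rightarrow> real"
  assumes m: "m \<ge> 1" and \<rho>: "\<rho> > 0" and x: "nsq n x = 1"
    and reg: "regular_sample n m a x"
  defines "zs \<equiv> \<lambda>i. of_real \<rho> * x i"
  defines "b \<equiv> \<lambda>j. cmod (ip n (a j) zs)"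
  defines "s \<equiv> \<lambda>k i. Z (Suc k) i - Z k i"
  assumes \<sigma>: "0 < \<sigma>\<^sub>0" "\<And>k. \<sigma>\<^sub>0 \<le> \<sigma> k" "\<And>k. \<sigma> k \<le> \<sigma>\<^sub>1"
    and min: "\<And>k h. cmodel n m a b (\<sigma> k) (Z k) (s k) \<le> cmodel n m a b (\<sigma> k) (Z k) h"
    and dec: "\<And>k. pr_loss n m a b (Z (Suc k)) \<le> pr_loss n m a b (Z k) + cmodel n m a b (\<sigma> k) (Z k) (s k)"
  shows "\<exists>c M. cmod c = 1 \<and> M > 0 \<and> (\<lambda>k. nrm n (\<lambda>i. Z k i - c * zs i)) \<longlonglongrightarrow> 0 \<and>
     (\<forall>\<^sub>F k in sequentially. nrm n (\<lambda>i. Z (Suc k) i - c * zs i) \<le> M * (nrm n (\<lambda>i. Z k i - c * zs i))\<^sup>2)"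
proof -
  define S where "S k = nrm n (s k)" for k
  have S0: "S k \<ge> 0" for k by (simp add: S_def)
  have \<sigma>0: "\<sigma> k > 0" for k using \<sigma>(1) \<sigma>(2)[of k] by linarith
  let ?f = "pr_loss n m a b" and ?D1 = "pr_D1 n m a b" and ?D2 = "pr_D2 n m a b"
  have f0: "?f z \<ge> 0" for z by (simp add: pr_loss_def sum_nonneg)
  have drop: "?f (Z (Suc k)) + \<sigma>\<^sub>0 / 12 * S k ^ 3 \<le> ?f (Z k)" for k
  proof -
    have "cmodel n m a b (\<sigma> k) (Z k) (s k) \<le> - (\<sigma> k / 12) * S k ^ 3"
      unfolding S_def using \<sigma>0[of k] by (intro cmodel_decrease min) auto
    moreover have "\<sigma>\<^sub>0 / 12 * S k ^ 3 \<le> \<sigma> k / 12 * S k ^ 3"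
      using \<sigma>(2)[of k] S0[of k] by (intro mult_right_mono) auto
    ultimately show ?thesis using dec[of k] by linarith
  qed
  \<comment> \<open>The decreases add up to at most the initial loss, so the cubes of the steps are summable.\<close>
  have part: "?f (Z N) + (\<Sum>k<N. \<sigma>\<^sub>0 / 12 * S k ^ 3) \<le> ?f (Z 0)" for N
  proof (induction N)
    case (Suc N)
    then show ?case using drop[of N] by simp
  qed simp
  have "summable (\<lambda>k. \<sigma>\<^sub>0 / 12 * S k ^ 3)"
  proof (rule summableI_nonneg_bounded)
    show "0 \<le> \<sigma>\<^sub>0 / 12 * S k ^ 3" for k using \<sigma>(1) S0[of k] by simp
    show "(\<Sum>k<N. \<sigma>\<^sub>0 / 12 * S k ^ 3) \<le> ?f (Z 0)" for N
      using part[of N] f0[of "Z N"] by linarith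
  qed
  then have "(\<lambda>k. \<sigma>\<^sub>0 / 12 * S k ^ 3) \<longlonglongrightarrow> 0" by (rule summable_LIMSEQ_zero)
  from tendsto_mult_left[OF this, of "12 / \<sigma>\<^sub>0"] have "(\<lambda>k. S k ^ 3) \<longlonglongrightarrow> 0"
    using \<sigma>(1) by simp
  then have Slim: "S \<longlonglongrightarrow> 0"
    using tendsto_real_root[of "\<lambda>k. S k ^ 3" 0 sequentially 3] S0 by (simp add: real_root_power_cancel)
  have mono: "?f (Z k) \<le> ?f (Z 0)" for k
    using part[of k] sum_nonneg[of "{..<k}" "\<lambda>k. \<sigma>\<^sub>0 / 12 * S k ^ 3"] \<sigma>(1) S0 by simp
  obtain C0 where C0: "\<And>z. (nsq n z)\<^sup>2 \<le> C0 + 8 * ?f z"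
    using pr_loss_coercive[OF m reg] by blast
  define B where "B = 1 + \<bar>C0 + 8 * ?f (Z 0)\<bar>"
  have B: "nrm n (Z k) \<le> B" for k
  proof -
    have "(nsq n (Z k))\<^sup>2 \<le> C0 + 8 * ?f (Z 0)" using C0[of "Z k"] mono[of k] by linarith
    also have "\<dots> \<le> B" by (simp add: B_def)
    also have "\<dots> \<le> B\<^sup>2" using self_le_power[of B 2] by (simp add: B_def)
    finally have "nsq n (Z k) \<le> B" by (rule power2_le_imp_le) (simp add: B_def)
    also have "\<dots> \<le> B\<^sup>2" using self_le_power[of B 2] by (simp add: B_def)
    finally have "(nrm n (Z k))\<^sup>2 \<le> B\<^sup>2" by (simp add: nrm_sq)
    then show ?thesis by (rule power2_le_imp_le) (simp add: B_def)
  qed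
  have nzs: "nrm n zs = \<rho>"
    using \<rho> x by (simp add: zs_def nrm_scale) (simp add: nrm_def)
  have nczs: "nrm n (\<lambda>i. c * zs i) = \<rho>" if "cmod c = 1" for c
    using that by (simp add: nrm_scale nzs)
  define R where "R = 2 * B + \<rho>"
  have B0: "B \<ge> 0" by (simp add: B_def)
  have RZ: "nrm n (Z k) \<le> R" for k using B[of k] B0 \<rho> by (simp add: R_def)
  have triminus: "nrm n (\<lambda>i. u i - v i) \<le> nrm n u + nrm n v" for u v
    using nrm_triangle[of n u "\<lambda>i. - v i"] by (simp add: nrm_def nsq_def)
  have Rs: "nrm n (s k) \<le> R" for k
    using triminus[of "Z (Suc k)" "Z k"] B[of k] B[of "Suc k"] \<rho> by (simp add: R_def s_def)
  have Ry: "nrm n (\<lambda>i. c * zs i - Z k i) \<le> R" if "cmod c = 1" for c k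
    using triminus[of "\<lambda>i. c * zs i" "Z k"] nczs[OF that] B[of k] B0 by (simp add: R_def)
  obtain C where C: "C > 0" and taylor: "\<And>z s h. nrm n z \<le> R \<Longrightarrow> nrm n s \<le> R \<Longrightarrow>
      \<bar>?D1 (\<lambda>i. z i + s i) h - ?D1 z h - ?D2 z s h\<bar> \<le> C * (nrm n s)\<^sup>2 * nrm n h \<and>
      \<bar>?D2 (\<lambda>i. z i + s i) h h - ?D2 z h h\<bar> \<le> C * nrm n s * nsq n h"
    using pr_taylor_bounds[OF m, of n R a b] by blast
  have Zs: "(\<lambda>i. Z k i + s k i) = Z (Suc k)" for k by (simp add: s_def)
  define K where "K = 4 * C / \<sigma>\<^sub>0 + 4"
  have K: "K > 0" using C \<sigma>(1) by (simp add: K_def add_pos_pos)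
  \<comment> \<open>\<open>K\<close> bounds a step by the distance to any point of the orbit, whatever its phase.\<close>
  have step: "S k \<le> K * nrm n (\<lambda>i. Z k i - c * zs i)" if c: "cmod c = 1" for c k
    unfolding S_def K_def
    by (rule cubic_step_length[OF taylor C min \<sigma>(1) \<sigma>(2)])
      (use pr_stationary_at_phase[OF c, of n m a zs] RZ Ry[OF c] in \<open>simp_all add: b_def\<close>)
  have \<sigma>1: "\<sigma>\<^sub>1 > 0" using \<sigma>0[of 0] \<sigma>(3)[of 0] by linarith
  \<comment> \<open>After a short step the new iterate is almost second-order critical: its gradient is quadratic
    and its negative curvature linear in the step.\<close>
  have curv: "?D2 (Z (Suc k)) h h \<ge> - ((3 * \<sigma>\<^sub>1 + C) * S k * nsq n h)" for k h
  proof -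
    have "?D2 (Z k) h h \<ge> - 3 * \<sigma> k * S k * nsq n h"
      unfolding S_def using \<sigma>0[of k] by (intro cmodel_curvature min) auto
    moreover have "\<sigma> k * (S k * nsq n h) \<le> \<sigma>\<^sub>1 * (S k * nsq n h)"
      using \<sigma>(3)[of k] S0[of k] by (intro mult_right_mono) auto
    moreover have "\<bar>?D2 (Z (Suc k)) h h - ?D2 (Z k) h h\<bar> \<le> C * S k * nsq n h"
      using taylor[OF RZ[of k] Rs[of k], of h] unfolding Zs by (simp add: S_def)
    ultimately show ?thesis by (simp add: algebra_simps)
  qed
  have grad: "\<bar>?D1 (Z (Suc k)) h\<bar> \<le> (\<sigma>\<^sub>1 / 2 + C) * (S k)\<^sup>2 * nrm n h" for k h
  proof -
    have st: "?D1 (Z k) h + ?D2 (Z k) (s k) h + \<sigma> k / 2 * nrm n (s k) * Re (ip n (s k) h) = 0"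
      using \<sigma>0[of k] by (intro cmodel_stationary min) auto
    have "\<bar>\<sigma> k / 2 * nrm n (s k) * Re (ip n (s k) h)\<bar> \<le> \<sigma>\<^sub>1 / 2 * S k * (S k * nrm n h)"
      unfolding abs_mult S_def using \<sigma>0[of k] \<sigma>(3)[of k] ip_CS[of n "s k" h] abs_Re_le_cmod[of "ip n (s k) h"]
      by (intro mult_mono) auto
    moreover have "\<bar>?D1 (Z (Suc k)) h - ?D1 (Z k) h - ?D2 (Z k) (s k) h\<bar> \<le> C * (S k)\<^sup>2 * nrm n h"
      using taylor[OF RZ[of k] Rs[of k], of h] unfolding Zs by (simp add: S_def)
    ultimately have "\<bar>?D1 (Z (Suc k)) h\<bar> \<le> \<sigma>\<^sub>1 / 2 * S k * (S k * nrm n h) + C * (S k)\<^sup>2 * nrm n h"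
      using st by linarith
    then show ?thesis by (simp add: power2_eq_square algebra_simps)
  qed
  \<comment> \<open>Below this step length the curvature bound meets the hypothesis of the landscape lemma.\<close>
  define \<theta> where "\<theta> = \<rho>\<^sup>2 / (50 * (3 * \<sigma>\<^sub>1 + C))"
  have \<theta>: "\<theta> > 0" using \<rho> \<sigma>1 C by (simp add: \<theta>_def)
  define C1 where "C1 = 50 * (\<sigma>\<^sub>1 / 2 + C) / \<rho>\<^sup>2"
  have C1: "C1 > 0" using \<rho> \<sigma>1 C by (simp add: C1_def add_pos_pos)
  have near: "\<exists>c. cmod c = 1 \<and> nrm n (\<lambda>i. Z (Suc k) i - c * zs i) \<le> C1 * (S k)\<^sup>2" if small: "S k \<le> \<theta>" for k
  proof -
    have "(3 * \<sigma>\<^sub>1 + C) * S k \<le> (3 * \<sigma>\<^sub>1 + C) * \<theta>"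
      using small \<sigma>1 C by (intro mult_left_mono) auto
    also have "\<dots> = \<rho>\<^sup>2 / 50"
    proof -
      have "q * (r / (50 * q)) = r / 50" if "q > 0" for q r :: real using that by simp
      from this[of "3 * \<sigma>\<^sub>1 + C" "\<rho>\<^sup>2"] show ?thesis using \<sigma>1 C unfolding \<theta>_def by linarith
    qed
    finally have "(3 * \<sigma>\<^sub>1 + C) * S k * \<rho>\<^sup>2 \<le> \<rho>\<^sup>2 / 50 * \<rho>\<^sup>2"
      by (intro mult_right_mono) auto
    then have b1: "(3 * \<sigma>\<^sub>1 + C) * S k * \<rho>\<^sup>2 \<le> \<rho> ^ 4 / 50" by (simp add: power2_eq_square power4_eq_xxxx)
    have nsqs: "nsq n zs = \<rho>\<^sup>2" "nsq n (\<lambda>i. \<i> * zs i) = \<rho>\<^sup>2"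
      using nzs by (simp_all add: nsq_scale nrm_sq[symmetric])
    have "?D2 (Z (Suc k)) zs zs + ?D2 (Z (Suc k)) (\<lambda>i. \<i> * zs i) (\<lambda>i. \<i> * zs i) \<ge> - (\<rho> ^ 4 / 25)"
      using curv[of k zs] curv[of k "\<lambda>i. \<i> * zs i"] b1 unfolding nsqs by linarith
    from landscape[OF m \<rho> x reg this[unfolded b_def zs_def]] obtain c where c: "cmod c = 1"
      and lb: "\<rho>\<^sup>2 / 50 * nsq n (\<lambda>i. Z (Suc k) i - c * zs i) \<le> ?D1 (Z (Suc k)) (\<lambda>i. Z (Suc k) i - c * zs i)"
      unfolding b_def zs_def by blast
    let ?d = "nrm n (\<lambda>i. Z (Suc k) i - c * zs i)"
    have "\<rho>\<^sup>2 / 50 * ?d\<^sup>2 \<le> (\<sigma>\<^sub>1 / 2 + C) * (S k)\<^sup>2 * ?d"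
      using lb grad[of k "\<lambda>i. Z (Suc k) i - c * zs i"] by (simp add: nrm_sq)
    then have "?d * ?d \<le> ?d * (C1 * (S k)\<^sup>2)"
      using \<rho> by (simp add: C1_def field_simps power2_eq_square)
    then have "?d \<le> C1 * (S k)\<^sup>2"
      using C1 nrm_nonneg[of n "\<lambda>i. Z (Suc k) i - c * zs i"]
      by (cases "?d = 0") (auto simp: mult_le_cancel_left less_le)
    with c show ?thesis by blast
  qed
  define C2 where "C2 = K * C1"
  have C2: "C2 > 0" using K C1 by (simp add: C2_def)
  have "\<forall>\<^sub>F k in sequentially. S k < Min {\<theta>, 1 / (2 * C2)}"
    using order_tendstoD(2)[OF Slim, of "Min {\<theta>, 1 / (2 * C2)}"] \<theta> C2 by simp
  then obtain N where "\<And>k. k \<ge> N \<Longrightarrow> S k < Min {\<theta>, 1 / (2 * C2)}"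
    unfolding eventually_sequentially by blast
  then have N: "S k \<le> \<theta> \<and> S k \<le> 1 / (2 * C2)" if "k \<ge> N" for k
    using less_imp_le[of "S k" "Min {\<theta>, 1 / (2 * C2)}"] that by simp
  have "\<forall>k. \<exists>c. cmod c = 1 \<and> (k \<ge> N \<longrightarrow> nrm n (\<lambda>i. Z (Suc k) i - c * zs i) \<le> C1 * (S k)\<^sup>2)"
    using near N by (metis norm_one)
  then obtain c where c: "\<And>k. cmod (c k) = 1"
    and dc: "\<And>k. k \<ge> N \<Longrightarrow> nrm n (\<lambda>i. Z (Suc k) i - c k * zs i) \<le> C1 * (S k)\<^sup>2" by metis
  have quad: "S (Suc k) \<le> C2 * (S k)\<^sup>2" if "k \<ge> N" for k
  proof -
    have "S (Suc k) \<le> K * nrm n (\<lambda>i. Z (Suc k) i - c k * zs i)" by (rule step[OF c])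
    also have "\<dots> \<le> K * (C1 * (S k)\<^sup>2)" using dc[OF that] K by (intro mult_left_mono) auto
    finally show ?thesis by (simp add: C2_def)
  qed
  have half: "S (Suc k) \<le> S k / 2" if "k \<ge> N" for k
  proof -
    have "C2 * S k \<le> 1 / 2" using N[OF that] C2 by (simp add: field_simps)
    then have "C2 * S k * S k \<le> 1 / 2 * S k" using S0[of k] by (intro mult_right_mono) auto
    with quad[OF that] show ?thesis by (simp add: power2_eq_square mult.assoc)
  qed
  have tail: "nrm n (\<lambda>i. Z (k + l) i - Z k i) \<le> 2 * S k" if "k \<ge> N" for k l
  proof -
    have "nrm n (\<lambda>i. Z (k + l) i - Z k i) \<le> 2 * S k - 2 * S (k + l)"
      using halving_steps_tail[where Z = Z and n = n and K = N and k = k and l = l] half that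
      by (simp add: S_def s_def)
    with S0[of "k + l"] show ?thesis by linarith
  qed
  \<comment> \<open>The phases may depend on the iterate; the circle is compact, so they accumulate at one phase,
    and the geometric tail bound turns convergence of the subsequence into convergence.\<close>
  have "compact (sphere (0::complex) 1)" by simp
  moreover have "\<forall>k. c k \<in> sphere 0 1" using c by simp
  ultimately obtain c' r where c': "c' \<in> sphere 0 1" and r: "strict_mono (r :: nat \<Rightarrow> nat)" and lim: "(c \<circ> r) \<longlonglongrightarrow> c'"
    unfolding compact_eq_seq_compact_metric seq_compact_def by metis
  have c'1: "cmod c' = 1" using c' by simp
  have sub: "(\<lambda>l. nrm n (\<lambda>i. Z (Suc (r l)) i - c' * zs i)) \<longlonglongrightarrow> 0"
  proof (rule Lim_null_comparison)
    show "\<forall>\<^sub>F l in sequentially. norm (nrm n (\<lambda>i. Z (Suc (r l)) i - c' * zs i))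
        \<le> C1 * (S (r l))\<^sup>2 + cmod (c (r l) - c') * \<rho>"
      using eventually_ge_at_top[of N]
    proof eventually_elim
      case (elim l)
      have "(\<lambda>i. c (r l) * zs i - c' * zs i) = (\<lambda>i. (c (r l) - c') * zs i)"
        by (simp add: algebra_simps)
      then have "nrm n (\<lambda>i. c (r l) * zs i - c' * zs i) = cmod (c (r l) - c') * \<rho>"
        by (simp add: nrm_scale nzs)
      moreover have "r l \<ge> N" using elim seq_suble[OF r, of l] by linarith
      ultimately show ?case
        using nrm_triangle_diff[of n "Z (Suc (r l))" "\<lambda>i. c' * zs i" "\<lambda>i. c (r l) * zs i"] dc[of "r l"]
        by simp
    qed
    have "(\<lambda>l. S (r l)) \<longlonglongrightarrow> 0" using LIMSEQ_subseq_LIMSEQ[OF Slim r] by (simp add: o_def)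
    moreover have "(\<lambda>l. c (r l)) \<longlonglongrightarrow> c'" using lim by (simp add: o_def)
    then have "(\<lambda>l. cmod (c (r l) - c')) \<longlonglongrightarrow> 0" by (simp add: LIM_zero tendsto_norm_zero)
    ultimately have "(\<lambda>l. C1 * (S (r l))\<^sup>2 + cmod (c (r l) - c') * \<rho>) \<longlonglongrightarrow> C1 * 0\<^sup>2 + 0 * \<rho>"
      by (intro tendsto_intros)
    then show "(\<lambda>l. C1 * (S (r l))\<^sup>2 + cmod (c (r l) - c') * \<rho>) \<longlonglongrightarrow> 0" by simp
  qed
  have dist: "nrm n (\<lambda>i. Z k i - c' * zs i) \<le> 2 * S k" if k: "k \<ge> N" for k
  proof -
    have "(\<lambda>l. 2 * S k + nrm n (\<lambda>i. Z (Suc (r l)) i - c' * zs i)) \<longlonglongrightarrow> 2 * S k + 0"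
      by (intro tendsto_intros sub)
    moreover have "\<forall>l\<ge>k. nrm n (\<lambda>i. Z k i - c' * zs i) \<le> 2 * S k + nrm n (\<lambda>i. Z (Suc (r l)) i - c' * zs i)"
    proof (intro allI impI)
      fix l assume "l \<ge> k"
      then have "Suc (r l) \<ge> k" using seq_suble[OF r, of l] by linarith
      then obtain p where "Suc (r l) = k + p" using le_Suc_ex by blast
      then show "nrm n (\<lambda>i. Z k i - c' * zs i) \<le> 2 * S k + nrm n (\<lambda>i. Z (Suc (r l)) i - c' * zs i)"
        using nrm_triangle_diff[of n "Z k" "\<lambda>i. c' * zs i" "Z (k + p)"] tail[OF k, of p]
        by (simp add: nrm_minus_commute[of n "Z k"])
    qed
    ultimately show ?thesis
      using LIMSEQ_le_const[of _ "2 * S k + 0" "nrm n (\<lambda>i. Z k i - c' * zs i)"] by auto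
  qed
  show ?thesis
  proof (intro exI[of _ c'] exI[of _ "2 * C2 * K\<^sup>2"] conjI c'1)
    show "2 * C2 * K\<^sup>2 > 0" using C2 K by simp
    show "(\<lambda>k. nrm n (\<lambda>i. Z k i - c' * zs i)) \<longlonglongrightarrow> 0"
    proof (rule Lim_null_comparison)
      show "\<forall>\<^sub>F k in sequentially. norm (nrm n (\<lambda>i. Z k i - c' * zs i)) \<le> 2 * S k"
        using eventually_ge_at_top[of N] by eventually_elim (use dist in simp)
      show "(\<lambda>k. 2 * S k) \<longlonglongrightarrow> 0" using tendsto_mult_left[OF Slim, of 2] by simp
    qed
    show "\<forall>\<^sub>F k in sequentially. nrm n (\<lambda>i. Z (Suc k) i - c' * zs i)
        \<le> 2 * C2 * K\<^sup>2 * (nrm n (\<lambda>i. Z k i - c' * zs i))\<^sup>2"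
      using eventually_ge_at_top[of N]
    proof eventually_elim
      case (elim k)
      have "nrm n (\<lambda>i. Z (Suc k) i - c' * zs i) \<le> 2 * S (Suc k)" using elim by (intro dist) simp
      also have "\<dots> \<le> 2 * C2 * (S k)\<^sup>2" using quad[OF elim] by simp
      also have "\<dots> \<le> 2 * C2 * (K * nrm n (\<lambda>i. Z k i - c' * zs i))\<^sup>2"
        using step[OF c'1, of k] S0[of k] C2 by (intro mult_left_mono power_mono) auto
      finally show ?case by (simp add: power_mult_distrib)
    qed
  qed
qed

section \<open>Gradient, Hessian and iterates as real vectors\<close>

text \<open>Identifies a real vector of dimension \<open>2 n\<close> with a complex one; the value 0 beyond \<open>n\<close> makes the
  identification additive as an equality of functions.\<close>

definition cvec :: "nat \<Rightarrow> real vec \<Rightarrow> nat \<Rightarrow> complex" where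
  "cvec n u = (\<lambda>i. if i < n then Complex (u $ i) (u $ (n + i)) else 0)"

definition rvec :: "nat \<Rightarrow> (nat \<Rightarrow> complex) \<Rightarrow> real vec" where
  "rvec n h = vec (2 * n) (\<lambda>k. if k < n then Re (h k) else Im (h (k - n)))"

lemma rvec_carrier: "rvec n h \<in> carrier_vec (2 * n)"
  by (simp add: rvec_def)

lemma cvec_rvec: "i < n \<Longrightarrow> cvec n (rvec n h) i = h i"
  by (simp add: cvec_def rvec_def complex_eq_iff)

lemma cvec_add:
  "u \<in> carrier_vec (2 * n) \<Longrightarrow> v \<in> carrier_vec (2 * n) \<Longrightarrow> cvec n (u + v) = (\<lambda>i. cvec n u i + cvec n v i)"
  by (auto simp: cvec_def fun_eq_iff complex_eq_iff)

lemma cvec_diff: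
  "u \<in> carrier_vec (2 * n) \<Longrightarrow> v \<in> carrier_vec (2 * n) \<Longrightarrow> cvec n (u - v) = (\<lambda>i. cvec n u i - cvec n v i)"
  by (auto simp: cvec_def fun_eq_iff complex_eq_iff)

lemma cvec_smult:
  "v \<in> carrier_vec (2 * n) \<Longrightarrow> cvec n (t \<cdot>\<^sub>v v) = (\<lambda>i. of_real t * cvec n v i)"
  by (auto simp: cvec_def fun_eq_iff complex_eq_iff)

lemma sum_double:
  fixes g :: "nat \<Rightarrow> 'a::comm_monoid_add"
  shows "(\<Sum>k<2 * n. g k) = (\<Sum>i<n. g i + g (n + i))"
proof -
  have "(\<Sum>k<2 * n. g k) = (\<Sum>k=0..<n. g k) + (\<Sum>k=n..<2 * n. g k)"
    by (subst sum.atLeastLessThan_concat) (auto simp: atLeast0LessThan)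
  also have "(\<Sum>k=n..<2 * n. g k) = (\<Sum>k=0..<n. g (n + k))"
    using sum.shift_bounds_nat_ivl[of g 0 n n] by (simp add: add.commute mult_2)
  finally show ?thesis by (simp add: sum.distrib atLeast0LessThan)
qed

lemma nrm_cvec: "u \<in> carrier_vec (2 * n) \<Longrightarrow> nrm n (cvec n u) = vec_enorm u"
  unfolding nrm_L2 vec_enorm_def L2_set_def
  by (simp add: cvec_def sum_double cmod_power2)

lemma vec_dist_cvec:
  assumes "u \<in> carrier_vec (2 * n)" "v \<in> carrier_vec (2 * n)"
  shows "vec_dist (2 * n) u v = nrm n (\<lambda>i. cvec n u i - cvec n v i)"
  using assms by (simp add: vec_dist_eq_enorm cvec_diff[symmetric] nrm_cvec)

lemma scalar_prod_ip:
  assumes "v \<in> carrier_vec n" "w \<in> carrier_vec n"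
  shows "v \<bullet>c w = ip n (($) w) (($) v)"
  using assms by (simp add: scalar_prod_def ip_def atLeast0LessThan mult.commute)

lemma objective_cvec:
  assumes u: "u \<in> carrier_vec (2 * n)" and a: "\<And>j. j \<in> {1..m} \<Longrightarrow> a j \<in> carrier_vec n"
  shows "phase_retrieval_objective m n a b u = pr_loss n m (\<lambda>j. ($) (a j)) b (cvec n u)"
proof -
  have "complex_of_pair n u \<bullet>c a j = ip n (($) (a j)) (cvec n u)" if "j \<in> {1..m}" for j
  proof -
    have "complex_of_pair n u \<bullet>c a j = ip n (($) (a j)) (($) (complex_of_pair n u))"
      using a[OF that] by (intro scalar_prod_ip) (auto simp: complex_of_pair_def)
    also have "\<dots> = ip n (($) (a j)) (cvec n u)"
      using u by (intro ip_cong) (auto simp: complex_of_pair_def cvec_def vec_first_def vec_last_def)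
    finally show ?thesis .
  qed
  then show ?thesis by (simp add: phase_retrieval_objective_def pr_loss_def)
qed

lemma pr_loss_deriv:
  "((\<lambda>t. pr_loss n m a b (\<lambda>i. z i + of_real t * h i)) has_real_derivative pr_D1 n m a b z h) (at 0)"
proof -
  have *: "cmod (p + of_real t * q) ^ 2 = cmod p ^ 2 + 2 * t * Re (cnj p * q) + t\<^sup>2 * cmod q ^ 2" for p q t
    by (simp add: cmod_power2) (simp add: power2_eq_square algebra_simps)
  have d: "((\<lambda>t. (cmod2 p + 2 * t * R + t\<^sup>2 * Q - B)\<^sup>2) has_real_derivative 2 * ((cmod2 p - B) * (2 * R))) (at 0)"
    for p :: complex and R Q B :: real
    by (auto intro!: derivative_eq_intros)
  have "((\<lambda>t. 1 / (2 * real m) * (\<Sum>j=1..m. (cmod2 (ip n (a j) z) + 2 * t * Re (cnj (ip n (a j) z) * ip n (a j) h)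
        + t\<^sup>2 * cmod2 (ip n (a j) h) - (b j)\<^sup>2)\<^sup>2)) has_real_derivative
     1 / (2 * real m) * (\<Sum>j=1..m. 2 * ((cmod2 (ip n (a j) z) - (b j)\<^sup>2) * (2 * Re (cnj (ip n (a j) z) * ip n (a j) h))))) (at 0)"
    by (intro DERIV_cmult DERIV_sum d)
  then show ?thesis
    unfolding pr_loss_def ip_add ip_scale * pr_D1_def
    by (rule DERIV_cong) (simp add: sum_distrib_left[symmetric])
qed

lemma pr_D1_deriv:
  "((\<lambda>t. pr_D1 n m a b (\<lambda>i. z i + of_real t * h i) k) has_real_derivative pr_D2 n m a b z h k) (at 0)"
proof -
  have *: "(cmod (p + of_real t * q) ^ 2 - B) * (2 * Re (cnj (p + of_real t * q) * r))
     = (cmod p ^ 2 + 2 * t * Re (cnj p * q) + t\<^sup>2 * cmod q ^ 2 - B) * (2 * (Re (cnj p * r) + t * Re (cnj q * r)))"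
    for p q r t and B :: real
    by (simp add: cmod_power2) (simp add: power2_eq_square algebra_simps)
  have d: "((\<lambda>t. (P + 2 * t * R + t\<^sup>2 * Q - B) * (2 * (U + t * V))) has_real_derivative
      4 * R * U + 2 * (P - B) * V) (at 0)" for P R Q B U V :: real
    by (auto intro!: derivative_eq_intros)
  show ?thesis
    unfolding pr_D1_def ip_add ip_scale * pr_D2_def
    by (intro DERIV_cmult DERIV_sum d)
qed

lemma partial_deriv_loss:
  fixes F :: "real vec \<Rightarrow> real"
  assumes F: "\<And>u. u \<in> carrier_vec (2 * n) \<Longrightarrow> F u = pr_loss n m a b (cvec n u)"
    and u: "u \<in> carrier_vec (2 * n)"
  shows "partial_deriv (2 * n) k F u = pr_D1 n m a b (cvec n u) (cvec n (unit_vec (2 * n) k))"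
proof -
  have "(\<lambda>t. F (u + t \<cdot>\<^sub>v unit_vec (2 * n) k))
      = (\<lambda>t. pr_loss n m a b (\<lambda>i. cvec n u i + of_real t * cvec n (unit_vec (2 * n) k) i))"
    using u by (simp add: F cvec_add cvec_smult)
  then show ?thesis
    unfolding partial_deriv_def by (simp add: DERIV_imp_deriv[OF pr_loss_deriv])
qed

lemma partial_deriv_loss2:
  fixes F :: "real vec \<Rightarrow> real"
  assumes F: "\<And>u. u \<in> carrier_vec (2 * n) \<Longrightarrow> F u = pr_loss n m a b (cvec n u)"
    and u: "u \<in> carrier_vec (2 * n)"
  shows "partial_deriv (2 * n) k (partial_deriv (2 * n) l F) u
     = pr_D2 n m a b (cvec n u) (cvec n (unit_vec (2 * n) k)) (cvec n (unit_vec (2 * n) l))"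
proof -
  have "(\<lambda>t. partial_deriv (2 * n) l F (u + t \<cdot>\<^sub>v unit_vec (2 * n) k))
      = (\<lambda>t. pr_D1 n m a b (\<lambda>i. cvec n u i + of_real t * cvec n (unit_vec (2 * n) k) i) (cvec n (unit_vec (2 * n) l)))"
    using u by (simp add: partial_deriv_loss[OF F] cvec_add cvec_smult)
  then show ?thesis
    by (subst partial_deriv_def) (simp add: DERIV_imp_deriv[OF pr_D1_deriv])
qed

lemma pr_D1_sum:
  "finite K \<Longrightarrow> pr_D1 n m a b z (\<lambda>i. \<Sum>k\<in>K. of_real (c k) * e k i) = (\<Sum>k\<in>K. c k * pr_D1 n m a b z (e k))"
proof (induction K rule: finite_induct)
  case (insert x K)
  have "(\<lambda>i. \<Sum>k\<in>insert x K. of_real (c k) * e k i)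
      = (\<lambda>i. (\<Sum>k\<in>K. of_real (c k) * e k i) + of_real (c x) * e x i)"
    using insert by (simp add: add.commute)
  then show ?case using insert by (simp add: pr_D1_line)
qed simp

lemma pr_D2_sum:
  "finite K \<Longrightarrow> pr_D2 n m a b z w (\<lambda>i. \<Sum>k\<in>K. of_real (c k) * e k i) = (\<Sum>k\<in>K. c k * pr_D2 n m a b z w (e k))"
proof (induction K rule: finite_induct)
  case (insert x K)
  have "(\<lambda>i. \<Sum>k\<in>insert x K. of_real (c k) * e k i)
      = (\<lambda>i. (\<Sum>k\<in>K. of_real (c k) * e k i) + of_real (c x) * e x i)"
    using insert by (simp add: add.commute)
  then show ?case using insert by (simp add: pr_D2_line_right)
qed simp

lemma cvec_expand:
  assumes "h \<in> carrier_vec (2 * n)"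
  shows "cvec n h = (\<lambda>i. \<Sum>k\<in>{..<2 * n}. of_real (h $ k) * cvec n (unit_vec (2 * n) k) i)"
proof
  fix i
  show "cvec n h i = (\<Sum>k\<in>{..<2 * n}. of_real (h $ k) * cvec n (unit_vec (2 * n) k) i)"
  proof (cases "i < n")
    case True
    have "(\<Sum>k\<in>{..<2 * n}. of_real (h $ k) * cvec n (unit_vec (2 * n) k) i)
      = (\<Sum>k\<in>{..<2 * n}. (if k = i then of_real (h $ k) else 0) + (if k = n + i then \<i> * of_real (h $ k) else 0))"
      using True by (intro sum.cong) (auto simp: cvec_def complex_eq_iff)
    also have "\<dots> = of_real (h $ i) + \<i> * of_real (h $ (n + i))"
      using True by (simp add: sum.distrib)
    also have "\<dots> = cvec n h i" using True by (simp add: cvec_def complex_eq_iff)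
    finally show ?thesis by simp
  qed (simp add: cvec_def)
qed

lemma gradient_loss:
  fixes F :: "real vec \<Rightarrow> real"
  assumes F: "\<And>u. u \<in> carrier_vec (2 * n) \<Longrightarrow> F u = pr_loss n m a b (cvec n u)"
    and u: "u \<in> carrier_vec (2 * n)" and h: "h \<in> carrier_vec (2 * n)"
  shows "gradient (2 * n) F u \<bullet> h = pr_D1 n m a b (cvec n u) (cvec n h)"
proof -
  have "pr_D1 n m a b (cvec n u) (cvec n h)
      = (\<Sum>k\<in>{..<2 * n}. h $ k * pr_D1 n m a b (cvec n u) (cvec n (unit_vec (2 * n) k)))"
    by (subst cvec_expand[OF h]) (simp add: pr_D1_sum)
  moreover have "gradient (2 * n) F u \<bullet> h = (\<Sum>k\<in>{..<2 * n}. h $ k * partial_deriv (2 * n) k F u)"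
    using h by (auto simp: scalar_prod_def gradient_def atLeast0LessThan mult.commute carrier_vecD intro!: sum.cong)
  ultimately show ?thesis by (simp add: partial_deriv_loss[OF F u])
qed

lemma hessian_loss:
  fixes F :: "real vec \<Rightarrow> real"
  assumes F: "\<And>u. u \<in> carrier_vec (2 * n) \<Longrightarrow> F u = pr_loss n m a b (cvec n u)"
    and u: "u \<in> carrier_vec (2 * n)" and h: "h \<in> carrier_vec (2 * n)"
  shows "h \<bullet> (hessian (2 * n) F u *\<^sub>v h) = pr_D2 n m a b (cvec n u) (cvec n h) (cvec n h)"
proof -
  let ?e = "\<lambda>k. cvec n (unit_vec (2 * n) k)" and ?D = "pr_D2 n m a b (cvec n u)"
  have r: "?D w (cvec n h) = (\<Sum>l\<in>{..<2 * n}. h $ l * ?D w (?e l))" for w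
    by (subst cvec_expand[OF h]) (simp add: pr_D2_sum)
  have "?D (cvec n h) (cvec n h) = (\<Sum>k\<in>{..<2 * n}. h $ k * ?D (cvec n h) (?e k))"
    by (rule r)
  also have "\<dots> = (\<Sum>k\<in>{..<2 * n}. h $ k * (\<Sum>l\<in>{..<2 * n}. h $ l * ?D (?e k) (?e l)))"
    by (simp only: pr_D2_sym[of n m a b "cvec n u" "cvec n h"] r)
  also have "\<dots> = h \<bullet> (hessian (2 * n) F u *\<^sub>v h)"
  proof -
    have pd: "partial_deriv (2 * n) k (partial_deriv (2 * n) l F) u = ?D (?e k) (?e l)" for k l
      by (rule partial_deriv_loss2) (use F u in auto)
    have dim: "dim_vec h = 2 * n" using h by (rule carrier_vecD)
    have "(hessian (2 * n) F u *\<^sub>v h) $ k = (\<Sum>l\<in>{..<2 * n}. h $ l * ?D (?e k) (?e l))" if "k < 2 * n" for k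
    proof -
      have "(hessian (2 * n) F u *\<^sub>v h) $ k = (\<Sum>l\<in>{..<2 * n}. ?D (?e k) (?e l) * h $ l)"
        using that dim by (simp add: scalar_prod_def hessian_def atLeast0LessThan pd)
      then show ?thesis by (simp only: mult.commute[of "h $ _"])
    qed
    then show ?thesis by (simp add: scalar_prod_def[of h] hessian_def[of "2 * n" F u, THEN arg_cong[of _ _ dim_row]] atLeast0LessThan)
  qed
  finally show ?thesis by simp
qed

text \<open>The gradient and the Hessian are defined by iterated partial derivatives; linearity of the derivative
  forms assembles them from the unit vectors.\<close>

lemma cubic_model_loss:
  fixes F :: "real vec \<Rightarrow> real"
  assumes F: "\<And>u. u \<in> carrier_vec (2 * n) \<Longrightarrow> F u = pr_loss n m a b (cvec n u)"
    and u: "u \<in> carrier_vec (2 * n)" and p: "p \<in> carrier_vec (2 * n)"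
  shows "cubic_model (2 * n) F \<sigma> u p
    = F u + cmodel n m a b \<sigma> (cvec n u) (\<lambda>i. cvec n p i - cvec n u i)"
proof -
  have h: "p - u \<in> carrier_vec (2 * n)" using u p by simp
  have "gradient (2 * n) F u \<bullet> (p - u) = pr_D1 n m a b (cvec n u) (cvec n (p - u))"
    by (rule gradient_loss) (use F u h in auto)
  moreover have "(p - u) \<bullet> (hessian (2 * n) F u *\<^sub>v (p - u)) = pr_D2 n m a b (cvec n u) (cvec n (p - u)) (cvec n (p - u))"
    by (rule hessian_loss) (use F u h in auto)
  ultimately show ?thesis
    by (simp add: cubic_model_def cmodel_def nrm_cvec[OF h, symmetric] cvec_diff[OF p u])
qed

lemma cmodel_cong:
  assumes "\<And>i. i < n \<Longrightarrow> h i = h' i"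
  shows "cmodel n m a b \<sigma> z h = cmodel n m a b \<sigma> z h'"
  unfolding cmodel_def pr_D1_def pr_D2_def nrm_def
  using assms by (simp only: ip_cong[of n h h'] nsq_cong[of n h h'])

lemma normalised_signal:
  assumes "zstar \<in> carrier_vec n" "zstar \<noteq> 0\<^sub>v n"
  shows "nrm n (($) zstar) > 0" "nsq n (\<lambda>i. zstar $ i / of_real (nrm n (($) zstar))) = 1"
proof -
  have "nsq n (($) zstar) \<noteq> 0"
  proof
    assume "nsq n (($) zstar) = 0"
    then have "\<forall>i<n. zstar $ i = 0" by (simp add: nsq_def sum_nonneg_eq_0_iff)
    then have "zstar = 0\<^sub>v n" using assms(1) by (intro eq_vecI) auto
    with assms(2) show False by simp
  qed
  then show pos: "nrm n (($) zstar) > 0"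
    using nsq_nonneg[of n "($) zstar"] by (simp add: nrm_def less_le)
  have "(\<lambda>i. zstar $ i / of_real (nrm n (($) zstar))) = (\<lambda>i. of_real (1 / nrm n (($) zstar)) * zstar $ i)"
    by simp
  then have "nsq n (\<lambda>i. zstar $ i / of_real (nrm n (($) zstar)))
      = cmod2 (of_real (1 / nrm n (($) zstar))) * nsq n (($) zstar)"
    by (simp only: nsq_scale)
  also have "\<dots> = 1" using pos by (simp add: nrm_sq[symmetric] power_divide norm_divide)
  finally show "nsq n (\<lambda>i. zstar $ i / of_real (nrm n (($) zstar))) = 1" .
qed

text \<open>The deterministic half of the theorem: translates a run of the method into the coordinates of the
  preceding section and the limit back into a point of the orbit.\<close>

lemma cr_sequence_converges:
  assumes m: "m \<ge> 1" and z: "zstar \<in> carrier_vec n" "zstar \<noteq> 0\<^sub>v n"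
    and a: "\<And>j. j \<in> {1..m} \<Longrightarrow> a j \<in> carrier_vec n"
    and reg: "regular_sample n m (\<lambda>j. ($) (a j)) (\<lambda>i. zstar $ i / of_real (nrm n (($) zstar)))"
  defines "b \<equiv> \<lambda>j. cmod (zstar \<bullet>c a j)"
  defines "f \<equiv> phase_retrieval_objective m n a b"
  assumes u0: "u0 \<in> carrier_vec (2 * n)" and cr: "CR_sequence (2 * n) f u0 u"
  shows "\<exists>w \<in> phase_orbit (map_vec Re zstar) (map_vec Im zstar). Q_quadratic_convergent (2 * n) u w"
proof -
  define \<rho> where "\<rho> = nrm n (($) zstar)"
  define x where "x = (\<lambda>i. zstar $ i / of_real \<rho>)"
  let ?a = "\<lambda>j. ($) (a j)"
  have \<rho>: "\<rho> > 0" using normalised_signal(1)[OF z] by (simp add: \<rho>_def)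
  have zs: "(\<lambda>i. of_real \<rho> * x i) = ($) zstar" using \<rho> by (simp add: x_def)
  have x1: "nsq n x = 1" using normalised_signal(2)[OF z] by (simp add: x_def \<rho>_def)
  define b' where "b' = (\<lambda>j. cmod (ip n (?a j) (\<lambda>i. of_real \<rho> * x i)))"
  have b': "b j = b' j" if "j \<in> {1..m}" for j
    unfolding b_def b'_def zs using scalar_prod_ip[OF z(1) a[OF that]] by simp
  have F: "f v = pr_loss n m ?a b' (cvec n v)" if "v \<in> carrier_vec (2 * n)" for v
    using objective_cvec[OF that, where a = a and m = m and b = b] a b' by (simp add: f_def pr_loss_def)
  from cr obtain S L \<sigma>min \<sigma> where start: "u 0 = u0" and CRs: "CR_setup (2 * n) f u0 S L \<sigma>min"
    and it: "\<And>k. \<sigma>min \<le> \<sigma> k \<and> \<sigma> k \<le> 2 * L \<and>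
             is_arg_min (cubic_model (2 * n) f (\<sigma> k) (u k)) (\<lambda>p. p \<in> carrier_vec (2 * n)) (u (Suc k)) \<and>
             f (u (Suc k)) \<le> cubic_model_min (2 * n) f (\<sigma> k) (u k)"
    unfolding CR_sequence_def by blast
  have car: "u k \<in> carrier_vec (2 * n)" for k
    using it[of "k - 1"] u0 start by (cases k) (auto simp: is_arg_min_def)
  define Z where "Z = (\<lambda>k. cvec n (u k))"
  have model: "cubic_model (2 * n) f (\<sigma> k) (u k) p
      = f (u k) + cmodel n m ?a b' (\<sigma> k) (Z k) (\<lambda>i. cvec n p i - Z k i)" if "p \<in> carrier_vec (2 * n)" for k p
    unfolding Z_def by (rule cubic_model_loss[OF F car that])
  have opt: "cubic_model (2 * n) f (\<sigma> k) (u k) (u (Suc k)) \<le> cubic_model (2 * n) f (\<sigma> k) (u k) p"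
    if "p \<in> carrier_vec (2 * n)" for k p
    using it[of k] that by (auto simp: is_arg_min_def not_less)
  have min: "cmodel n m ?a b' (\<sigma> k) (Z k) (\<lambda>i. Z (Suc k) i - Z k i) \<le> cmodel n m ?a b' (\<sigma> k) (Z k) h" for k h
  proof -
    have "u k + rvec n h \<in> carrier_vec (2 * n)" using car rvec_carrier by simp
    from opt[OF this, of k] model[OF this, of k] model[OF car, of k "Suc k"]
    have "cmodel n m ?a b' (\<sigma> k) (Z k) (\<lambda>i. Z (Suc k) i - Z k i)
        \<le> cmodel n m ?a b' (\<sigma> k) (Z k) (\<lambda>i. cvec n (u k + rvec n h) i - Z k i)"
      by (simp add: Z_def)
    also have "\<dots> = cmodel n m ?a b' (\<sigma> k) (Z k) h"
      by (rule cmodel_cong) (simp add: Z_def cvec_add car rvec_carrier cvec_rvec)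
    finally show ?thesis .
  qed
  have dec: "pr_loss n m ?a b' (Z (Suc k)) \<le> pr_loss n m ?a b' (Z k)
      + cmodel n m ?a b' (\<sigma> k) (Z k) (\<lambda>i. Z (Suc k) i - Z k i)" for k
  proof -
    have "cubic_model_min (2 * n) f (\<sigma> k) (u k) \<le> cubic_model (2 * n) f (\<sigma> k) (u k) (u (Suc k))"
      unfolding cubic_model_min_def
      by (rule cINF_lower[OF bdd_belowI2[OF opt] car])
    then show ?thesis
      using it[of k] model[OF car, of k "Suc k"] F[OF car, of k] F[OF car, of "Suc k"] by (simp add: Z_def)
  qed
  have \<sigma>pos: "\<sigma>min > 0" using CRs by (simp add: CR_setup_def)
  have "regular_sample n m ?a x" using reg by (simp add: x_def \<rho>_def)
  from cubic_iterates_converge[where Z = Z and \<sigma> = \<sigma> and a = ?a and \<sigma>\<^sub>0 = \<sigma>min and \<sigma>\<^sub>1 = "2 * L",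
      OF m \<rho> x1 this \<sigma>pos _ _ min[unfolded b'_def] dec[unfolded b'_def]] it
  obtain c M where c: "cmod c = 1" and M: "M > 0"
    and lim: "(\<lambda>k. nrm n (\<lambda>i. Z k i - c * zstar $ i)) \<longlonglongrightarrow> 0"
    and quad: "\<forall>\<^sub>F k in sequentially. nrm n (\<lambda>i. Z (Suc k) i - c * zstar $ i) \<le> M * (nrm n (\<lambda>i. Z k i - c * zstar $ i))\<^sup>2"
    unfolding fun_cong[OF zs] by blast
  define \<phi> where "\<phi> = Arg2pi c"
  have \<phi>: "\<phi> \<in> {0..<2 * pi}" and c_cis: "c = cis \<phi>"
    using Arg2pi_ge_0[of c] Arg2pi_lt_2pi[of c] Arg2pi_eq[of c] c by (simp_all add: \<phi>_def cis_conv_exp)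
  let ?X = "map_vec Re zstar" and ?Y = "map_vec Im zstar"
  define w where "w = (cos \<phi> \<cdot>\<^sub>v ?X - sin \<phi> \<cdot>\<^sub>v ?Y) @\<^sub>v (sin \<phi> \<cdot>\<^sub>v ?X + cos \<phi> \<cdot>\<^sub>v ?Y)"
  have w: "w \<in> phase_orbit ?X ?Y" unfolding phase_orbit_def w_def using \<phi> by (intro imageI)
  have wc: "w \<in> carrier_vec (2 * n)" using z by (auto simp: w_def mult_2 carrier_vecD)
  have cw: "cvec n w i = c * zstar $ i" if "i < n" for i
    using that z by (simp add: cvec_def w_def c_cis complex_eq_iff carrier_vecD)
  have dist: "vec_dist (2 * n) (u k) w = nrm n (\<lambda>i. Z k i - c * zstar $ i)" for k
    unfolding vec_dist_cvec[OF car wc] nrm_def Z_def by (rule arg_cong[of _ _ sqrt], rule nsq_cong) (simp add: cw)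
  have "Q_quadratic_convergent (2 * n) u w"
    unfolding Q_quadratic_convergent_def
  proof (intro conjI exI[of _ M])
    show "limitin (vec_topology (2 * n)) u w sequentially"
      unfolding Metric_space.limitin_metric[OF Metric_space_vec]
    proof (intro conjI allI impI wc)
      fix \<epsilon> :: real assume "\<epsilon> > 0"
      then show "\<forall>\<^sub>F k in sequentially. u k \<in> carrier_vec (2 * n) \<and> vec_dist (2 * n) (u k) w < \<epsilon>"
        using order_tendstoD(2)[OF lim, of \<epsilon>] car by (simp add: dist)
    qed
    show "\<forall>\<^sub>F k in sequentially. vec_dist (2 * n) (u (Suc k)) w \<le> M * (vec_dist (2 * n) (u k) w)\<^sup>2"
      using quad by (simp add: dist)
  qed (rule M)
  with w show ?thesis by blast
qed

section \<open>Gaussian linear forms\<close>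

abbreviation half_normal :: "real measure" where
  "half_normal \<equiv> density lborel (normal_density 0 (sqrt (1/2)))"

lemma distributed_distr:
  assumes M: "M = distr P N g" and g: "g \<in> measurable P N" and f: "f \<in> borel_measurable N"
    and d: "distributed P lborel (\<lambda>x. f (g x)) D"
  shows "distributed M lborel f D"
  using d f g unfolding distributed_def M
  by (simp add: distr_distr o_def cong: measurable_cong_sets)

lemma std_complex_normal_eq:
  "std_complex_normal = distr (half_normal \<Otimes>\<^sub>M half_normal) borel (\<lambda>(s, t). Complex s t)"
  by (simp add: std_complex_normal_def Let_def)

lemma sets_std_complex_normal [simp, measurable_cong]: "sets std_complex_normal = sets borel"
  by (simp add: std_complex_normal_eq)

lemma Complex_pair_measurable: "(\<lambda>(s, t). Complex s t) \<in> borel_measurable (half_normal \<Otimes>\<^sub>M half_normal)"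
  by (simp add: borel_measurable_complex_iff case_prod_beta)

lemma distributed_Re_mult_std_complex_normal:
  assumes c: "c \<noteq> 0"
  shows "distributed std_complex_normal lborel (\<lambda>w. Re (cnj w * c)) (normal_density 0 (cmod c / sqrt 2))"
proof -
  let ?G = half_normal and ?Q = "half_normal \<Otimes>\<^sub>M half_normal"
  interpret g: prob_space ?G by (rule prob_space_normal_density) simp
  interpret Q: pair_prob_space ?G ?G ..
  have fst_distr: "distr ?Q borel fst = ?G"
  proof -
    have "distr ?Q borel fst = distr ?Q ?G fst" by (rule distr_cong) auto
    also have "\<dots> = ?G" by (rule g.distr_pair_fst)
    finally show ?thesis .
  qed
  have snd_distr: "distr ?Q borel snd = ?G"
  proof -
    have "distr ?Q borel snd = distr ?Q borel (fst \<circ> (\<lambda>(x, y). (y, x)))"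
      by (rule distr_cong) auto
    also have "\<dots> = distr (distr ?Q ?Q (\<lambda>(x, y). (y, x))) borel fst"
      by (subst distr_distr) auto
    also have "distr ?Q ?Q (\<lambda>(x, y). (y, x)) = ?Q"
      by (rule Q.distr_pair_swap[symmetric])
    finally show ?thesis by (simp add: fst_distr)
  qed
  have dfst: "distributed ?Q lborel fst (normal_density 0 (sqrt (1/2)))"
    and dsnd: "distributed ?Q lborel snd (normal_density 0 (sqrt (1/2)))"
    using fst_distr snd_distr by (simp_all add: distributed_def cong: distr_cong)
  have ind: "Q.indep_var borel fst borel snd"
    unfolding Q.indep_var_distribution_eq
  proof (intro conjI)
    show "distr ?Q borel fst \<Otimes>\<^sub>M distr ?Q borel snd = distr ?Q (borel \<Otimes>\<^sub>M borel) (\<lambda>x. (fst x, snd x))"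
      unfolding fst_distr snd_distr
      by (simp, intro distr_id2[symmetric] sets_pair_measure_cong) auto
  qed auto
  have scaled: "distributed ?Q lborel (\<lambda>q. \<alpha> * X q) (normal_density 0 (\<bar>\<alpha>\<bar> / sqrt 2))"
    if "distributed ?Q lborel X (normal_density 0 (sqrt (1/2)))" "\<alpha> \<noteq> 0" for X \<alpha>
    using Q.normal_density_affine[OF that(1) _ that(2), of 0] by (simp add: real_sqrt_divide)
  have "distributed ?Q lborel (\<lambda>q. Re c * fst q + Im c * snd q) (normal_density 0 (cmod c / sqrt 2))"
  proof (cases "Re c = 0 \<or> Im c = 0")
    case True
    then show ?thesis
    proof
      assume "Re c = 0"
      with c scaled[OF dsnd, of "Im c"] show ?thesis by (simp add: cmod_def complex_eq_iff)
    next
      assume "Im c = 0"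
      with c scaled[OF dfst, of "Re c"] show ?thesis by (simp add: cmod_def complex_eq_iff)
    qed
  next
    case False
    have "Q.indep_var borel ((\<lambda>x. Re c * x) \<circ> fst) borel ((\<lambda>x. Im c * x) \<circ> snd)"
      by (rule Q.indep_var_compose[OF ind]) auto
    then have "distributed ?Q lborel (\<lambda>q. Re c * fst q + Im c * snd q)
        (normal_density (0 + 0) (sqrt ((\<bar>Re c\<bar> / sqrt 2)\<^sup>2 + (\<bar>Im c\<bar> / sqrt 2)\<^sup>2)))"
      using False by (intro Q.add_indep_normal scaled dfst dsnd) (auto simp: o_def)
    also have "sqrt ((\<bar>Re c\<bar> / sqrt 2)\<^sup>2 + (\<bar>Im c\<bar> / sqrt 2)\<^sup>2) = cmod c / sqrt 2"
      by (simp add: cmod_def power_divide add_divide_distrib[symmetric] real_sqrt_divide)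
    finally show ?thesis by simp
  qed
  then show ?thesis
    by (intro distributed_distr[OF std_complex_normal_eq Complex_pair_measurable])
      (auto simp: case_prod_beta algebra_simps cong: distributed_def)
qed

lemma std_complex_normal_vec_distr:
  "std_complex_normal_vec n = distr (\<Pi>\<^sub>M i\<in>{..<n}. std_complex_normal) (std_complex_normal_vec n) (vec n)"
  "vec n \<in> measurable (\<Pi>\<^sub>M i\<in>{..<n}. std_complex_normal) (std_complex_normal_vec n)"
  unfolding std_complex_normal_vec_def
  by (rule embed_measure_eq_distr'[OF inj_on_vec_PiM], rule measurable_embed_measure2'[OF inj_on_vec_PiM])

lemma coordinate_measurable:
  assumes "i < n"
  shows "(\<lambda>\<omega>. \<omega> i) \<in> borel_measurable (\<Pi>\<^sub>M i\<in>{..<n}. std_complex_normal)"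
  using measurable_component_singleton[of i "{..<n}" "\<lambda>_. std_complex_normal"] assms
  by (simp add: measurable_cong_sets[OF refl sets_std_complex_normal])

lemma cnj_measurable: "cnj \<in> borel_measurable borel"
  by (intro borel_measurable_continuous_onI continuous_intros)

lemma ip_measurable [measurable]:
  "(\<lambda>a. ip n (($) a) z) \<in> borel_measurable (std_complex_normal_vec n)"
  unfolding std_complex_normal_vec_def
proof (rule measurable_embed_measure1)
  have "(\<lambda>\<omega>. \<Sum>i<n. cnj (\<omega> i) * z i) \<in> borel_measurable (\<Pi>\<^sub>M i\<in>{..<n}. std_complex_normal)"
    by (intro borel_measurable_sum borel_measurable_times borel_measurable_const
        measurable_compose[OF coordinate_measurable cnj_measurable]) auto
  then show "(\<lambda>x. ip n (($) (vec n x)) z) \<in> borel_measurable (\<Pi>\<^sub>M i\<in>{..<n}. std_complex_normal)"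
    by (simp add: ip_def)
qed

text \<open>Only the law of the real part of one linear form is needed. Replacing \<open>z\<close> by a phase multiple gives
  all other real parts, and polarisation gives joint moments of two forms.\<close>

lemma distributed_Re_ip:
  assumes "nsq n z \<noteq> 0"
  shows "distributed (std_complex_normal_vec n) lborel (\<lambda>a. Re (ip n (($) a) z))
     (normal_density 0 (sqrt (nsq n z / 2)))"
proof -
  let ?P = "\<Pi>\<^sub>M i\<in>{..<n}. std_complex_normal"
  interpret P: prob_space ?P by (intro prob_space_PiM prob_space_std_complex_normal)
  \<comment> \<open>A zero coefficient would contribute a degenerate Gaussian, which has no density.\<close>
  define I where "I = {i. i < n \<and> z i \<noteq> 0}"
  have I: "finite I" "I \<subseteq> {..<n}" by (auto simp: I_def)
  have I0: "I \<noteq> {}"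
  proof
    assume "I = {}"
    then have "nsq n z = 0" by (auto simp: nsq_def I_def)
    with assms show False by simp
  qed
  have n0: "{..<n} \<noteq> {}" using I I0 by auto
  have comp: "distr ?P borel (\<lambda>\<omega>. \<omega> i) = std_complex_normal" if "i < n" for i
  proof -
    have "distr ?P borel (\<lambda>\<omega>. \<omega> i) = distr ?P std_complex_normal (\<lambda>\<omega>. \<omega> i)"
      by (rule distr_cong) auto
    also have "\<dots> = std_complex_normal"
      using that prob_space_std_complex_normal by (intro distr_PiM_component) auto
    finally show ?thesis .
  qed
  have meas: "(\<lambda>\<omega>. \<omega> i) \<in> borel_measurable ?P" if "i < n" for i
    using that by (rule coordinate_measurable)
  have "P.indep_vars (\<lambda>_. borel) (\<lambda>i \<omega>. \<omega> i) {..<n}"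
  proof (subst P.indep_vars_iff_distr_eq_PiM'[OF n0])
    show "(\<lambda>\<omega>. \<omega> i) \<in> borel_measurable ?P" if "i \<in> {..<n}" for i using that meas by simp
    have "distr ?P (Pi\<^sub>M {..<n} (\<lambda>_. borel)) (\<lambda>x. \<lambda>i\<in>{..<n}. x i) = distr ?P ?P (\<lambda>x. x)"
      by (intro distr_cong sets_PiM_cong) (auto simp: space_PiM)
    also have "\<dots> = ?P" by (rule distr_id)
    also have "\<dots> = Pi\<^sub>M {..<n} (\<lambda>i. distr ?P borel (\<lambda>\<omega>. \<omega> i))"
      by (intro PiM_cong) (auto simp: comp)
    finally show "distr ?P (Pi\<^sub>M {..<n} (\<lambda>_. borel)) (\<lambda>x. \<lambda>i\<in>{..<n}. x i)
      = Pi\<^sub>M {..<n} (\<lambda>i. distr ?P borel (\<lambda>\<omega>. \<omega> i))" .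
  qed
  then have "P.indep_vars (\<lambda>_. borel) (\<lambda>i \<omega>. \<omega> i) I"
    by (rule P.indep_vars_subset) (rule I)
  then have ind: "P.indep_vars (\<lambda>_. borel) (\<lambda>i \<omega>. Re (cnj (\<omega> i) * z i)) I"
    by (rule P.indep_vars_compose2) auto
  have dist: "distributed ?P lborel (\<lambda>\<omega>. Re (cnj (\<omega> i) * z i)) (normal_density 0 (cmod (z i) / sqrt 2))"
    if "i \<in> I" for i
  proof -
    have "distributed std_complex_normal lborel (\<lambda>w. Re (cnj w * z i)) (normal_density 0 (cmod (z i) / sqrt 2))"
      using that by (intro distributed_Re_mult_std_complex_normal) (auto simp: I_def)
    then have "distr (distr ?P borel (\<lambda>\<omega>. \<omega> i)) lborel (\<lambda>w. Re (cnj w * z i))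
        = density lborel (normal_density 0 (cmod (z i) / sqrt 2))"
      using that I comp[of i] by (auto simp: distributed_def)
    moreover have "distr (distr ?P borel (\<lambda>\<omega>. \<omega> i)) lborel (\<lambda>w. Re (cnj w * z i))
        = distr ?P lborel (\<lambda>\<omega>. Re (cnj (\<omega> i) * z i))"
      using that I meas[of i] by (subst distr_distr) (auto simp: o_def)
    ultimately show ?thesis
      using that I meas[of i] by (auto simp: distributed_def)
  qed
  have "distributed ?P lborel (\<lambda>\<omega>. \<Sum>i\<in>I. Re (cnj (\<omega> i) * z i))
     (normal_density (\<Sum>i\<in>I. 0) (sqrt (\<Sum>i\<in>I. (cmod (z i) / sqrt 2)\<^sup>2)))"
    by (rule P.sum_indep_normal[OF I(1) I0 ind _ dist]) (auto simp: I_def)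
  moreover have "(\<Sum>i\<in>I. (cmod (z i) / sqrt 2)\<^sup>2) = nsq n z / 2"
  proof -
    have "(\<Sum>i\<in>I. cmod2 (z i)) = nsq n z"
      unfolding nsq_def by (rule sum.mono_neutral_left) (auto simp: I_def)
    then show ?thesis by (simp add: power_divide sum_divide_distrib[symmetric])
  qed
  moreover have "(\<Sum>i\<in>I. Re (cnj (\<omega> i) * z i)) = Re (ip n (($) (vec n \<omega>)) z)" for \<omega>
  proof -
    have "(\<Sum>i\<in>I. Re (cnj (\<omega> i) * z i)) = (\<Sum>i<n. Re (cnj (\<omega> i) * z i))"
      by (rule sum.mono_neutral_left) (auto simp: I_def)
    also have "\<dots> = Re (ip n (($) (vec n \<omega>)) z)" by (simp add: ip_def)
    finally show ?thesis .
  qed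
  ultimately have "distributed ?P lborel (\<lambda>\<omega>. Re (ip n (($) (vec n \<omega>)) z)) (normal_density 0 (sqrt (nsq n z / 2)))"
    by simp
  then show ?thesis
    by (intro distributed_distr[OF std_complex_normal_vec_distr]) auto
qed

section \<open>Moments of Gaussian linear forms\<close>

abbreviation gauss :: "nat \<Rightarrow> complex vec measure" where
  "gauss \<equiv> std_complex_normal_vec"

abbreviation lf :: "nat \<Rightarrow> (nat \<Rightarrow> complex) \<Rightarrow> complex vec \<Rightarrow> complex" where
  "lf n z a \<equiv> ip n (($) a) z"

text \<open>An integrable majorant of all polynomials in a Gaussian linear form.\<close>

definition gexp :: "complex \<Rightarrow> real" where
  "gexp w = exp (cmod2 w / 4)"

lemma gexp_pos: "gexp w > 0" by (simp add: gexp_def)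

lemma gexp_measurable [measurable]: "gexp \<in> borel_measurable borel"
  unfolding gexp_def by measurable

lemma nn_integral_exp_Re_sq:
  assumes "nsq n z = 1"
  shows "(\<integral>\<^sup>+a. exp ((Re (lf n z a))\<^sup>2 / 2) \<partial>gauss n) \<le> 2"
proof -
  have d: "distributed (gauss n) lborel (\<lambda>a. Re (lf n z a)) (normal_density 0 (sqrt (1/2)))"
    using distributed_Re_ip[of n z] assms by simp
  have "(\<integral>\<^sup>+a. exp ((Re (lf n z a))\<^sup>2 / 2) \<partial>gauss n)
     = (\<integral>\<^sup>+x. ennreal (normal_density 0 (sqrt (1/2)) x) * ennreal (exp (x\<^sup>2 / 2)) \<partial>lborel)"
    by (rule distributed_nn_integral[OF d, symmetric]) simp
  also have "\<dots> = (\<integral>\<^sup>+x. ennreal (sqrt 2) * ennreal (normal_density 0 1 x) \<partial>lborel)"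
  proof (rule nn_integral_cong)
    fix x :: real
    have "normal_density 0 (sqrt (1/2)) x * exp (x\<^sup>2 / 2) = sqrt 2 * normal_density 0 1 x"
    proof -
      have "exp (- x\<^sup>2) * exp (x\<^sup>2 / 2) = exp (- (x\<^sup>2 / 2))"
        by (simp add: exp_add[symmetric])
      then show ?thesis by (simp add: normal_density_def real_sqrt_mult field_simps)
    qed
    then show "ennreal (normal_density 0 (sqrt (1/2)) x) * ennreal (exp (x\<^sup>2 / 2)) = ennreal (sqrt 2) * ennreal (normal_density 0 1 x)"
      by (simp add: ennreal_mult'[symmetric])
  qed
  also have "\<dots> = ennreal (sqrt 2) * (\<integral>\<^sup>+x. ennreal (normal_density 0 1 x) \<partial>lborel)"
    by (rule nn_integral_cmult) simp
  also have "(\<integral>\<^sup>+x. ennreal (normal_density 0 1 x) \<partial>lborel) = 1"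
    by (subst nn_integral_eq_integral) auto
  also have "ennreal (sqrt 2) * 1 \<le> 2"
    using real_sqrt_le_mono[of 2 4] by (simp add: ennreal_numeral[symmetric] del: ennreal_numeral)
  finally show ?thesis .
qed

lemma Im_lf: "Im (lf n z a) = Re (lf n (\<lambda>i. - \<i> * z i) a)"
  by (subst ip_scale) simp

text \<open>Convexity of \<open>exp\<close> separates the real and the imaginary part, each of which is a real Gaussian.\<close>

lemma nn_integral_gexp:
  assumes z: "nsq n z = 1"
  shows "(\<integral>\<^sup>+a. gexp (lf n z a) \<partial>gauss n) \<le> 2"
proof -
  let ?w = "\<lambda>i. - \<i> * z i"
  have w: "nsq n ?w = 1" by (subst nsq_scale) (use z in simp)
  have am: "exp ((u + v) / 2) \<le> (exp u + exp v) / 2" for u v :: real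
  proof -
    have "exp ((u + v) / 2) = exp (u / 2) * exp (v / 2)" by (simp add: exp_add[symmetric] add_divide_distrib)
    also have "\<dots> \<le> ((exp (u / 2))\<^sup>2 + (exp (v / 2))\<^sup>2) / 2"
      using zero_le_power2[of "exp (u / 2) - exp (v / 2)"] by (simp add: power2_eq_square algebra_simps)
    finally show ?thesis by (simp add: exp_double[symmetric])
  qed
  have pt: "gexp u \<le> exp ((Re u)\<^sup>2 / 2) / 2 + exp ((Im u)\<^sup>2 / 2) / 2" for u
    using am[of "(Re u)\<^sup>2 / 2" "(Im u)\<^sup>2 / 2"] by (simp add: gexp_def cmod_power2 add_divide_distrib)
  have "(\<integral>\<^sup>+a. gexp (lf n z a) \<partial>gauss n)
     \<le> (\<integral>\<^sup>+a. ennreal (1/2) * exp ((Re (lf n z a))\<^sup>2 / 2) + ennreal (1/2) * exp ((Re (lf n ?w a))\<^sup>2 / 2) \<partial>gauss n)"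
  proof (rule nn_integral_mono)
    fix a
    show "ennreal (gexp (lf n z a)) \<le> ennreal (1/2) * exp ((Re (lf n z a))\<^sup>2 / 2) + ennreal (1/2) * exp ((Re (lf n ?w a))\<^sup>2 / 2)"
    proof -
      have half: "ennreal (1/2) * ennreal X = ennreal (1/2 * X)" for X
        by (rule ennreal_mult'[symmetric]) simp
      have eq: "ennreal (1/2) * ennreal X + ennreal (1/2) * ennreal Y = ennreal (1/2 * X + 1/2 * Y)"
        if "X \<ge> 0" "Y \<ge> 0" for X Y
        unfolding half using that by (intro ennreal_plus[symmetric]) auto
      show ?thesis
        unfolding eq[OF exp_ge_zero exp_ge_zero]
        using pt[of "lf n z a"] unfolding Im_lf by (intro ennreal_leI) simp
    qed
  qed
  also have "\<dots> = ennreal (1/2) * (\<integral>\<^sup>+a. exp ((Re (lf n z a))\<^sup>2 / 2) \<partial>gauss n)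
      + ennreal (1/2) * (\<integral>\<^sup>+a. exp ((Re (lf n ?w a))\<^sup>2 / 2) \<partial>gauss n)"
    by (subst nn_integral_add) (auto simp: nn_integral_cmult)
  also have "\<dots> \<le> ennreal (1/2) * 2 + ennreal (1/2) * 2"
    by (intro add_mono mult_left_mono nn_integral_exp_Re_sq z w) auto
  also have "\<dots> = 2"
  proof -
    have "ennreal (1/2) * ennreal 2 = ennreal (1/2 * 2)" by (rule ennreal_mult'[symmetric]) simp
    then have "ennreal (1/2) * 2 = 1" by simp
    then show ?thesis by (simp only: one_add_one)
  qed
  finally show ?thesis .
qed

lemma integrable_gexp:
  assumes z: "nsq n z = 1"
  shows "integrable (gauss n) (\<lambda>a. gexp (lf n z a))" "(\<integral>a. gexp (lf n z a) \<partial>gauss n) \<le> 2"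
proof -
  have fin: "(\<integral>\<^sup>+a. gexp (lf n z a) \<partial>gauss n) < \<infinity>"
    using nn_integral_gexp[OF z] by (rule order.strict_trans1) simp
  show i: "integrable (gauss n) (\<lambda>a. gexp (lf n z a))"
    using fin gexp_pos by (intro integrableI_nonneg) (auto simp: less_imp_le)
  have "ennreal (\<integral>a. gexp (lf n z a) \<partial>gauss n) = (\<integral>\<^sup>+a. gexp (lf n z a) \<partial>gauss n)"
    using i gexp_pos by (intro nn_integral_eq_integral[symmetric]) (auto simp: less_imp_le)
  also have "\<dots> \<le> ennreal 2" using nn_integral_gexp[OF z] by simp
  finally show "(\<integral>a. gexp (lf n z a) \<partial>gauss n) \<le> 2" by (subst (asm) ennreal_le_iff) simp_all
qed

lemma fourth_power_le_exp:
  assumes "y \<ge> (0::real)"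
  shows "y ^ 4 \<le> 2 ^ 20 * exp (y / 8)"
proof -
  have "y / 32 \<le> exp (y / 32)" using exp_ge_add_one_self[of "y / 32"] by linarith
  then have "(y / 32) ^ 4 \<le> exp (y / 32) ^ 4" using assms by (intro power_mono) auto
  also have "\<dots> = exp (y / 8)" by (simp add: exp_of_nat_mult[symmetric])
  finally show ?thesis by (simp add: power_divide)
qed

lemma cmod8_gexp: "(cmod w) ^ 8 * exp (cmod2 w / 8) \<le> 2 ^ 20 * gexp w"
proof -
  have "(cmod w) ^ 8 = (cmod2 w) ^ 4" by (simp add: power_mult[symmetric])
  also have "\<dots> \<le> 2 ^ 20 * exp (cmod2 w / 8)" by (rule fourth_power_le_exp) simp
  finally have "(cmod w) ^ 8 * exp (cmod2 w / 8) \<le> 2 ^ 20 * exp (cmod2 w / 8) * exp (cmod2 w / 8)"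
    by (intro mult_right_mono) auto
  also have "\<dots> = 2 ^ 20 * gexp w" by (simp add: gexp_def mult.assoc exp_add[symmetric])
  finally show ?thesis .
qed

lemma cmod8_le_gexp: "(cmod w) ^ 8 \<le> 2 ^ 20 * gexp w"
proof -
  have "(cmod w) ^ 8 * 1 \<le> (cmod w) ^ 8 * exp (cmod2 w / 8)" by (intro mult_left_mono) auto
  with cmod8_gexp[of w] show ?thesis by linarith
qed

lemma Re4_moment:
  assumes "nsq n z \<noteq> 0"
  shows "has_bochner_integral (gauss n) (\<lambda>a. (Re (lf n z a)) ^ 4) (3/4 * (nsq n z)\<^sup>2)"
proof -
  define \<sigma> where "\<sigma> = sqrt (nsq n z / 2)"
  have \<sigma>: "\<sigma> > 0" "\<sigma>\<^sup>2 = nsq n z / 2" using assms nsq_nonneg[of n z] by (auto simp: \<sigma>_def less_le)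
  have d: "distributed (gauss n) lborel (\<lambda>a. Re (lf n z a)) (normal_density 0 \<sigma>)"
    using distributed_Re_ip[OF assms] by (simp add: \<sigma>_def)
  have hb: "has_bochner_integral lborel (\<lambda>x. normal_density 0 \<sigma> x * x ^ 4) (3 * (\<sigma>\<^sup>2)\<^sup>2)"
    using normal_moment_even[OF \<sigma>(1), of 0 2] by (simp add: fact_numeral power_divide power2_eq_square mult.assoc)
  have "integrable (gauss n) (\<lambda>a. (Re (lf n z a)) ^ 4)"
    using distributed_integrable[OF d, of "\<lambda>x. x ^ 4"] hb by (auto simp: has_bochner_integral_iff)
  moreover have "(\<integral>a. (Re (lf n z a)) ^ 4 \<partial>gauss n) = 3 * (\<sigma>\<^sup>2)\<^sup>2"
    using distributed_integral[OF d, of "\<lambda>x. x ^ 4"] hb by (auto simp: has_bochner_integral_iff)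
  ultimately show ?thesis by (simp add: has_bochner_integral_iff \<sigma>(2) power_divide)
qed

text \<open>Expresses the fourth power of the modulus by real parts of four phase multiples, whose laws are known.\<close>

lemma cmod4_phases:
  "(cmod w) ^ 4 = 2/3 * ((Re w) ^ 4 + (Re (\<i> * w)) ^ 4
      + (Re (Complex (1 / sqrt 2) (1 / sqrt 2) * w)) ^ 4 + (Re (Complex (1 / sqrt 2) (- 1 / sqrt 2) * w)) ^ 4)"
proof -
  have s4: "(sqrt 2) ^ 4 = (4::real)"
    using real_sqrt_pow2[of 2] by (simp add: power4_eq_xxxx)
  have "(cmod w) ^ 4 = ((Re w)\<^sup>2 + (Im w)\<^sup>2)\<^sup>2"
    unfolding cmod_power2[symmetric] by (simp add: power_mult[symmetric])
  moreover have "(Re (Complex (1 / sqrt 2) (1 / sqrt 2) * w)) ^ 4 = (Re w - Im w) ^ 4 / 4"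
    by (simp add: diff_divide_distrib[symmetric] power_divide s4)
  moreover have "(Re (Complex (1 / sqrt 2) (- 1 / sqrt 2) * w)) ^ 4 = (Re w + Im w) ^ 4 / 4"
    by (simp add: add_divide_distrib[symmetric] power_divide s4)
  ultimately show ?thesis
    by (simp add: power2_eq_square power4_eq_xxxx field_simps)
qed

lemma cmod4_moment:
  "has_bochner_integral (gauss n) (\<lambda>a. (cmod (lf n z a)) ^ 4) (2 * (nsq n z)\<^sup>2)"
proof (cases "nsq n z = 0")
  case True
  then have "lf n z a = 0" for a by (rule nsq_zero_ip)
  then show ?thesis using True by (simp add: has_bochner_integral_zero)
next
  case False
  have ph: "has_bochner_integral (gauss n) (\<lambda>a. (Re (c * lf n z a)) ^ 4) (3/4 * (nsq n z)\<^sup>2)" if "cmod c = 1" for c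
    using Re4_moment[of n "\<lambda>i. c * z i"] False that by (simp only: nsq_scale ip_scale) simp
  have u: "cmod (Complex (1 / sqrt 2) (1 / sqrt 2)) = 1" "cmod (Complex (1 / sqrt 2) (- 1 / sqrt 2)) = 1"
    by (simp_all add: cmod_def power_divide)
  have "has_bochner_integral (gauss n)
     (\<lambda>a. 2/3 * ((Re (1 * lf n z a)) ^ 4 + (Re (\<i> * lf n z a)) ^ 4
      + (Re (Complex (1 / sqrt 2) (1 / sqrt 2) * lf n z a)) ^ 4 + (Re (Complex (1 / sqrt 2) (- 1 / sqrt 2) * lf n z a)) ^ 4))
     (2/3 * (3/4 * (nsq n z)\<^sup>2 + 3/4 * (nsq n z)\<^sup>2 + 3/4 * (nsq n z)\<^sup>2 + 3/4 * (nsq n z)\<^sup>2))"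
    by (intro has_bochner_integral_mult_right has_bochner_integral_add ph u) auto
  then show ?thesis unfolding cmod4_phases mult_1_left by simp
qed

text \<open>As \<open>c\<close> varies, these fourth moments determine the mixed moments of \<open>a\<^sup>H x\<close> and \<open>a\<^sup>H e\<close>.\<close>

lemma polarised_moment:
  assumes "nsq n x = 1" "nsq n e = 1"
  shows "integrable (gauss n) (\<lambda>a. (cmod (lf n x a + c * lf n e a)) ^ 4)"
    "(\<integral>a. (cmod (lf n x a + c * lf n e a)) ^ 4 \<partial>gauss n) = 2 * (1 + 2 * Re (c * ip n x e) + cmod2 c)\<^sup>2"
  using cmod4_moment[of n "\<lambda>i. x i + c * e i"] assms
  by (auto simp: has_bochner_integral_iff ip_add ip_scale nsq_add nsq_scale)

lemma weighted_moment:
  assumes "nsq n x = 1" "nsq n e = 1"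
  shows "integrable (gauss n) (\<lambda>a. cmod2 (lf n x a) * cmod2 (lf n e a))"
    "(\<integral>a. cmod2 (lf n x a) * cmod2 (lf n e a) \<partial>gauss n) = 1 + cmod2 (ip n x e)"
proof -
  let ?Q = "\<lambda>c a. (cmod (lf n x a + c * lf n e a)) ^ 4"
  note pm = polarised_moment[OF assms]
  have id: "cmod2 p * cmod2 q = ((cmod (p + 1 * q)) ^ 4 + (cmod (p + (-1) * q)) ^ 4
      + (cmod (p + \<i> * q)) ^ 4 + (cmod (p + (-\<i>) * q)) ^ 4 - 4 * (cmod p) ^ 4 - 4 * (cmod q) ^ 4) / 16" for p q
  proof -
    have "(cmod w) ^ 4 = ((Re w)\<^sup>2 + (Im w)\<^sup>2)\<^sup>2" for w
      unfolding cmod_power2[symmetric] by (simp add: power_mult[symmetric])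
    then show ?thesis by (simp add: cmod_power2) (simp add: power2_eq_square field_simps)
  qed
  have hx: "integrable (gauss n) (\<lambda>a. (cmod (lf n x a)) ^ 4)" "(\<integral>a. (cmod (lf n x a)) ^ 4 \<partial>gauss n) = 2"
    and he: "integrable (gauss n) (\<lambda>a. (cmod (lf n e a)) ^ 4)" "(\<integral>a. (cmod (lf n e a)) ^ 4 \<partial>gauss n) = 2"
    using cmod4_moment[of n x] cmod4_moment[of n e] assms by (auto simp: has_bochner_integral_iff)
  show "integrable (gauss n) (\<lambda>a. cmod2 (lf n x a) * cmod2 (lf n e a))"
    unfolding id by (intro integrable_divide Bochner_Integration.integrable_diff Bochner_Integration.integrable_add integrable_mult_right pm hx he)
  have "(\<integral>a. cmod2 (lf n x a) * cmod2 (lf n e a) \<partial>gauss n)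
    = (2 * (1 + 2 * Re (1 * ip n x e) + cmod2 1)\<^sup>2 + 2 * (1 + 2 * Re ((-1) * ip n x e) + cmod2 (-1))\<^sup>2
      + 2 * (1 + 2 * Re (\<i> * ip n x e) + cmod2 \<i>)\<^sup>2 + 2 * (1 + 2 * Re ((-\<i>) * ip n x e) + cmod2 (-\<i>))\<^sup>2 - 4 * 2 - 4 * 2) / 16"
    unfolding id using pm(1)[of 1] pm(1)[of "-1"] pm(1)[of \<i>] pm(1)[of "-\<i>"] hx(1) he(1)
    by (simp only: integral_divide_zero Bochner_Integration.integral_diff Bochner_Integration.integral_add
        integral_mult_right_zero Bochner_Integration.integrable_diff Bochner_Integration.integrable_add
        integrable_mult_right pm(2) hx(2) he(2) simp_thms)
  also have "\<dots> = 1 + cmod2 (ip n x e)"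
    by (simp add: cmod_power2) (simp add: power2_eq_square field_simps)
  finally show "(\<integral>a. cmod2 (lf n x a) * cmod2 (lf n e a) \<partial>gauss n) = 1 + cmod2 (ip n x e)" .
qed

lemma mixed_square_moment:
  assumes "nsq n x = 1" "nsq n e = 1"
  shows "integrable (gauss n) (\<lambda>a. mixed_square \<tau> (lf n x a) (lf n e a))"
    "(\<integral>a. mixed_square \<tau> (lf n x a) (lf n e a) \<partial>gauss n) = mixed_moment \<tau> (ip n x e)"
proof -
  note pm = polarised_moment[OF assms] and wm = weighted_moment[OF assms]
  define A B where "A = 3 * \<tau> * (1 - \<tau>) / 48" and "B = 9/4 * (1 - \<tau>)\<^sup>2 / 8"
  have id: "mixed_square \<tau> p q = \<tau>\<^sup>2 * (cmod q) ^ 4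
      + A * ((cmod (p + 2 * q)) ^ 4 - (cmod (p + (-2) * q)) ^ 4 - 2 * ((cmod (p + 1 * q)) ^ 4 - (cmod (p + (-1) * q)) ^ 4))
      + B * ((cmod (p + 1 * q)) ^ 4 + (cmod (p + (-1) * q)) ^ 4 - 2 * (cmod p) ^ 4 - 2 * (cmod q) ^ 4
          - 4 * (cmod2 p * cmod2 q))" for p q
  proof -
    have c4: "(cmod w) ^ 4 = ((Re w)\<^sup>2 + (Im w)\<^sup>2)\<^sup>2" for w
      unfolding cmod_power2[symmetric] by (simp add: power_mult[symmetric])
    let ?\<rho> = "Re (cnj p * q)"
    have 1: "(cmod (p + 2 * q)) ^ 4 - (cmod (p + (-2) * q)) ^ 4 - 2 * ((cmod (p + 1 * q)) ^ 4 - (cmod (p + (-1) * q)) ^ 4)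
        = 48 * (?\<rho> * cmod2 q)"
      by (simp add: c4 cmod_power2) (simp add: power2_eq_square algebra_simps)
    have 2: "(cmod (p + 1 * q)) ^ 4 + (cmod (p + (-1) * q)) ^ 4 - 2 * (cmod p) ^ 4 - 2 * (cmod q) ^ 4
          - 4 * (cmod2 p * cmod2 q) = 8 * ?\<rho>\<^sup>2"
      by (simp add: c4 cmod_power2) (simp add: power2_eq_square algebra_simps)
    have 3: "(cmod q) ^ 4 = (cmod2 q)\<^sup>2" by (simp add: power_mult[symmetric])
    show ?thesis unfolding 1 2 unfolding 3 mixed_square_def A_def B_def
      by (simp only: power2_eq_square) (simp add: field_simps)
  qed
  have hx: "integrable (gauss n) (\<lambda>a. (cmod (lf n x a)) ^ 4)" "(\<integral>a. (cmod (lf n x a)) ^ 4 \<partial>gauss n) = 2"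
    and he: "integrable (gauss n) (\<lambda>a. (cmod (lf n e a)) ^ 4)" "(\<integral>a. (cmod (lf n e a)) ^ 4 \<partial>gauss n) = 2"
    using cmod4_moment[of n x] cmod4_moment[of n e] assms by (auto simp: has_bochner_integral_iff)
  show "integrable (gauss n) (\<lambda>a. mixed_square \<tau> (lf n x a) (lf n e a))"
    unfolding id by (intro Bochner_Integration.integrable_diff Bochner_Integration.integrable_add integrable_mult_right pm hx he wm)
  have "(\<integral>a. mixed_square \<tau> (lf n x a) (lf n e a) \<partial>gauss n)
    = \<tau>\<^sup>2 * 2 + A * (2 * (1 + 2 * Re (2 * ip n x e) + cmod2 2)\<^sup>2 - 2 * (1 + 2 * Re ((-2) * ip n x e) + cmod2 (-2))\<^sup>2
        - 2 * (2 * (1 + 2 * Re (1 * ip n x e) + cmod2 1)\<^sup>2 - 2 * (1 + 2 * Re ((-1) * ip n x e) + cmod2 (-1))\<^sup>2))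
      + B * (2 * (1 + 2 * Re (1 * ip n x e) + cmod2 1)\<^sup>2 + 2 * (1 + 2 * Re ((-1) * ip n x e) + cmod2 (-1))\<^sup>2
        - 2 * 2 - 2 * 2 - 4 * (1 + cmod2 (ip n x e)))"
    unfolding id using pm(1)[of 1] pm(1)[of "-1"] pm(1)[of 2] pm(1)[of "-2"] hx(1) he(1) wm(1)
    by (simp only: Bochner_Integration.integral_diff Bochner_Integration.integral_add
        integral_mult_right_zero Bochner_Integration.integrable_diff Bochner_Integration.integrable_add
        integrable_mult_right pm(2) hx(2) he(2) wm(2) simp_thms)
  also have "\<dots> = mixed_moment \<tau> (ip n x e)"
    unfolding mixed_moment_def A_def B_def by (simp add: power2_eq_square field_simps)
  finally show "(\<integral>a. mixed_square \<tau> (lf n x a) (lf n e a) \<partial>gauss n) = mixed_moment \<tau> (ip n x e)" .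
qed

section \<open>Tail bounds for one direction\<close>

text \<open>Markov's inequality for the exponential of the sum, whose expectation factorises over the samples.\<close>

lemma chernoff_sample:
  assumes M: "prob_space M" and f [measurable]: "f \<in> borel_measurable M"
    and mgf: "(\<integral>\<^sup>+x. exp (f x) \<partial>M) \<le> ennreal (exp c)"
  shows "measure (\<Pi>\<^sub>M j\<in>{1..m}. M) {a \<in> space (\<Pi>\<^sub>M j\<in>{1..m}. M). t \<le> (\<Sum>j=1..m. f (a j))}
     \<le> exp (real m * c - t)"
proof -
  let ?P = "\<Pi>\<^sub>M j\<in>{1..m}. M"
  interpret M: prob_space M by fact
  interpret P: product_sigma_finite "\<lambda>_::nat. M" by (simp add: product_sigma_finite_def M.sigma_finite_measure_axioms)
  interpret PP: prob_space ?P by (intro prob_space_PiM M)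
  have comp: "(\<lambda>a. f (a j)) \<in> borel_measurable ?P" if "j \<in> {1..m}" for j
    by (rule measurable_compose[OF measurable_component_singleton[OF that] f])
  have sum_meas: "(\<lambda>a. \<Sum>j=1..m. f (a j)) \<in> borel_measurable ?P"
    by (intro borel_measurable_sum comp)
  have exp_meas: "(\<lambda>a. \<Prod>j\<in>{1..m}. ennreal (exp (f (a j)))) \<in> borel_measurable ?P"
  proof (intro borel_measurable_prod_ennreal)
    fix j assume j: "j \<in> {1..m}"
    have "(\<lambda>x. ennreal (exp (f x))) \<in> borel_measurable M" by measurable
    then show "(\<lambda>a. ennreal (exp (f (a j)))) \<in> borel_measurable ?P"
      by (rule measurable_compose[OF measurable_component_singleton[OF j]])
  qed
  let ?A = "{a \<in> space ?P. t \<le> (\<Sum>j=1..m. f (a j))}"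
  have A: "?A \<in> sets ?P" using sum_meas by (rule borel_measurable_le[OF borel_measurable_const])
  have "emeasure ?P ?A = (\<integral>\<^sup>+a. indicator ?A a \<partial>?P)" using A by simp
  also have "\<dots> \<le> (\<integral>\<^sup>+a. ennreal (exp (- t)) * (\<Prod>j\<in>{1..m}. ennreal (exp (f (a j)))) \<partial>?P)"
  proof (rule nn_integral_mono)
    fix a
    have "1 \<le> exp (- t) * (\<Prod>j=1..m. exp (f (a j)))" if "a \<in> ?A"
      using that by (simp add: exp_sum[symmetric] exp_add[symmetric])
    then show "indicator ?A a \<le> ennreal (exp (- t)) * (\<Prod>j\<in>{1..m}. ennreal (exp (f (a j))))"
      by (auto simp: indicator_def prod_ennreal ennreal_mult'[symmetric] prod_nonneg)
  qed
  also have "\<dots> = ennreal (exp (- t)) * (\<integral>\<^sup>+a. (\<Prod>j\<in>{1..m}. ennreal (exp (f (a j)))) \<partial>?P)"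
    by (rule nn_integral_cmult[OF exp_meas])
  also have "(\<integral>\<^sup>+a. (\<Prod>j\<in>{1..m}. ennreal (exp (f (a j)))) \<partial>?P) = (\<Prod>j\<in>{1..m}. \<integral>\<^sup>+x. ennreal (exp (f x)) \<partial>M)"
    by (rule P.product_nn_integral_prod) auto
  also have "\<dots> \<le> (\<Prod>j\<in>{1..m}. ennreal (exp c))"
    using mgf by (intro prod_mono_ennreal) auto
  also have "\<dots> = ennreal (exp (real m * c))"
    by (simp add: ennreal_power exp_of_nat_mult)
  also have "ennreal (exp (- t)) * ennreal (exp (real m * c)) = ennreal (exp (real m * c - t))"
    by (simp add: ennreal_mult'[symmetric] exp_add[symmetric])
  finally have "emeasure ?P ?A \<le> ennreal (exp (real m * c - t))"
    by (simp add: mult_left_mono)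
  then show ?thesis
    unfolding PP.emeasure_eq_measure by (subst (asm) ennreal_le_iff) auto
qed

lemma union_over_sample:
  assumes M: "prob_space M" and A: "A \<in> sets M"
  shows "measure (\<Pi>\<^sub>M j\<in>{1..m}. M) {a \<in> space (\<Pi>\<^sub>M j\<in>{1..m}. M). \<exists>j\<in>{1..m}. a j \<in> A}
    \<le> real m * measure M A"
proof -
  let ?P = "\<Pi>\<^sub>M j\<in>{1..m}. M"
  interpret M: prob_space M by fact
  interpret PP: prob_space ?P by (intro prob_space_PiM M)
  have s: "{a \<in> space ?P. a j \<in> A} \<in> sets ?P" if "j \<in> {1..m}" for j
  proof -
    have "(\<lambda>a. a j) -` A \<inter> space ?P \<in> sets ?P"
      by (rule measurable_sets[OF measurable_component_singleton[OF that] A])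
    also have "(\<lambda>a. a j) -` A \<inter> space ?P = {a \<in> space ?P. a j \<in> A}" by auto
    finally show ?thesis .
  qed
  have m1: "measure ?P {a \<in> space ?P. a j \<in> A} = measure M A" if "j \<in> {1..m}" for j
  proof -
    have "distr ?P M (\<lambda>a. a j) = M"
      using M that by (intro distr_PiM_component)
    then have "measure M A = measure (distr ?P M (\<lambda>a. a j)) A"
      by (rule arg_cong[OF sym])
    also have "\<dots> = measure ?P ((\<lambda>a. a j) -` A \<inter> space ?P)"
      by (rule measure_distr[OF measurable_component_singleton[OF that] A])
    also have "(\<lambda>a. a j) -` A \<inter> space ?P = {a \<in> space ?P. a j \<in> A}" by auto
    finally show ?thesis by (rule sym)
  qed
  have eq: "{a \<in> space ?P. \<exists>j\<in>{1..m}. a j \<in> A} = (\<Union>j\<in>{1..m}. {a \<in> space ?P. a j \<in> A})" by auto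
  have "measure ?P (\<Union>j\<in>{1..m}. {a \<in> space ?P. a j \<in> A}) \<le> (\<Sum>j\<in>{1..m}. measure ?P {a \<in> space ?P. a j \<in> A})"
    by (rule PP.finite_measure_subadditive_finite) (use s in auto)
  also have "\<dots> = (\<Sum>j\<in>{1..m}. measure M A)" by (rule sum.cong[OF refl m1])
  finally show ?thesis unfolding eq by simp
qed

lemma gauss_tail:
  assumes z: "nsq n z = 1"
  shows "measure (gauss n) {a \<in> space (gauss n). cmod2 (lf n z a) > W} \<le> 2 * exp (- W / 4)"
proof -
  interpret G: prob_space "gauss n" by (rule prob_space_std_complex_normal_vec)
  have "measure (gauss n) {a \<in> space (gauss n). cmod2 (lf n z a) > W}
      \<le> measure (gauss n) {a \<in> space (gauss n). exp (W / 4) \<le> gexp (lf n z a)}"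
  proof (rule G.finite_measure_mono)
    show "{a \<in> space (gauss n). exp (W / 4) \<le> gexp (lf n z a)} \<in> sets (gauss n)"
      by (intro borel_measurable_le borel_measurable_const measurable_compose[OF ip_measurable gexp_measurable])
  qed (auto simp: gexp_def)
  also have "\<dots> \<le> (\<integral>a. gexp (lf n z a) \<partial>gauss n) / exp (W / 4)"
    using integrable_gexp[OF z] gexp_pos
    by (intro integral_Markov_inequality_measure[where A = "{}"]) (auto simp: less_imp_le)
  also have "\<dots> \<le> 2 / exp (W / 4)"
    using integrable_gexp[OF z] by (intro divide_right_mono) auto
  also have "2 / exp (W / 4) = 2 * exp (- W / 4)" by (simp add: exp_minus field_simps)
  finally show ?thesis .
qed

text \<open>The product of two squared linear forms has no exponential moment; capping one of the factors at \<open>W\<close> restores it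
  at the scale \<open>1 / W\<close>. With \<open>W\<close> of order \<open>ln m\<close> the cap is rarely active.\<close>

definition capped :: "real \<Rightarrow> complex \<Rightarrow> complex \<Rightarrow> real" where
  "capped W p q = (if cmod2 p \<le> W then cmod2 p * cmod2 q else 0)"

lemma capped_measurable [measurable]:
  "(\<lambda>a. capped W (lf n x a) (lf n e a)) \<in> borel_measurable (gauss n)"
  unfolding capped_def by measurable

lemma mixed_square_measurable [measurable]:
  "(\<lambda>a. mixed_square \<tau> (lf n x a) (lf n e a)) \<in> borel_measurable (gauss n)"
proof -
  have "(\<lambda>a. cnj (lf n x a)) \<in> borel_measurable (gauss n)"
    by (rule measurable_compose[OF ip_measurable cnj_measurable])
  then show ?thesis unfolding mixed_square_def by measurable
qed

lemma exp_le_quadratic: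
  assumes "y \<ge> (0::real)"
  shows "exp y \<le> 1 + y + y\<^sup>2 * exp y"
proof -
  show ?thesis
  proof -
    have "exp y * (1 - y\<^sup>2) \<le> 1 + y"
    proof (cases "y \<le> 1")
      case True
      have "(1 - y) * exp y \<le> 1"
      proof -
        have "1 - y \<le> exp (- y)" using exp_ge_add_one_self[of "- y"] by simp
        then have "(1 - y) * exp y \<le> exp (- y) * exp y" by (intro mult_right_mono) auto
        then show ?thesis by (simp add: exp_add[symmetric])
      qed
      then have "(1 + y) * ((1 - y) * exp y) \<le> (1 + y) * 1" using assms by (intro mult_left_mono) auto
      moreover have "exp y * (1 - y\<^sup>2) = (1 + y) * ((1 - y) * exp y)" by (simp add: power2_eq_square algebra_simps)
      ultimately show ?thesis by (simp only: mult_1_right)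
    next
      case False
      then have "1 - y\<^sup>2 \<le> 0" using power_mono[of 1 y 2] by simp
      then have "exp y * (1 - y\<^sup>2) \<le> 0" by (simp add: mult_nonneg_nonpos)
      then show ?thesis using assms by linarith
    qed
    then show ?thesis by (simp add: algebra_simps)
  qed
qed

lemma exp_minus_le_quadratic:
  assumes "y \<ge> (0::real)"
  shows "exp (- y) \<le> 1 - y + y\<^sup>2"
proof -
  have "1 \<le> (1 + y) * (1 - y + y\<^sup>2)"
    using assms by (simp add: power2_eq_square algebra_simps)
  also have "\<dots> \<le> exp y * (1 - y + y\<^sup>2)"
  proof (rule mult_right_mono)
    have "1 - y + y\<^sup>2 = (y - 1/2)\<^sup>2 + 3/4" by (simp add: power2_eq_square algebra_simps)
    then show "0 \<le> 1 - y + y\<^sup>2" by simp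
  qed (rule exp_ge_add_one_self)
  finally show ?thesis by (simp add: exp_minus field_simps)
qed

lemma nn_integral_exp_le_of_majorant:
  fixes f B :: "'a \<Rightarrow> real"
  assumes pt: "\<And>a. exp (f a) \<le> B a" and int: "integrable M B" and le: "integral\<^sup>L M B \<le> 1 + c"
  shows "(\<integral>\<^sup>+a. exp (f a) \<partial>M) \<le> ennreal (exp c)"
proof -
  have "(\<integral>\<^sup>+a. exp (f a) \<partial>M) \<le> (\<integral>\<^sup>+a. B a \<partial>M)"
    by (intro nn_integral_mono ennreal_leI pt)
  also have "\<dots> = ennreal (integral\<^sup>L M B)"
    using int order.trans[OF exp_ge_zero pt] by (intro nn_integral_eq_integral) auto
  also have "\<dots> \<le> ennreal (exp c)"
    using le exp_ge_add_one_self[of c] by (intro ennreal_leI) linarith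
  finally show ?thesis .
qed

text \<open>The bound \<open>l * W \<le> 1/16\<close> turns the exponential of the product into one of \<open>|q|\<^sup>2 / 16\<close>, so the second-order
  remainder is integrable with a constant independent of \<open>W\<close>.\<close>

lemma capped_mgf:
  assumes x: "nsq n x = 1" and e: "nsq n e = 1" and W: "W \<ge> 1" and l: "0 \<le> l" "l * W \<le> 1/16"
  shows "(\<integral>\<^sup>+a. exp (l * capped W (lf n x a) (lf n e a)) \<partial>gauss n)
     \<le> ennreal (exp (l * (1 + cmod2 (ip n x e)) + l\<^sup>2 * 2 ^ 21))"
proof -
  interpret G: prob_space "gauss n" by (rule prob_space_std_complex_normal_vec)
  let ?p = "\<lambda>a. lf n x a" and ?q = "\<lambda>a. lf n e a"
  let ?B = "\<lambda>a. 1 + l * (cmod2 (?p a) * cmod2 (?q a)) + l\<^sup>2 * 2 ^ 19 * (gexp (?p a) + gexp (?q a))"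
  have pt: "exp (l * capped W p q) \<le> 1 + l * (cmod2 p * cmod2 q) + l\<^sup>2 * 2 ^ 19 * (gexp p + gexp q)" for p q
  proof (cases "cmod2 p \<le> W")
    case False
    then show ?thesis using l gexp_pos[of p] gexp_pos[of q] by (simp add: capped_def)
  next
    case True
    define X where "X = cmod2 p * cmod2 q"
    have X: "X \<ge> 0" by (simp add: X_def)
    have "l * X \<le> (l * W) * cmod2 q"
      using True l by (auto simp: X_def mult.assoc intro!: mult_left_mono mult_right_mono)
    also have "\<dots> \<le> 1/16 * cmod2 q" using l by (intro mult_right_mono) auto
    finally have lX: "l * X \<le> cmod2 q / 16" by simp
    have "exp (l * X) \<le> 1 + l * X + (l * X)\<^sup>2 * exp (l * X)"
      using l X by (intro exp_le_quadratic) auto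
    also have "(l * X)\<^sup>2 * exp (l * X) \<le> l\<^sup>2 * (2 ^ 19 * (gexp p + gexp q))"
    proof -
      have "X\<^sup>2 * exp (l * X) \<le> X\<^sup>2 * exp (cmod2 q / 16)"
        using lX by (intro mult_left_mono) auto
      also have "\<dots> = (cmod p) ^ 4 * ((cmod q) ^ 4 * exp (cmod2 q / 16))"
        by (simp add: X_def power_mult_distrib power_mult[symmetric])
      also have "\<dots> \<le> (((cmod p) ^ 4)\<^sup>2 + ((cmod q) ^ 4 * exp (cmod2 q / 16))\<^sup>2) / 2"
        using zero_le_power2[of "(cmod p) ^ 4 - (cmod q) ^ 4 * exp (cmod2 q / 16)"]
        by (simp add: power2_eq_square algebra_simps)
      also have "((cmod q) ^ 4 * exp (cmod2 q / 16))\<^sup>2 = (cmod q) ^ 8 * exp (cmod2 q / 8)"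
        by (simp add: power_mult_distrib power_mult[symmetric] exp_double[symmetric])
      also have "((cmod p) ^ 4)\<^sup>2 = (cmod p) ^ 8" by (simp add: power_mult[symmetric])
      also have "((cmod p) ^ 8 + (cmod q) ^ 8 * exp (cmod2 q / 8)) / 2 \<le> (2 ^ 20 * gexp p + 2 ^ 20 * gexp q) / 2"
        by (intro divide_right_mono add_mono cmod8_le_gexp cmod8_gexp) auto
      finally have "X\<^sup>2 * exp (l * X) \<le> 2 ^ 19 * (gexp p + gexp q)" by simp
      then have "l\<^sup>2 * (X\<^sup>2 * exp (l * X)) \<le> l\<^sup>2 * (2 ^ 19 * (gexp p + gexp q))"
        by (intro mult_left_mono) auto
      then show ?thesis by (simp add: power_mult_distrib mult.assoc)
    qed
    finally show ?thesis using True by (simp add: capped_def X_def algebra_simps)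
  qed
  have iB: "integrable (gauss n) ?B"
    by (intro Bochner_Integration.integrable_add integrable_mult_right weighted_moment x e integrable_gexp) auto
  have EB: "(\<integral>a. ?B a \<partial>gauss n) = 1 + l * (1 + cmod2 (ip n x e))
      + l\<^sup>2 * 2 ^ 19 * ((\<integral>a. gexp (?p a) \<partial>gauss n) + (\<integral>a. gexp (?q a) \<partial>gauss n))"
    using weighted_moment[OF x e] integrable_gexp(1)[OF x] integrable_gexp(1)[OF e]
    by (simp add: G.prob_space)
  show ?thesis
  proof (rule nn_integral_exp_le_of_majorant[where B = ?B, OF pt iB])
    have "l\<^sup>2 * 2 ^ 19 * ((\<integral>a. gexp (?p a) \<partial>gauss n) + (\<integral>a. gexp (?q a) \<partial>gauss n)) \<le> l\<^sup>2 * 2 ^ 19 * (2 + 2)"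
      by (intro mult_left_mono add_mono integrable_gexp x e) auto
    then show "(\<integral>a. ?B a \<partial>gauss n) \<le> 1 + (l * (1 + cmod2 (ip n x e)) + l\<^sup>2 * 2 ^ 21)"
      unfolding EB by simp
  qed
qed

lemma mixed_square_sq_le:
  assumes "0 \<le> \<tau>" "\<tau> \<le> 1"
  shows "(mixed_square \<tau> p q)\<^sup>2 \<le> 2 ^ 27 * (gexp p + gexp q)"
proof -
  let ?P = "cmod2 p" and ?Q = "cmod2 q"
  note r = abs_Re_cnj_le[of p q]
  have "\<bar>\<tau> * ?Q + (1 - \<tau>) * (3/2) * Re (cnj p * q)\<bar> \<le> \<bar>\<tau> * ?Q\<bar> + \<bar>(1 - \<tau>) * (3/2) * Re (cnj p * q)\<bar>"
    by (rule abs_triangle_ineq)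
  also have "\<dots> \<le> 1 * ?Q + 1 * (3/2) * (cmod p * cmod q)"
    unfolding abs_mult using assms by (intro add_mono mult_mono r) auto
  also have "cmod p * cmod q \<le> (?P + ?Q) / 2"
    using zero_le_power2[of "cmod p - cmod q"] by (simp add: power2_eq_square algebra_simps)
  finally have c: "\<bar>\<tau> * ?Q + (1 - \<tau>) * (3/2) * Re (cnj p * q)\<bar> \<le> 1 * ?Q + 1 * (3/2) * ((?P + ?Q) / 2)"
    by simp
  have "1 * Q + 1 * (3/2) * ((P + Q) / 2) \<le> 2 * (P + Q)" if "P \<ge> 0" "Q \<ge> 0" for P Q :: real
    using that by simp
  from order.trans[OF c this] have b: "\<bar>\<tau> * ?Q + (1 - \<tau>) * (3/2) * Re (cnj p * q)\<bar> \<le> 2 * (?P + ?Q)"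
    by simp
  have "(mixed_square \<tau> p q)\<^sup>2 = \<bar>\<tau> * ?Q + (1 - \<tau>) * (3/2) * Re (cnj p * q)\<bar> ^ 4"
    by (simp add: mixed_square_def power_even_abs power_mult[symmetric])
  also have "\<dots> \<le> (2 * (?P + ?Q)) ^ 4" using b by (intro power_mono) auto
  also have "\<dots> = 16 * ((?P + ?Q)\<^sup>2)\<^sup>2"
  proof -
    have "(2 * y) ^ 4 = 16 * (y\<^sup>2)\<^sup>2" for y :: real by (simp add: power_mult_distrib power_mult[symmetric])
    then show ?thesis .
  qed
  also have "\<dots> \<le> 16 * (2 * (?P\<^sup>2 + ?Q\<^sup>2))\<^sup>2"
    using zero_le_power2[of "?P - ?Q"] by (intro mult_left_mono power_mono) (auto simp: power2_eq_square algebra_simps)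
  also have "\<dots> = 64 * (?P\<^sup>2 + ?Q\<^sup>2)\<^sup>2"
  proof -
    have "16 * (2 * y)\<^sup>2 = 64 * y\<^sup>2" for y :: real by (simp add: power_mult_distrib)
    then show ?thesis .
  qed
  also have "\<dots> \<le> 64 * (2 * ((?P\<^sup>2)\<^sup>2 + (?Q\<^sup>2)\<^sup>2))"
    using zero_le_power2[of "?P\<^sup>2 - ?Q\<^sup>2"] by (intro mult_left_mono) (auto simp: power2_eq_square algebra_simps)
  also have "\<dots> = 128 * ((cmod p) ^ 8 + (cmod q) ^ 8)" by (simp add: power_mult[symmetric])
  also have "\<dots> \<le> 128 * (2 ^ 20 * gexp p + 2 ^ 20 * gexp q)"
    by (intro mult_left_mono add_mono cmod8_le_gexp) auto
  finally show ?thesis by simp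
qed

text \<open>A nonnegative variable with a finite second moment has a Gaussian lower tail, because
  \<open>exp (- y) \<le> 1 - y + y\<^sup>2\<close> for all \<open>y \<ge> 0\<close>.\<close>

lemma mixed_square_mgf:
  assumes x: "nsq n x = 1" and e: "nsq n e = 1" and \<tau>: "0 \<le> \<tau>" "\<tau> \<le> 1" and l: "0 \<le> l"
  shows "(\<integral>\<^sup>+a. exp (- l * mixed_square \<tau> (lf n x a) (lf n e a)) \<partial>gauss n)
     \<le> ennreal (exp (- l * mixed_moment \<tau> (ip n x e) + l\<^sup>2 * 2 ^ 29))"
proof -
  interpret G: prob_space "gauss n" by (rule prob_space_std_complex_normal_vec)
  let ?p = "\<lambda>a. lf n x a" and ?q = "\<lambda>a. lf n e a"
  let ?B = "\<lambda>a. 1 - l * mixed_square \<tau> (?p a) (?q a) + l\<^sup>2 * 2 ^ 27 * (gexp (?p a) + gexp (?q a))"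
  have pt: "exp (- l * mixed_square \<tau> p q) \<le> 1 - l * mixed_square \<tau> p q + l\<^sup>2 * 2 ^ 27 * (gexp p + gexp q)" for p q
  proof -
    have "exp (- (l * mixed_square \<tau> p q)) \<le> 1 - l * mixed_square \<tau> p q + (l * mixed_square \<tau> p q)\<^sup>2"
      using l by (intro exp_minus_le_quadratic) (auto simp: mixed_square_def)
    also have "(l * mixed_square \<tau> p q)\<^sup>2 \<le> l\<^sup>2 * (2 ^ 27 * (gexp p + gexp q))"
      unfolding power_mult_distrib by (intro mult_left_mono mixed_square_sq_le \<tau>) auto
    finally show ?thesis by (simp add: algebra_simps)
  qed
  note ms = mixed_square_moment[OF x e, of \<tau>]
  have iB: "integrable (gauss n) ?B"
    by (intro Bochner_Integration.integrable_add Bochner_Integration.integrable_diff integrable_mult_right ms integrable_gexp x e) auto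
  have EB: "(\<integral>a. ?B a \<partial>gauss n) = 1 - l * mixed_moment \<tau> (ip n x e)
      + l\<^sup>2 * 2 ^ 27 * ((\<integral>a. gexp (?p a) \<partial>gauss n) + (\<integral>a. gexp (?q a) \<partial>gauss n))"
    using ms integrable_gexp(1)[OF x] integrable_gexp(1)[OF e]
    by (simp add: G.prob_space)
  show ?thesis
  proof (rule nn_integral_exp_le_of_majorant[where B = ?B, OF pt iB])
    have "l\<^sup>2 * 2 ^ 27 * ((\<integral>a. gexp (?p a) \<partial>gauss n) + (\<integral>a. gexp (?q a) \<partial>gauss n)) \<le> l\<^sup>2 * 2 ^ 27 * (2 + 2)"
      by (intro mult_left_mono add_mono integrable_gexp x e) auto
    then show "(\<integral>a. ?B a \<partial>gauss n) \<le> 1 + (- l * mixed_moment \<tau> (ip n x e) + l\<^sup>2 * 2 ^ 29)"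
      unfolding EB by simp
  qed
qed

lemma complex_normal_sample_eq: "complex_normal_sample m n = (\<Pi>\<^sub>M j\<in>{1..m}. gauss n)"
  by (simp add: complex_normal_sample_def)

lemma capped_sum_tail:
  assumes x: "nsq n x = 1" and e: "nsq n e = 1" and W: "W \<ge> 1" and \<delta>: "0 \<le> \<delta>" "\<delta> \<le> 1"
  shows "measure (complex_normal_sample m n) {a \<in> space (complex_normal_sample m n).
      real m * (1 + cmod2 (ip n x e) + \<delta>) \<le> (\<Sum>j=1..m. capped W (lf n x (a j)) (lf n e (a j)))}
    \<le> exp (- (real m * \<delta>\<^sup>2 / (2 ^ 23 * W)))"
proof (cases "\<delta> = 0")
  case True
  interpret P: prob_space "complex_normal_sample m n" by (rule prob_space_complex_normal_sample)
  show ?thesis using True by simp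
next
  case False
  let ?\<kappa> = "1 + cmod2 (ip n x e)"
  \<comment> \<open>The minimiser of \<open>l\<^sup>2 * 2 ^ 21 - l * \<delta>\<close>, divided by \<open>W\<close> to keep \<open>l * W\<close> small.\<close>
  define l where "l = \<delta> / (2 ^ 22 * W)"
  have l: "0 < l" "l * W \<le> 1/16" using W \<delta> False by (auto simp: l_def)
  have "(\<Sum>j=1..m. l * capped W (lf n x (a j)) (lf n e (a j))) = l * (\<Sum>j=1..m. capped W (lf n x (a j)) (lf n e (a j)))" for a
    by (simp add: sum_distrib_left)
  then have ev: "real m * (?\<kappa> + \<delta>) \<le> (\<Sum>j=1..m. capped W (lf n x (a j)) (lf n e (a j)))
     \<longleftrightarrow> l * (real m * (?\<kappa> + \<delta>)) \<le> (\<Sum>j=1..m. l * capped W (lf n x (a j)) (lf n e (a j)))" for a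
    using l by simp
  have "measure (complex_normal_sample m n) {a \<in> space (complex_normal_sample m n).
      real m * (?\<kappa> + \<delta>) \<le> (\<Sum>j=1..m. capped W (lf n x (a j)) (lf n e (a j)))}
    \<le> exp (real m * (l * ?\<kappa> + l\<^sup>2 * 2 ^ 21) - l * (real m * (?\<kappa> + \<delta>)))"
    unfolding ev complex_normal_sample_eq
    using l by (intro chernoff_sample[where f = "\<lambda>a. l * capped W (lf n x a) (lf n e a)"]
        prob_space_std_complex_normal_vec capped_mgf x e W) auto
  also have "real m * (l * ?\<kappa> + l\<^sup>2 * 2 ^ 21) - l * (real m * (?\<kappa> + \<delta>)) = real m * (l\<^sup>2 * 2 ^ 21 - l * \<delta>)"
    by (simp add: algebra_simps)
  also have "exp \<dots> \<le> exp (- (real m * \<delta>\<^sup>2 / (2 ^ 23 * W)))"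
  proof -
    have "l\<^sup>2 * 2 ^ 21 = \<delta>\<^sup>2 / (2 ^ 23 * W) * (1 / W)" by (simp add: l_def power2_eq_square field_simps)
    also have "\<dots> \<le> \<delta>\<^sup>2 / (2 ^ 23 * W) * 1" using W by (intro mult_left_mono) auto
    finally have "l\<^sup>2 * 2 ^ 21 \<le> \<delta>\<^sup>2 / (2 ^ 23 * W)" by simp
    moreover have "l * \<delta> = 2 * (\<delta>\<^sup>2 / (2 ^ 23 * W))" by (simp add: l_def power2_eq_square)
    note ud = calculation this
    have g: "u \<le> w \<Longrightarrow> v = 2 * w \<Longrightarrow> u - v \<le> - w" for u v w :: real by simp
    from ud have "l\<^sup>2 * 2 ^ 21 - l * \<delta> \<le> - (\<delta>\<^sup>2 / (2 ^ 23 * W))" by (rule g)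
    then have "real m * (l\<^sup>2 * 2 ^ 21 - l * \<delta>) \<le> real m * (- (\<delta>\<^sup>2 / (2 ^ 23 * W)))" by (intro mult_left_mono) auto
    then show ?thesis by simp
  qed
  finally show ?thesis .
qed

lemma mixed_sum_tail:
  assumes x: "nsq n x = 1" and e: "nsq n e = 1" and \<tau>: "0 \<le> \<tau>" "\<tau> \<le> 1" and \<delta>: "0 < \<delta>"
  shows "measure (complex_normal_sample m n) {a \<in> space (complex_normal_sample m n).
      (\<Sum>j=1..m. mixed_square \<tau> (lf n x (a j)) (lf n e (a j))) \<le> real m * (mixed_moment \<tau> (ip n x e) - \<delta>)}
    \<le> exp (- (real m * \<delta>\<^sup>2 / 2 ^ 31))"
proof -
  let ?\<mu> = "mixed_moment \<tau> (ip n x e)"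
  \<comment> \<open>The minimiser of \<open>l\<^sup>2 * 2 ^ 29 - l * \<delta>\<close>.\<close>
  define l where "l = \<delta> / 2 ^ 30"
  have l: "0 < l" using \<delta> by (auto simp: l_def)
  have "(\<Sum>j=1..m. - l * mixed_square \<tau> (lf n x (a j)) (lf n e (a j)))
      = - l * (\<Sum>j=1..m. mixed_square \<tau> (lf n x (a j)) (lf n e (a j)))" for a
    by (simp add: sum_distrib_left sum_negf)
  then have ev: "(\<Sum>j=1..m. mixed_square \<tau> (lf n x (a j)) (lf n e (a j))) \<le> real m * (?\<mu> - \<delta>)
     \<longleftrightarrow> - l * (real m * (?\<mu> - \<delta>)) \<le> (\<Sum>j=1..m. - l * mixed_square \<tau> (lf n x (a j)) (lf n e (a j)))" for a
    using l by simp
  have "measure (complex_normal_sample m n) {a \<in> space (complex_normal_sample m n).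
      (\<Sum>j=1..m. mixed_square \<tau> (lf n x (a j)) (lf n e (a j))) \<le> real m * (?\<mu> - \<delta>)}
    \<le> exp (real m * (- l * ?\<mu> + l\<^sup>2 * 2 ^ 29) - (- l * (real m * (?\<mu> - \<delta>))))"
    unfolding ev complex_normal_sample_eq
    using l by (intro chernoff_sample[where f = "\<lambda>a. - l * mixed_square \<tau> (lf n x a) (lf n e a)"]
        prob_space_std_complex_normal_vec mixed_square_mgf x e \<tau>) auto
  also have "real m * (- l * ?\<mu> + l\<^sup>2 * 2 ^ 29) - (- l * (real m * (?\<mu> - \<delta>))) = real m * (l\<^sup>2 * 2 ^ 29 - l * \<delta>)"
    by (simp add: algebra_simps)
  also have "l\<^sup>2 * 2 ^ 29 - l * \<delta> = - (\<delta>\<^sup>2 / 2 ^ 31)" by (simp add: l_def power2_eq_square)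
  finally show ?thesis by simp
qed

section \<open>From a net to all directions\<close>

lemma floor_eq_close:
  fixes u v B :: real
  assumes "\<lfloor>B * u\<rfloor> = \<lfloor>B * v\<rfloor>" "B > 0"
  shows "\<bar>u - v\<bar> \<le> 1 / B"
proof -
  have "\<bar>B * u - B * v\<bar> \<le> 1" using assms(1) by linarith
  then have "B * \<bar>u - v\<bar> \<le> 1" using assms(2) by (simp add: right_diff_distrib[symmetric] abs_mult)
  then show ?thesis using assms(2) by (simp add: field_simps)
qed

lemma unit_coordinate:
  assumes "nsq n e = 1" "i < n"
  shows "cmod (e i) \<le> 1"
proof -
  have "cmod2 (e i) \<le> nsq n e"
    unfolding nsq_def using assms(2) by (intro member_le_sum) auto
  then have "cmod2 (e i) \<le> 1\<^sup>2" using assms(1) by simp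
  then show ?thesis by (rule power2_le_imp_le) simp
qed

lemma nrm_le_sum: "nrm n z \<le> (\<Sum>i<n. cmod (z i))"
  unfolding nrm_L2 by (rule L2_set_le_sum) auto

text \<open>A coordinatewise grid. For \<open>B\<close> a power of \<open>m\<close> its cardinality has a logarithm of order \<open>n ln m\<close>, which the
  number of samples can absorb.\<close>

lemma sphere_net:
  assumes B: "B \<ge> (1::nat)"
  obtains T where "finite T" "card T \<le> (2 * B + 1) ^ (2 * n)" "\<And>e. e \<in> T \<Longrightarrow> nsq n e = 1"
    "\<And>e. nsq n e = 1 \<Longrightarrow> \<exists>e'\<in>T. nrm n (\<lambda>i. e i - e' i) \<le> 2 * real n / real B"
proof -
  let ?S = "{e. nsq n e = 1}"
  \<comment> \<open>Two unit vectors in the same grid cell are close; one representative per nonempty cell keeps the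
    net on the sphere.\<close>
  define key where "key e = (\<lambda>i\<in>{..<n}. (\<lfloor>real B * Re (e i)\<rfloor>, \<lfloor>real B * Im (e i)\<rfloor>))" for e :: "nat \<Rightarrow> complex"
  let ?I = "{- int B..int B}"
  have rng: "\<lfloor>real B * y\<rfloor> \<in> ?I" if "\<bar>y\<bar> \<le> 1" for y
  proof -
    have "real B * y \<le> real B * 1" "real B * (-1) \<le> real B * y"
      using that by (intro mult_left_mono; simp)+
    then show ?thesis by (auto simp: le_floor_iff floor_le_iff)
  qed
  have sub: "key ` ?S \<subseteq> (\<Pi>\<^sub>E i\<in>{..<n}. ?I \<times> ?I)"
  proof
    fix k assume "k \<in> key ` ?S"
    then obtain e where e: "nsq n e = 1" "k = key e" by auto
    have "\<bar>Re (e i)\<bar> \<le> 1 \<and> \<bar>Im (e i)\<bar> \<le> 1" if "i < n" for i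
      using unit_coordinate[OF e(1) that] abs_Re_le_cmod[of "e i"] abs_Im_le_cmod[of "e i"] by linarith
    then show "k \<in> (\<Pi>\<^sub>E i\<in>{..<n}. ?I \<times> ?I)" using rng by (auto simp: e(2) key_def)
  qed
  have fin: "finite (\<Pi>\<^sub>E i\<in>{..<n}. ?I \<times> ?I)" by (intro finite_PiE) auto
  have "card ?I = 2 * B + 1" by (simp add: nat_add_distrib nat_mult_distrib)
  then have "card (\<Pi>\<^sub>E i\<in>{..<n}. ?I \<times> ?I) = (2 * B + 1) ^ (2 * n)"
    by (simp only: card_PiE[OF finite_lessThan] card_cartesian_product prod_constant card_lessThan
        power_mult power2_eq_square)
  then have card: "card (key ` ?S) \<le> (2 * B + 1) ^ (2 * n)"
    using card_mono[OF fin sub] by simp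
  define pick where "pick k = (SOME e. nsq n e = 1 \<and> key e = k)" for k
  have pick: "nsq n (pick (key e)) = 1 \<and> key (pick (key e)) = key e" if "nsq n e = 1" for e
    unfolding pick_def by (rule someI[of _ e]) (use that in simp)
  show thesis
  proof
    show "finite (pick ` key ` ?S)" using finite_subset[OF sub fin] by simp
    show "card (pick ` key ` ?S) \<le> (2 * B + 1) ^ (2 * n)"
      using card_image_le[OF finite_subset[OF sub fin], of pick] card by linarith
    show "nsq n e = 1" if "e \<in> pick ` key ` ?S" for e using that pick by auto
    show "\<exists>e'\<in>pick ` key ` ?S. nrm n (\<lambda>i. e i - e' i) \<le> 2 * real n / real B" if e: "nsq n e = 1" for e
    proof (rule bexI)
      let ?e = "pick (key e)"
      have c: "cmod (e i - ?e i) \<le> 2 / real B" if i: "i < n" for i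
      proof -
        have "key ?e i = key e i" using pick[OF e] by simp
        then have "\<lfloor>real B * Re (e i)\<rfloor> = \<lfloor>real B * Re (?e i)\<rfloor>" "\<lfloor>real B * Im (e i)\<rfloor> = \<lfloor>real B * Im (?e i)\<rfloor>"
          using i by (simp_all add: key_def)
        from this[THEN floor_eq_close] B have "\<bar>Re (e i) - Re (?e i)\<bar> \<le> 1 / real B" "\<bar>Im (e i) - Im (?e i)\<bar> \<le> 1 / real B"
          by auto
        then show ?thesis using cmod_le[of "e i - ?e i"] by simp
      qed
      have "nrm n (\<lambda>i. e i - ?e i) \<le> (\<Sum>i<n. cmod (e i - ?e i))" by (rule nrm_le_sum)
      also have "\<dots> \<le> real (card {..<n}) * (2 / real B)" by (rule sum_bounded_above) (use c in auto)
      finally show "nrm n (\<lambda>i. e i - ?e i) \<le> 2 * real n / real B" by (simp add: mult.commute)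
    qed (use e in auto)
  qed
qed

lemma abs_mult_diff_le:
  fixes a b c d :: real
  shows "\<bar>a * b - c * d\<bar> \<le> \<bar>a - c\<bar> * \<bar>b\<bar> + \<bar>c\<bar> * \<bar>b - d\<bar>"
proof -
  have "a * b - c * d = (a - c) * b + c * (b - d)" by (simp add: algebra_simps)
  then show ?thesis by (metis abs_mult abs_triangle_ineq)
qed

lemma abs_square_diff_le:
  fixes a b M :: real
  assumes "\<bar>a\<bar> \<le> M" "\<bar>b\<bar> \<le> M"
  shows "\<bar>a\<^sup>2 - b\<^sup>2\<bar> \<le> 2 * M * \<bar>a - b\<bar>"
proof -
  have "\<bar>a\<^sup>2 - b\<^sup>2\<bar> = \<bar>a + b\<bar> * \<bar>a - b\<bar>" by (simp add: power2_eq_square algebra_simps flip: abs_mult)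
  also have "\<dots> \<le> (2 * M) * \<bar>a - b\<bar>" using assms by (intro mult_right_mono) linarith+
  finally show ?thesis .
qed

lemma cmod_sq_diff_le:
  assumes "cmod u \<le> M" "cmod v \<le> M"
  shows "\<bar>cmod2 u - cmod2 v\<bar> \<le> 2 * M * cmod (u - v)"
proof -
  have "\<bar>cmod2 u - cmod2 v\<bar> \<le> 2 * M * \<bar>cmod u - cmod v\<bar>"
    using assms by (intro abs_square_diff_le) auto
  also have "\<dots> \<le> 2 * M * cmod (u - v)"
    using assms norm_ge_zero[of u] by (intro mult_left_mono norm_triangle_ineq3) linarith
  finally show ?thesis .
qed

lemma mixed_moment_lipschitz:
  assumes \<tau>: "0 \<le> \<tau>" "\<tau> \<le> 1" "0 \<le> \<tau>'" "\<tau>' \<le> 1" and w: "cmod w \<le> 1" "cmod w' \<le> 1"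
  shows "\<bar>mixed_moment \<tau> w - mixed_moment \<tau>' w'\<bar> \<le> 22 * \<bar>\<tau> - \<tau>'\<bar> + 18 * cmod (w - w')"
proof -
  define \<delta> \<epsilon> where "\<delta> = \<bar>\<tau> - \<tau>'\<bar>" and "\<epsilon> = cmod (w - w')"
  define g where "g = (\<lambda>w. 1/2 + 2 * (Re w)\<^sup>2 - cmod2 w / 2)"
  have d: "0 \<le> \<delta>" "0 \<le> \<epsilon>" by (auto simp: \<delta>_def \<epsilon>_def)
  have R: "\<bar>Re w\<bar> \<le> 1" "\<bar>Re w'\<bar> \<le> 1" using w abs_Re_le_cmod[of w] abs_Re_le_cmod[of w'] by linarith+
  have Rd: "\<bar>Re w - Re w'\<bar> \<le> \<epsilon>" using abs_Re_le_cmod[of "w - w'"] by (simp add: \<epsilon>_def)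
  have 1: "\<bar>\<tau>\<^sup>2 - \<tau>'\<^sup>2\<bar> \<le> 2 * \<delta>" using abs_square_diff_le[of \<tau> 1 \<tau>'] \<tau> by (simp add: \<delta>_def)
  have 2: "\<bar>\<tau> * (1 - \<tau>) * Re w - \<tau>' * (1 - \<tau>') * Re w'\<bar> \<le> \<delta> + \<epsilon>"
  proof -
    have "\<bar>\<tau> * (1 - \<tau>) - \<tau>' * (1 - \<tau>')\<bar> = \<bar>1 - \<tau> - \<tau>'\<bar> * \<delta>"
      unfolding \<delta>_def abs_mult[symmetric] by (simp add: algebra_simps)
    also have "\<dots> \<le> 1 * \<delta>" using \<tau> d by (intro mult_right_mono) linarith+
    finally have a: "\<bar>\<tau> * (1 - \<tau>) - \<tau>' * (1 - \<tau>')\<bar> \<le> \<delta>" by simp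
    have "\<bar>\<tau>' * (1 - \<tau>')\<bar> \<le> 1 * 1" unfolding abs_mult using \<tau> by (intro mult_mono) auto
    then have b: "\<bar>\<tau>' * (1 - \<tau>')\<bar> \<le> 1" by simp
    have "\<bar>\<tau> * (1 - \<tau>) * Re w - \<tau>' * (1 - \<tau>') * Re w'\<bar>
        \<le> \<bar>\<tau> * (1 - \<tau>) - \<tau>' * (1 - \<tau>')\<bar> * \<bar>Re w\<bar> + \<bar>\<tau>' * (1 - \<tau>')\<bar> * \<bar>Re w - Re w'\<bar>"
      by (rule abs_mult_diff_le)
    also have "\<dots> \<le> \<delta> * 1 + 1 * \<epsilon>" using a b R Rd d by (intro add_mono mult_mono) auto
    finally show ?thesis by simp
  qed
  have gd: "\<bar>g w - g w'\<bar> \<le> 5 * \<epsilon>"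
  proof -
    have "\<bar>(Re w)\<^sup>2 - (Re w')\<^sup>2\<bar> \<le> 2 * 1 * \<bar>Re w - Re w'\<bar>" using R by (rule abs_square_diff_le)
    moreover have "\<bar>cmod2 w - cmod2 w'\<bar> \<le> 2 * 1 * \<epsilon>" unfolding \<epsilon>_def using w by (rule cmod_sq_diff_le)
    moreover have "\<bar>1/2 + 2 * A - C / 2 - (1/2 + 2 * A' - C' / 2)\<bar> \<le> 5 * r"
      if "\<bar>A - A'\<bar> \<le> 2 * r" "\<bar>C - C'\<bar> \<le> 2 * r" for A A' C C' r :: real
      using that by linarith
    ultimately show ?thesis using Rd unfolding g_def by simp
  qed
  have gb: "\<bar>g w\<bar> \<le> 5/2"
  proof -
    have "(Re w)\<^sup>2 \<le> 1" "cmod2 w \<le> 1"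
      using R w by (simp_all add: abs_square_le_1 power_le_one)
    then show ?thesis using zero_le_power2[of "Re w"] zero_le_power2[of "cmod w"] unfolding g_def by linarith
  qed
  have 3: "\<bar>(1 - \<tau>)\<^sup>2 * g w - (1 - \<tau>')\<^sup>2 * g w'\<bar> \<le> 5 * \<delta> + 5 * \<epsilon>"
  proof -
    have a: "\<bar>(1 - \<tau>)\<^sup>2 - (1 - \<tau>')\<^sup>2\<bar> \<le> 2 * \<delta>"
      using abs_square_diff_le[of "1 - \<tau>" 1 "1 - \<tau>'"] \<tau> by (simp add: \<delta>_def abs_minus_commute)
    have b: "\<bar>(1 - \<tau>')\<^sup>2\<bar> \<le> 1" using \<tau> by (simp add: power_le_one)
    have "\<bar>(1 - \<tau>)\<^sup>2 * g w - (1 - \<tau>')\<^sup>2 * g w'\<bar>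
        \<le> \<bar>(1 - \<tau>)\<^sup>2 - (1 - \<tau>')\<^sup>2\<bar> * \<bar>g w\<bar> + \<bar>(1 - \<tau>')\<^sup>2\<bar> * \<bar>g w - g w'\<bar>"
      by (rule abs_mult_diff_le)
    also have "\<dots> \<le> (2 * \<delta>) * (5/2) + 1 * (5 * \<epsilon>)"
      using a b gb gd d by (intro add_mono mult_mono) auto
    finally show ?thesis by simp
  qed
  have mm: "mixed_moment \<tau> w = 2 * \<tau>\<^sup>2 + 6 * (\<tau> * (1 - \<tau>) * Re w) + 9/4 * ((1 - \<tau>)\<^sup>2 * g w)" for \<tau> w
    by (simp add: mixed_moment_def g_def)
  have "\<bar>mixed_moment \<tau> w - mixed_moment \<tau>' w'\<bar> \<le> 2 * (2 * \<delta>) + 6 * (\<delta> + \<epsilon>) + 9/4 * (5 * \<delta> + 5 * \<epsilon>)"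
  proof -
    have "\<bar>2 * A + 6 * B + 9/4 * C - (2 * A' + 6 * B' + 9/4 * C')\<bar> \<le> 2 * r + 6 * r' + 9/4 * r''"
      if "\<bar>A - A'\<bar> \<le> r" "\<bar>B - B'\<bar> \<le> r'" "\<bar>C - C'\<bar> \<le> r''" for A A' B B' C C' r r' r'' :: real
      using that by linarith
    from this[OF 1 2 3] show ?thesis unfolding mm .
  qed
  also have "\<dots> \<le> 22 * \<delta> + 18 * \<epsilon>" using d by simp
  finally show ?thesis unfolding \<delta>_def \<epsilon>_def .
qed

lemma mixed_square_lipschitz:
  assumes N: "N \<ge> 1" and p: "cmod p \<le> N" and q: "cmod q \<le> N" "cmod q' \<le> N"
    and \<tau>: "0 \<le> \<tau>" "\<tau> \<le> 1" "0 \<le> \<tau>'" "\<tau>' \<le> 1"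
  shows "\<bar>mixed_square \<tau> p q - mixed_square \<tau>' p q'\<bar> \<le> 25 * N ^ 3 * (N * \<bar>\<tau> - \<tau>'\<bar> + cmod (q - q'))"
proof -
  define \<delta> \<epsilon> where "\<delta> = \<bar>\<tau> - \<tau>'\<bar>" and "\<epsilon> = cmod (q - q')"
  have d: "0 \<le> \<delta>" "0 \<le> \<epsilon>" by (auto simp: \<delta>_def \<epsilon>_def)
  let ?y = "\<lambda>\<tau> q. \<tau> * cmod2 q + (1 - \<tau>) * ((3/2) * Re (cnj p * q))"
  have re: "\<bar>Re (cnj p * v)\<bar> \<le> N * cmod v" for v
  proof -
    have "\<bar>Re (cnj p * v)\<bar> \<le> cmod p * cmod v" by (rule abs_Re_cnj_le)
    also have "\<dots> \<le> N * cmod v" using p by (intro mult_right_mono) auto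
    finally show ?thesis .
  qed
  have sqb: "cmod2 v \<le> N\<^sup>2" if "cmod v \<le> N" for v using that by (intro power_mono) auto
  have reb: "\<bar>(3/2) * Re (cnj p * v)\<bar> \<le> 3/2 * N\<^sup>2" if "cmod v \<le> N" for v
  proof -
    have "\<bar>Re (cnj p * v)\<bar> \<le> N * N"
      using re[of v] mult_left_mono[OF that, of N] N by linarith
    moreover have "\<bar>(3/2) * r\<bar> = 3/2 * \<bar>r\<bar>" for r :: real by (simp add: abs_mult)
    ultimately show ?thesis by (simp only: power2_eq_square)
  qed
  have yb: "\<bar>?y \<tau> v\<bar> \<le> 5/2 * N\<^sup>2" if "cmod v \<le> N" "0 \<le> \<tau>" "\<tau> \<le> 1" for \<tau> v
  proof -
    have "\<bar>?y \<tau> v\<bar> \<le> \<bar>\<tau>\<bar> * \<bar>cmod2 v\<bar> + \<bar>1 - \<tau>\<bar> * \<bar>(3/2) * Re (cnj p * v)\<bar>"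
      unfolding abs_mult[symmetric] by (rule abs_triangle_ineq)
    also have "\<dots> \<le> 1 * N\<^sup>2 + 1 * (3/2 * N\<^sup>2)"
      using that sqb[OF that(1)] reb[OF that(1)] by (intro add_mono mult_mono) auto
    finally show ?thesis by simp
  qed
  have dy: "\<bar>?y \<tau> q - ?y \<tau>' q'\<bar> \<le> 5/2 * N\<^sup>2 * \<delta> + 7/2 * N * \<epsilon>"
  proof -
    have "\<bar>\<tau> * cmod2 q - \<tau>' * cmod2 q'\<bar> \<le> \<bar>\<tau> - \<tau>'\<bar> * \<bar>cmod2 q\<bar> + \<bar>\<tau>'\<bar> * \<bar>cmod2 q - cmod2 q'\<bar>"
      by (rule abs_mult_diff_le)
    also have "\<dots> \<le> \<delta> * N\<^sup>2 + 1 * (2 * N * \<epsilon>)"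
      using \<tau> sqb[OF q(1)] cmod_sq_diff_le[OF q] d by (intro add_mono mult_mono) (auto simp: \<delta>_def \<epsilon>_def)
    finally have a: "\<bar>\<tau> * cmod2 q - \<tau>' * cmod2 q'\<bar> \<le> \<delta> * N\<^sup>2 + 2 * N * \<epsilon>" by simp
    have "\<bar>(1 - \<tau>) * ((3/2) * Re (cnj p * q)) - (1 - \<tau>') * ((3/2) * Re (cnj p * q'))\<bar>
       \<le> \<bar>(1 - \<tau>) - (1 - \<tau>')\<bar> * \<bar>(3/2) * Re (cnj p * q)\<bar> + \<bar>1 - \<tau>'\<bar> * \<bar>(3/2) * Re (cnj p * q) - (3/2) * Re (cnj p * q')\<bar>"
      by (rule abs_mult_diff_le)
    also have "(3/2) * Re (cnj p * q) - (3/2) * Re (cnj p * q') = (3/2) * Re (cnj p * (q - q'))"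
      by (simp add: algebra_simps)
    also have "\<bar>(1 - \<tau>) - (1 - \<tau>')\<bar> * \<bar>(3/2) * Re (cnj p * q)\<bar> + \<bar>1 - \<tau>'\<bar> * \<bar>(3/2) * Re (cnj p * (q - q'))\<bar>
        \<le> \<delta> * (3/2 * N\<^sup>2) + 1 * (3/2 * (N * \<epsilon>))"
      using \<tau> reb[OF q(1)] re[of "q - q'"] d by (intro add_mono mult_mono) (auto simp: \<delta>_def \<epsilon>_def abs_mult)
    finally have b: "\<bar>(1 - \<tau>) * ((3/2) * Re (cnj p * q)) - (1 - \<tau>') * ((3/2) * Re (cnj p * q'))\<bar>
        \<le> \<delta> * (3/2 * N\<^sup>2) + 3/2 * (N * \<epsilon>)" by simp
    have "\<bar>?y \<tau> q - ?y \<tau>' q'\<bar> \<le> (\<delta> * N\<^sup>2 + 2 * N * \<epsilon>) + (\<delta> * (3/2 * N\<^sup>2) + 3/2 * (N * \<epsilon>))"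
      using a b by linarith
    also have "\<dots> = 5/2 * N\<^sup>2 * \<delta> + 7/2 * N * \<epsilon>" by (simp add: algebra_simps)
    finally show ?thesis .
  qed
  have ms: "mixed_square \<tau> p q = (?y \<tau> q)\<^sup>2" for \<tau> q by (simp only: mixed_square_def mult.assoc)
  have "\<bar>mixed_square \<tau> p q - mixed_square \<tau>' p q'\<bar> \<le> 2 * (5/2 * N\<^sup>2) * \<bar>?y \<tau> q - ?y \<tau>' q'\<bar>"
    unfolding ms using q \<tau> by (intro abs_square_diff_le yb) auto
  also have "\<dots> \<le> 2 * (5/2 * N\<^sup>2) * (5/2 * N\<^sup>2 * \<delta> + 7/2 * N * \<epsilon>)"
    using dy by (intro mult_left_mono) auto
  also have "\<dots> = 25/2 * N ^ 3 * (N * \<delta>) + 35/2 * N ^ 3 * \<epsilon>"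
    by (simp add: power2_eq_square power3_eq_cube algebra_simps)
  also have "\<dots> \<le> 25 * N ^ 3 * (N * \<delta>) + 25 * N ^ 3 * \<epsilon>"
    using N d by (intro add_mono mult_right_mono) auto
  finally show ?thesis by (simp add: \<delta>_def \<epsilon>_def distrib_left)
qed

text \<open>All sums are polynomial in the direction with coefficients controlled by \<open>N\<close>, so they change little
  between a direction and its neighbour in the net; \<open>\<tau>\<close> is rounded down to a multiple of \<open>1 / B\<close>.\<close>

lemma regular_sample_of_net:
  assumes x: "nsq n x = 1" and N: "N \<ge> 1" "\<And>j. j \<in> {1..m} \<Longrightarrow> nrm n (a j) \<le> N"
    and B: "B \<ge> (1::nat)" and T1: "\<And>e. e \<in> T \<Longrightarrow> nsq n e = 1"
    and T: "\<And>e. nsq n e = 1 \<Longrightarrow> \<exists>e'\<in>T. nrm n (\<lambda>i. e i - e' i) \<le> \<epsilon>"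
    and up: "\<And>e. e \<in> T \<Longrightarrow> (\<Sum>j=1..m. cmod2 (ip n (a j) x) * cmod2 (ip n (a j) e))
        \<le> real m * (1 + cmod2 (ip n x e) + 1/200)"
    and low: "\<And>e k. e \<in> T \<Longrightarrow> k \<le> B \<Longrightarrow> (\<Sum>j=1..m. mixed_square (real k / real B) (ip n (a j) x) (ip n (a j) e))
        \<ge> real m * (mixed_moment (real k / real B) (ip n x e) - 1/200)"
    and small: "25 * N ^ 4 * (1 / real B + \<epsilon>) + 22 / real B + 18 * \<epsilon> \<le> 1/200"
  shows "regular_sample n m a x"
proof -
  have nx: "nrm n x = 1" using x by (simp add: nrm_def)
  have unit: "nrm n e = 1" if "nsq n e = 1" for e using that by (simp add: nrm_def)
  have bnd: "cmod (ip n (a j) e) \<le> N * nrm n e" if "j \<in> {1..m}" for j e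
    using ip_CS[of n "a j" e] mult_right_mono[OF N(2)[OF that], of "nrm n e"] by simp
  have near: "\<exists>e'\<in>T. nrm n (\<lambda>i. e i - e' i) \<le> \<epsilon> \<and> \<epsilon> \<ge> 0 \<and> nsq n e' = 1
      \<and> (\<forall>j\<in>{1..m}. cmod (ip n (a j) e - ip n (a j) e') \<le> N * \<epsilon>)
      \<and> cmod (ip n x e - ip n x e') \<le> \<epsilon> \<and> cmod (ip n x e) \<le> 1 \<and> cmod (ip n x e') \<le> 1"
    if e: "nsq n e = 1" for e
  proof -
    obtain e' where e': "e' \<in> T" "nrm n (\<lambda>i. e i - e' i) \<le> \<epsilon>" using T[OF e] by blast
    have \<epsilon>0: "\<epsilon> \<ge> 0" using e'(2) nrm_nonneg order.trans by blast
    have u': "nsq n e' = 1" using T1[OF e'(1)] .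
    have dj: "cmod (ip n (a j) e - ip n (a j) e') \<le> N * \<epsilon>" if "j \<in> {1..m}" for j
      unfolding ip_diff[symmetric] using bnd[OF that, of "\<lambda>i. e i - e' i"] mult_left_mono[OF e'(2), of N] N by linarith
    have dx: "cmod (ip n x e - ip n x e') \<le> \<epsilon>"
      unfolding ip_diff[symmetric] using ip_CS[of n x "\<lambda>i. e i - e' i"] e'(2) nx by simp
    have wb: "cmod (ip n x e) \<le> 1" "cmod (ip n x e') \<le> 1"
      using ip_CS[of n x e] ip_CS[of n x e'] nx unit[OF e] unit[OF u'] by auto
    show ?thesis using e' \<epsilon>0 u' dj dx wb by blast
  qed
  show ?thesis
    unfolding regular_sample_def
  proof (intro conjI allI impI)
    fix e assume e: "nsq n e = 1"
    obtain e' where e': "e' \<in> T" "nrm n (\<lambda>i. e i - e' i) \<le> \<epsilon>" and \<epsilon>0: "\<epsilon> \<ge> 0" and u': "nsq n e' = 1"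
      and dj: "\<And>j. j \<in> {1..m} \<Longrightarrow> cmod (ip n (a j) e - ip n (a j) e') \<le> N * \<epsilon>"
      and dx: "cmod (ip n x e - ip n x e') \<le> \<epsilon>"
      and wb: "cmod (ip n x e) \<le> 1" "cmod (ip n x e') \<le> 1"
      using near[OF e] by metis
    have pw: "cmod2 (ip n (a j) x) * cmod2 (ip n (a j) e)
        \<le> cmod2 (ip n (a j) x) * cmod2 (ip n (a j) e') + 2 * N ^ 4 * \<epsilon>" if j: "j \<in> {1..m}" for j
    proof -
      have "\<bar>cmod2 (ip n (a j) e) - cmod2 (ip n (a j) e')\<bar> \<le> 2 * N * cmod (ip n (a j) e - ip n (a j) e')"
        using bnd[OF j, of e] bnd[OF j, of e'] unit[OF e] unit[OF u'] by (intro cmod_sq_diff_le) auto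
      also have "\<dots> \<le> 2 * N * (N * \<epsilon>)" using dj[OF j] N by (intro mult_left_mono) auto
      finally have "cmod2 (ip n (a j) x) * (cmod2 (ip n (a j) e) - cmod2 (ip n (a j) e')) \<le> N\<^sup>2 * (2 * N * (N * \<epsilon>))"
      proof -
        assume c: "\<bar>cmod2 (ip n (a j) e) - cmod2 (ip n (a j) e')\<bar> \<le> 2 * N * (N * \<epsilon>)"
        have "cmod2 (ip n (a j) x) * (cmod2 (ip n (a j) e) - cmod2 (ip n (a j) e'))
            \<le> cmod2 (ip n (a j) x) * (2 * N * (N * \<epsilon>))"
          using c by (intro mult_left_mono) auto
        also have "\<dots> \<le> N\<^sup>2 * (2 * N * (N * \<epsilon>))"
          using bnd[OF j, of x] nx N \<epsilon>0 by (intro mult_right_mono power_mono) auto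
        finally show ?thesis .
      qed
      also have "N\<^sup>2 * (2 * N * (N * \<epsilon>)) = 2 * N ^ 4 * \<epsilon>" by (simp add: power2_eq_square power4_eq_xxxx)
      finally show ?thesis by (simp add: right_diff_distrib)
    qed
    have "(\<Sum>j=1..m. cmod2 (ip n (a j) x) * cmod2 (ip n (a j) e))
      \<le> (\<Sum>j=1..m. cmod2 (ip n (a j) x) * cmod2 (ip n (a j) e') + 2 * N ^ 4 * \<epsilon>)"
      by (intro sum_mono pw)
    also have "\<dots> = (\<Sum>j=1..m. cmod2 (ip n (a j) x) * cmod2 (ip n (a j) e')) + real m * (2 * N ^ 4 * \<epsilon>)"
      by (simp add: sum.distrib)
    also have "\<dots> \<le> real m * (1 + cmod2 (ip n x e') + 1/200) + real m * (2 * N ^ 4 * \<epsilon>)"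
      using up[OF e'(1)] by simp
    also have "\<dots> = real m * (1 + cmod2 (ip n x e') + 1/200 + 2 * N ^ 4 * \<epsilon>)" by (simp add: algebra_simps)
    also have "\<dots> \<le> real m * (1 + cmod2 (ip n x e) + 1/100)"
    proof (intro mult_left_mono)
      have "\<bar>cmod2 (ip n x e) - cmod2 (ip n x e')\<bar> \<le> 2 * 1 * cmod (ip n x e - ip n x e')"
        using wb by (rule cmod_sq_diff_le)
      then have "cmod2 (ip n x e') \<le> cmod2 (ip n x e) + 2 * \<epsilon>" using dx by linarith
      moreover have "2 * N ^ 4 * \<epsilon> + 2 * \<epsilon> \<le> 1/200"
      proof -
        have "2 * N ^ 4 * \<epsilon> \<le> 25 * N ^ 4 * \<epsilon>" using N \<epsilon>0 by (intro mult_right_mono) auto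
        moreover have "0 \<le> 25 * N ^ 4 * (1 / real B)" "0 \<le> 22 / real B" using N by auto
        ultimately show ?thesis using small \<epsilon>0 by (simp only: distrib_left)
      qed
      ultimately show "1 + cmod2 (ip n x e') + 1/200 + 2 * N ^ 4 * \<epsilon> \<le> 1 + cmod2 (ip n x e) + 1/100" by linarith
    qed simp
    finally show "(\<Sum>j=1..m. cmod2 (ip n (a j) x) * cmod2 (ip n (a j) e)) \<le> real m * (1 + cmod2 (ip n x e) + 1/100)" .
  next
    fix e and \<tau> :: real assume e: "nsq n e = 1" and \<tau>: "0 \<le> \<tau>" "\<tau> \<le> 1"
    obtain e' where e': "e' \<in> T" "nrm n (\<lambda>i. e i - e' i) \<le> \<epsilon>" and \<epsilon>0: "\<epsilon> \<ge> 0" and u': "nsq n e' = 1"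
      and dj: "\<And>j. j \<in> {1..m} \<Longrightarrow> cmod (ip n (a j) e - ip n (a j) e') \<le> N * \<epsilon>"
      and dx: "cmod (ip n x e - ip n x e') \<le> \<epsilon>"
      and wb: "cmod (ip n x e) \<le> 1" "cmod (ip n x e') \<le> 1"
      using near[OF e] by metis
    define k where "k = nat \<lfloor>real B * \<tau>\<rfloor>"
    have rk: "real k = of_int \<lfloor>real B * \<tau>\<rfloor>" using \<tau> by (simp add: k_def)
    have "real B * \<tau> \<le> real B * 1" using \<tau> by (intro mult_left_mono) auto
    then have "real k \<le> real B" using rk by linarith
    then have kB: "k \<le> B" by simp
    define \<tau>' where "\<tau>' = real k / real B"
    have \<tau>': "0 \<le> \<tau>'" "\<tau>' \<le> 1" using kB B by (auto simp: \<tau>'_def)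
    have d\<tau>: "\<bar>\<tau> - \<tau>'\<bar> \<le> 1 / real B"
    proof (rule floor_eq_close)
      show "\<lfloor>real B * \<tau>\<rfloor> = \<lfloor>real B * \<tau>'\<rfloor>" using B rk by (simp add: \<tau>'_def)
    qed (use B in simp)
    have pw: "mixed_square \<tau>' (ip n (a j) x) (ip n (a j) e') - 25 * N ^ 4 * (1 / real B + \<epsilon>)
        \<le> mixed_square \<tau> (ip n (a j) x) (ip n (a j) e)" if j: "j \<in> {1..m}" for j
    proof -
      have "\<bar>mixed_square \<tau> (ip n (a j) x) (ip n (a j) e) - mixed_square \<tau>' (ip n (a j) x) (ip n (a j) e')\<bar>
         \<le> 25 * N ^ 3 * (N * \<bar>\<tau> - \<tau>'\<bar> + cmod (ip n (a j) e - ip n (a j) e'))"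
        using bnd[OF j, of x] bnd[OF j, of e] bnd[OF j, of e'] nx unit[OF e] unit[OF u'] \<tau> \<tau>'
        by (intro mixed_square_lipschitz N(1)) auto
      also have "\<dots> \<le> 25 * N ^ 3 * (N * (1 / real B) + N * \<epsilon>)"
        using N d\<tau> dj[OF j] by (intro mult_left_mono add_mono) auto
      also have "\<dots> = 25 * N ^ 4 * (1 / real B + \<epsilon>)" by (simp add: power3_eq_cube power4_eq_xxxx algebra_simps)
      finally show ?thesis by linarith
    qed
    have "real m * (mixed_moment \<tau> (ip n x e) - 1/100)
       \<le> real m * (mixed_moment \<tau>' (ip n x e') - 1/200 - 25 * N ^ 4 * (1 / real B + \<epsilon>))"
    proof (intro mult_left_mono)
      have "\<bar>mixed_moment \<tau> (ip n x e) - mixed_moment \<tau>' (ip n x e')\<bar> \<le> 22 * \<bar>\<tau> - \<tau>'\<bar> + 18 * cmod (ip n x e - ip n x e')"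
        using \<tau> \<tau>' wb by (intro mixed_moment_lipschitz)
      also have "\<dots> \<le> 22 * (1 / real B) + 18 * \<epsilon>" using d\<tau> dx by (intro add_mono mult_left_mono) auto
      finally have "\<bar>mixed_moment \<tau> (ip n x e) - mixed_moment \<tau>' (ip n x e')\<bar> \<le> 22 / real B + 18 * \<epsilon>" by simp
      then show "mixed_moment \<tau> (ip n x e) - 1/100
         \<le> mixed_moment \<tau>' (ip n x e') - 1/200 - 25 * N ^ 4 * (1 / real B + \<epsilon>)"
        using small by linarith
    qed simp
    also have "\<dots> = real m * (mixed_moment \<tau>' (ip n x e') - 1/200) - real m * (25 * N ^ 4 * (1 / real B + \<epsilon>))"
      by (simp add: right_diff_distrib)
    also have "\<dots> \<le> (\<Sum>j=1..m. mixed_square \<tau>' (ip n (a j) x) (ip n (a j) e')) - real m * (25 * N ^ 4 * (1 / real B + \<epsilon>))"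
      using low[OF e'(1) kB] by (simp add: \<tau>'_def)
    also have "\<dots> = (\<Sum>j=1..m. mixed_square \<tau>' (ip n (a j) x) (ip n (a j) e') - 25 * N ^ 4 * (1 / real B + \<epsilon>))"
      by (simp add: sum_subtractf)
    also have "\<dots> \<le> (\<Sum>j=1..m. mixed_square \<tau> (ip n (a j) x) (ip n (a j) e))"
      by (intro sum_mono pw)
    finally show "real m * (mixed_moment \<tau> (ip n x e) - 1/100) \<le> (\<Sum>j=1..m. mixed_square \<tau> (ip n (a j) x) (ip n (a j) e))" .
  qed
qed

section \<open>Regular samples are likely\<close>

definition unit_coord :: "nat \<Rightarrow> nat \<Rightarrow> complex" where
  "unit_coord i = (\<lambda>k. if k = i then 1 else 0)"

lemma nsq_unit_coord: "i < n \<Longrightarrow> nsq n (unit_coord i) = 1"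
  unfolding nsq_def unit_coord_def by (simp add: if_distrib[of cmod] if_distrib[of "\<lambda>x. x\<^sup>2"] cong: if_cong)

lemma ip_unit_coord: "i < n \<Longrightarrow> ip n a (unit_coord i) = cnj (a i)"
  unfolding ip_def unit_coord_def by (simp add: if_distrib[of "(*) _"] cong: if_cong)

lemma component_measurable_sample:
  assumes f: "f \<in> borel_measurable (gauss n)" and j: "j \<in> {1..m}"
  shows "(\<lambda>a. f (a j)) \<in> borel_measurable (complex_normal_sample m n)"
  unfolding complex_normal_sample_eq
  by (rule measurable_compose[OF measurable_component_singleton[OF j] f])

lemma sum_measurable_sample:
  fixes f :: "complex vec \<Rightarrow> real"
  assumes f: "f \<in> borel_measurable (gauss n)"
  shows "(\<lambda>a. \<Sum>j=1..m. f (a j)) \<in> borel_measurable (complex_normal_sample m n)"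
  by (intro borel_measurable_sum component_measurable_sample f)

definition large_entry_event where
  "large_entry_event m n W z = {a \<in> space (complex_normal_sample m n).
      \<exists>j\<in>{1..m}. a j \<in> {v \<in> space (gauss n). cmod2 (lf n z v) > W}}"

definition capped_event where
  "capped_event m n W x e = {a \<in> space (complex_normal_sample m n).
      real m * (1 + cmod2 (ip n x e) + 1/200) \<le> (\<Sum>j=1..m. capped W (lf n x (a j)) (lf n e (a j)))}"

definition mixed_event where
  "mixed_event m n x e \<tau> = {a \<in> space (complex_normal_sample m n).
      (\<Sum>j=1..m. mixed_square \<tau> (lf n x (a j)) (lf n e (a j))) \<le> real m * (mixed_moment \<tau> (ip n x e) - 1/200)}"

lemma large_entry_single: "{v \<in> space (gauss n). cmod2 (lf n z v) > W} \<in> sets (gauss n)"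
  by measurable

lemma events_measurable:
  "large_entry_event m n W z \<in> sets (complex_normal_sample m n)"
  "capped_event m n W x e \<in> sets (complex_normal_sample m n)"
  "mixed_event m n x e \<tau> \<in> sets (complex_normal_sample m n)"
proof -
  have c: "(\<lambda>a. cmod2 (lf n z a)) \<in> borel_measurable (gauss n)" by measurable
  have "large_entry_event m n W z
     = (\<Union>j\<in>{1..m}. {a \<in> space (complex_normal_sample m n). W < cmod2 (lf n z (a j))})"
    by (auto simp: large_entry_event_def complex_normal_sample_eq space_PiM PiE_def Pi_def)
  also have "\<dots> \<in> sets (complex_normal_sample m n)"
    by (intro sets.finite_UN borel_measurable_less borel_measurable_const component_measurable_sample[OF c]) auto
  finally show "large_entry_event m n W z \<in> sets (complex_normal_sample m n)" .
  show "capped_event m n W x e \<in> sets (complex_normal_sample m n)"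
    unfolding capped_event_def
    by (intro borel_measurable_le borel_measurable_const sum_measurable_sample[OF capped_measurable])
  show "mixed_event m n x e \<tau> \<in> sets (complex_normal_sample m n)"
    unfolding mixed_event_def
    by (intro borel_measurable_le borel_measurable_const sum_measurable_sample[OF mixed_square_measurable])
qed

lemma large_entry_prob:
  assumes "nsq n z = 1"
  shows "measure (complex_normal_sample m n) (large_entry_event m n W z) \<le> real m * (2 * exp (- W / 4))"
proof -
  have "measure (complex_normal_sample m n) (large_entry_event m n W z)
      \<le> real m * measure (gauss n) {v \<in> space (gauss n). cmod2 (lf n z v) > W}"
    unfolding large_entry_event_def complex_normal_sample_eq
    by (rule union_over_sample[OF prob_space_std_complex_normal_vec large_entry_single])
  also have "\<dots> \<le> real m * (2 * exp (- W / 4))"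
    by (intro mult_left_mono gauss_tail assms) auto
  finally show ?thesis .
qed

lemma measure_UN_le:
  assumes "prob_space M" "finite I" "\<And>i. i \<in> I \<Longrightarrow> A i \<in> sets M" "\<And>i. i \<in> I \<Longrightarrow> measure M (A i) \<le> c"
  shows "measure M (\<Union>i\<in>I. A i) \<le> real (card I) * c"
proof -
  interpret prob_space M by fact
  have "measure M (\<Union>i\<in>I. A i) \<le> (\<Sum>i\<in>I. measure M (A i))"
    using assms by (intro finite_measure_subadditive_finite) auto
  also have "\<dots> \<le> real (card I) * c" by (rule sum_bounded_above) (use assms in auto)
  finally show ?thesis .
qed

lemma gauss_carrier: "v \<in> space (gauss n) \<Longrightarrow> v \<in> carrier_vec n"
  by (auto simp: std_complex_normal_vec_def space_embed_measure)

text \<open>A union bound over the net. Each of its events has probability at most \<open>exp (- c m / ln m)\<close> and there are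
  \<open>exp (O (n ln m))\<close> events, so a multiple of \<open>n (ln m)\<^sup>2\<close> samples is enough. The first \<open>4 / m\<close> of the failure
  probability accounts for linear forms beyond the cap.\<close>

lemma regular_sample_probability:
  fixes n m :: nat
  assumes n: "n \<ge> 1" "n \<le> m" and m: "m \<ge> 1000" and big: "real m \<ge> 2 ^ 52 * real n * (ln (real m))\<^sup>2"
    and x: "nsq n x = 1"
  shows "\<exists>E \<in> sets (complex_normal_sample m n). measure (complex_normal_sample m n) E \<ge> 1 - 6 / real m \<and>
     (\<forall>a\<in>E. (\<forall>j\<in>{1..m}. a j \<in> carrier_vec n) \<and> regular_sample n m (\<lambda>j. ($) (a j)) x)"
proof -
  let ?P = "complex_normal_sample m n"
  interpret P: prob_space ?P by (rule prob_space_complex_normal_sample)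
  define L where "L = ln (real m)"
  have expL: "exp L = real m" using m by (simp add: L_def)
  have L1: "L \<ge> 1"
  proof -
    have "exp 1 \<le> real m" using exp_le m by linarith
    then show ?thesis using m by (simp add: L_def ln_ge_iff)
  qed
  have Lm: "L \<le> real m" using ln_le_minus_one[of "real m"] m by (simp add: L_def)
  \<comment> \<open>With this cap a single linear form exceeds it with probability at most \<open>2 / m ^ 3\<close>, small enough
    for a union over \<open>m\<close> samples and \<open>n + 1\<close> forms.\<close>
  define W where "W = 12 * L"
  have W1: "W \<ge> 1" using L1 by (simp add: W_def)
  \<comment> \<open>Samples have norm at most \<open>m ^ 2\<close> and the sums are quartic in them, so a polynomially fine grid
    makes the discretisation error smaller than \<open>1/200\<close>.\<close>
  define B where "B = m ^ 11"
  have B1: "B \<ge> 1" using m by (simp add: B_def)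
  obtain T where T: "finite T" "card T \<le> (2 * B + 1) ^ (2 * n)" "\<And>e. e \<in> T \<Longrightarrow> nsq n e = 1"
    "\<And>e. nsq n e = 1 \<Longrightarrow> \<exists>e'\<in>T. nrm n (\<lambda>i. e i - e' i) \<le> 2 * real n / real B"
    using sphere_net[OF B1] by blast
  define Z where "Z = insert x (unit_coord ` {..<n})"
  have Z: "finite Z" "card Z \<le> n + 1" "\<And>z. z \<in> Z \<Longrightarrow> nsq n z = 1"
  proof -
    show "finite Z" by (simp add: Z_def)
    show "card Z \<le> n + 1"
    proof -
      have "card (unit_coord ` {..<n}) \<le> n" using card_image_le[of "{..<n}" unit_coord] by simp
      then show ?thesis unfolding Z_def by (simp add: card_insert_if)
    qed
    show "nsq n z = 1" if "z \<in> Z" for z using that x nsq_unit_coord by (auto simp: Z_def)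
  qed
  define Bad1 where "Bad1 = (\<Union>z\<in>Z. large_entry_event m n W z)"
  define Bad2 where "Bad2 = (\<Union>e\<in>T. capped_event m n W x e)"
  define Bad3 where "Bad3 = (\<Union>(e, k)\<in>T \<times> {..B}. mixed_event m n x e (real k / real B))"
  have sets: "Bad1 \<in> sets ?P" "Bad2 \<in> sets ?P" "Bad3 \<in> sets ?P"
    unfolding Bad1_def Bad2_def Bad3_def using Z(1) T(1) events_measurable by (auto intro!: sets.finite_UN)
  define E where "E = space ?P - (Bad1 \<union> Bad2 \<union> Bad3)"
  have E: "E \<in> sets ?P" using sets by (simp add: E_def)
  have p1: "measure ?P Bad1 \<le> 4 / real m"
  proof -
    have "measure ?P Bad1 \<le> real (card Z) * (real m * (2 * exp (- W / 4)))"
      unfolding Bad1_def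
      by (intro measure_UN_le prob_space_complex_normal_sample Z(1) events_measurable large_entry_prob Z(3))
    also have "\<dots> \<le> (2 * real m) * (real m * (2 * exp (- W / 4)))"
      using Z(2) n m by (intro mult_right_mono) auto
    also have "exp (- W / 4) = 1 / real m ^ 3"
    proof -
      have "exp (- W / 4) = exp (- (real 3 * L))" by (simp add: W_def)
      also have "\<dots> = 1 / exp (real 3 * L)" by (simp add: exp_minus divide_inverse)
      also have "exp (real 3 * L) = exp L ^ 3" by (rule exp_of_nat_mult)
      finally show ?thesis by (simp add: expL)
    qed
    also have "(2 * real m) * (real m * (2 * (1 / real m ^ 3))) = 4 / real m"
      using m by (simp add: field_simps power3_eq_cube)
    finally show ?thesis .
  qed
  \<comment> \<open>The weaker of the two exponents; the union is over at most \<open>exp (36 * real n * L)\<close> events.\<close>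
  define q where "q = real m * (1/200)\<^sup>2 / (2 ^ 31 * L)"
  have nL: "37 * real n * L \<le> q"
  proof -
    have "37 * real n * L * (2 ^ 31 * L) * 40000 \<le> 2 ^ 52 * real n * L\<^sup>2"
    proof -
      have "37 * real n * L * (2 ^ 31 * L) * 40000 = (37 * 2 ^ 31 * 40000) * (real n * L\<^sup>2)" by (simp add: power2_eq_square)
      also have "\<dots> \<le> 2 ^ 52 * (real n * L\<^sup>2)" by (intro mult_right_mono) auto
      finally show ?thesis by simp
    qed
    also have "\<dots> \<le> real m" using big by (simp add: L_def)
    finally show ?thesis using L1 by (simp add: q_def field_simps power2_eq_square)
  qed
  have count: "(2 * real B + 1) ^ (2 * n) * (real B + 1) \<le> exp (36 * real n * L)"
  proof -
    have B12: "2 * real B + 1 \<le> real m ^ 12"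
    proof -
      have "2 * real B + 1 \<le> 3 * real B" using B1 by simp
      also have "\<dots> \<le> real m * real B" using m by (intro mult_right_mono) auto
      also have "\<dots> = real m ^ 12" by (simp add: B_def power_Suc[symmetric] del: power_Suc)
      finally show ?thesis .
    qed
    have "(2 * real B + 1) ^ (2 * n) * (real B + 1) \<le> (real m ^ 12) ^ (2 * n) * real m ^ 12"
      using B12 B1 by (intro mult_mono power_mono) auto
    also have "\<dots> = real m ^ (24 * n + 12)" by (simp add: power_add power_mult[symmetric] mult.commute)
    also have "\<dots> \<le> real m ^ (36 * n)" using m n by (intro power_increasing) auto
    also have "\<dots> = exp (real (36 * n) * L)" by (simp only: exp_of_nat_mult expL)
    finally show ?thesis by simp
  qed
  have fin: "exp (36 * real n * L) * exp (- q) \<le> 1 / real m"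
  proof -
    have "L \<le> real n * L" using n L1 by simp
    then have "36 * real n * L - q \<le> - L" using nL by linarith
    then have "exp (36 * real n * L - q) \<le> exp (- L)" by simp
    also have "\<dots> = 1 / real m" by (simp add: exp_minus expL divide_inverse)
    finally show ?thesis by (simp add: exp_diff exp_minus divide_inverse)
  qed
  have cT: "real (card T) \<le> (2 * real B + 1) ^ (2 * n)"
    using T(2) by (metis (mono_tags, opaque_lifting) of_nat_1 of_nat_add of_nat_le_iff of_nat_mult of_nat_numeral of_nat_power)
  have p2: "measure ?P Bad2 \<le> 1 / real m"
  proof -
    have "measure ?P (capped_event m n W x e) \<le> exp (- q)" if "e \<in> T" for e
    proof -
      have "measure ?P (capped_event m n W x e) \<le> exp (- (real m * (1/200)\<^sup>2 / (2 ^ 23 * W)))"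
        unfolding capped_event_def by (intro capped_sum_tail x T(3) that W1) auto
      also have "\<dots> \<le> exp (- q)"
      proof -
        have "2 ^ 23 * W \<le> 2 ^ 31 * L" using L1 by (simp add: W_def)
        then have "q \<le> real m * (1/200)\<^sup>2 / (2 ^ 23 * W)"
          unfolding q_def using W1 L1 by (intro divide_left_mono) auto
        then show ?thesis by simp
      qed
      finally show ?thesis .
    qed
    then have "measure ?P Bad2 \<le> real (card T) * exp (- q)"
      unfolding Bad2_def by (intro measure_UN_le prob_space_complex_normal_sample T(1) events_measurable)
    also have "\<dots> \<le> ((2 * real B + 1) ^ (2 * n) * (real B + 1)) * exp (- q)"
    proof (intro mult_right_mono)
      have "(2 * real B + 1) ^ (2 * n) * 1 \<le> (2 * real B + 1) ^ (2 * n) * (real B + 1)"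
        by (intro mult_left_mono) auto
      with cT show "real (card T) \<le> (2 * real B + 1) ^ (2 * n) * (real B + 1)" by linarith
    qed simp
    also have "\<dots> \<le> exp (36 * real n * L) * exp (- q)" using count by (intro mult_right_mono) auto
    finally show ?thesis using fin by linarith
  qed
  have p3: "measure ?P Bad3 \<le> 1 / real m"
  proof -
    have "measure ?P (mixed_event m n x e (real k / real B)) \<le> exp (- q)" if "e \<in> T" "k \<le> B" for e k
    proof -
      have "measure ?P (mixed_event m n x e (real k / real B)) \<le> exp (- (real m * (1/200)\<^sup>2 / 2 ^ 31))"
        unfolding mixed_event_def using that B1 by (intro mixed_sum_tail x T(3)) auto
      also have "\<dots> \<le> exp (- q)"
      proof -
        have "q \<le> real m * (1/200)\<^sup>2 / (2 ^ 31 * 1)"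
          unfolding q_def using L1 by (intro divide_left_mono) auto
        then show ?thesis by simp
      qed
      finally show ?thesis .
    qed
    then have "measure ?P Bad3 \<le> real (card (T \<times> {..B})) * exp (- q)"
      unfolding Bad3_def
      by (intro measure_UN_le prob_space_complex_normal_sample) (use T(1) events_measurable in auto)
    also have "\<dots> \<le> ((2 * real B + 1) ^ (2 * n) * (real B + 1)) * exp (- q)"
    proof (intro mult_right_mono)
      have "real (card (T \<times> {..B})) = real (card T) * (real B + 1)" by (simp add: card_cartesian_product algebra_simps)
      then show "real (card (T \<times> {..B})) \<le> (2 * real B + 1) ^ (2 * n) * (real B + 1)"
        using cT by (simp add: mult_right_mono)
    qed simp
    also have "\<dots> \<le> exp (36 * real n * L) * exp (- q)" using count by (intro mult_right_mono) auto
    finally show ?thesis using fin by linarith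
  qed
  have prob: "measure ?P E \<ge> 1 - 6 / real m"
  proof -
    have "measure ?P (Bad1 \<union> Bad2 \<union> Bad3) \<le> measure ?P Bad1 + measure ?P Bad2 + measure ?P Bad3"
      using measure_Un_le[of "Bad1 \<union> Bad2" ?P Bad3] measure_Un_le[of Bad1 ?P Bad2] sets by simp
    also have "\<dots> \<le> 4 / real m + 1 / real m + 1 / real m" using p1 p2 p3 by linarith
    also have "\<dots> = 6 / real m" by (simp add: add_divide_distrib[symmetric])
    finally have "measure ?P (Bad1 \<union> Bad2 \<union> Bad3) \<le> 6 / real m" .
    moreover have "measure ?P E = 1 - measure ?P (Bad1 \<union> Bad2 \<union> Bad3)"
      unfolding E_def by (rule P.prob_compl) (use sets in auto)
    ultimately show ?thesis by linarith
  qed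
  have good: "(\<forall>j\<in>{1..m}. a j \<in> carrier_vec n) \<and> regular_sample n m (\<lambda>j. ($) (a j)) x" if a: "a \<in> E" for a
  proof
    have asp: "a \<in> space ?P" and nb: "a \<notin> Bad1" "a \<notin> Bad2" "a \<notin> Bad3" using a by (auto simp: E_def)
    have aj: "a j \<in> space (gauss n)" if "j \<in> {1..m}" for j
      using asp that by (auto simp: complex_normal_sample_eq space_PiM)
    show "\<forall>j\<in>{1..m}. a j \<in> carrier_vec n" using aj gauss_carrier by blast
    have le: "cmod2 (lf n z (a j)) \<le> W" if "z \<in> Z" "j \<in> {1..m}" for z j
    proof -
      have "a \<notin> large_entry_event m n W z" using nb(1) that(1) by (auto simp: Bad1_def)
      then show ?thesis using asp that(2) aj[OF that(2)] by (auto simp: large_entry_event_def)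
    qed
    have nrm_a: "nrm n (($) (a j)) \<le> real m ^ 2" if j: "j \<in> {1..m}" for j
    proof -
      have "cmod2 (a j $ i) \<le> W" if "i < n" for i
        using le[of "unit_coord i" j] j that by (simp add: Z_def ip_unit_coord)
      then have "nsq n (($) (a j)) \<le> real (card {..<n}) * W"
        unfolding nsq_def by (intro sum_bounded_above) auto
      also have "\<dots> \<le> real m * (12 * real m)"
        using n Lm W1 by (intro mult_mono) (auto simp: W_def)
      also have "\<dots> \<le> real m * (real m * (real m * real m))"
      proof -
        have "12 * real m \<le> (real m * real m) * real m"
        proof (rule mult_right_mono)
          have "12 * 1 \<le> real m * real m" using m by (intro mult_mono) auto
          then show "12 \<le> real m * real m" by simp
        qed simp
        then have "real m * (12 * real m) \<le> real m * ((real m * real m) * real m)" by (intro mult_left_mono) auto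
        then show ?thesis by (simp add: mult.assoc)
      qed
      also have "\<dots> = (real m ^ 2)\<^sup>2" by (simp add: power2_eq_square)
      finally have "(nrm n (($) (a j)))\<^sup>2 \<le> (real m ^ 2)\<^sup>2" by (simp add: nrm_sq)
      then show ?thesis by (rule power2_le_imp_le) simp
    qed
    show "regular_sample n m (\<lambda>j. ($) (a j)) x"
    proof (rule regular_sample_of_net[OF x _ nrm_a B1 T(3) T(4)])
      show "1 \<le> real m ^ 2" using m by (simp add: one_le_power)
      fix e assume e: "e \<in> T"
      have "a \<notin> capped_event m n W x e" using nb(2) e by (auto simp: Bad2_def)
      then have "(\<Sum>j=1..m. capped W (lf n x (a j)) (lf n e (a j))) \<le> real m * (1 + cmod2 (ip n x e) + 1/200)"
        using asp by (simp add: capped_event_def)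
      moreover have "(\<Sum>j=1..m. capped W (lf n x (a j)) (lf n e (a j)))
          = (\<Sum>j=1..m. cmod2 (lf n x (a j)) * cmod2 (lf n e (a j)))"
        using le[of x] by (intro sum.cong) (auto simp: capped_def Z_def)
      ultimately show "(\<Sum>j=1..m. cmod2 (lf n x (a j)) * cmod2 (lf n e (a j)))
          \<le> real m * (1 + cmod2 (ip n x e) + 1/200)" by simp
    next
      fix e k assume e: "e \<in> T" and k: "k \<le> B"
      have "a \<notin> mixed_event m n x e (real k / real B)" using nb(3) e k by (auto simp: Bad3_def)
      then show "real m * (mixed_moment (real k / real B) (ip n x e) - 1/200)
          \<le> (\<Sum>j=1..m. mixed_square (real k / real B) (lf n x (a j)) (lf n e (a j)))"
        using asp by (simp add: mixed_event_def)
    next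
      have eps: "2 * real n / real B \<le> 2 / real m ^ 10"
      proof -
        have "2 * real n / real B \<le> 2 * real m / real B" using n B1 by (intro divide_right_mono) auto
        also have "\<dots> = 2 / real m ^ 10"
        proof -
          have "real B = real m * real m ^ 10" by (simp add: B_def power_Suc[symmetric] del: power_Suc)
          then show ?thesis using m by simp
        qed
        finally show ?thesis .
      qed
      have invB: "1 / real B \<le> 1 / real m ^ 10"
        unfolding B_def of_nat_power using m by (intro divide_left_mono power_increasing) auto
      have m8: "(real m ^ 2) ^ 4 = real m ^ 8" by (simp add: power_mult[symmetric])
      have "25 * (real m ^ 2) ^ 4 * (1 / real B + 2 * real n / real B) + 22 / real B + 18 * (2 * real n / real B)
         \<le> 25 * (real m ^ 2) ^ 4 * (1 / real m ^ 10 + 2 / real m ^ 10) + 22 * (1 / real m ^ 10) + 18 * (2 / real m ^ 10)"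
        using eps invB by (intro add_mono mult_left_mono) auto
      also have "\<dots> = 75 / real m ^ 2 + 58 / real m ^ 10"
      proof -
        have "real m ^ 10 = real m ^ 8 * real m ^ 2" by (simp add: power_add[symmetric])
        then show ?thesis using m unfolding m8 by (simp add: field_simps)
      qed
      also have "\<dots> \<le> 75 / real m ^ 2 + 58 / real m ^ 2"
        using m by (intro add_left_mono divide_left_mono power_increasing) auto
      also have "\<dots> = 133 / real m ^ 2" by (simp add: add_divide_distrib[symmetric])
      also have "\<dots> \<le> 133 / 1000 ^ 2" using m by (intro divide_left_mono power_mono) auto
      also have "\<dots> \<le> 1/200" by simp
      finally show "25 * (real m ^ 2) ^ 4 * (1 / real B + 2 * real n / real B) + 22 / real B + 18 * (2 * real n / real B) \<le> 1/200" .
    qed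
  qed
  show ?thesis using E prob good by blast
qed

text \<open>The hypothesis bounds \<open>m\<close> in terms of \<open>ln n\<close>, the union bound needs \<open>ln m\<close>.\<close>

lemma sample_size_condition:
  "\<exists>c0>0. \<exists>m0::nat. m0 \<ge> 1000 \<and> (\<forall>n m. n \<ge> 1 \<longrightarrow> m \<ge> m0 \<longrightarrow> real m \<ge> c0 * real n * ln (real n) ^ 3 \<longrightarrow>
      n \<le> m \<and> real m \<ge> 2 ^ 52 * real n * (ln (real m))\<^sup>2)"
proof -
  define C :: real where "C = 2 ^ 52"
  have "\<forall>\<^sub>F m in sequentially. C * (sqrt (real m) * (ln (real m))\<^sup>2) \<le> real m"
    unfolding C_def by real_asymp
  then obtain m1 where m1: "\<And>m. m \<ge> m1 \<Longrightarrow> C * (sqrt (real m) * (ln (real m))\<^sup>2) \<le> real m"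
    unfolding eventually_sequentially by blast
  have "n \<le> m \<and> real m \<ge> C * real n * (ln (real m))\<^sup>2"
    if n: "n \<ge> 1" and m: "m \<ge> max m1 1000" and big: "real m \<ge> 4 * C * real n * ln (real n) ^ 3" for n m
  proof -
    have m1000: "m \<ge> 1000" using m by simp
    have ln0: "ln (real m) \<ge> 1"
    proof -
      have "exp 1 \<le> real m" using exp_le m1000 by linarith
      then show ?thesis using m1000 by (simp add: ln_ge_iff)
    qed
    have main: "real m \<ge> C * real n * (ln (real m))\<^sup>2"
    \<comment> \<open>If \<open>m\<close> exceeds \<open>n\<^sup>2\<close> there is room to spare; otherwise \<open>ln m \<le> 2 * ln n\<close>.\<close>
    proof (cases "real n \<le> sqrt (real m)")
      case True
      have "C * real n * (ln (real m))\<^sup>2 \<le> C * sqrt (real m) * (ln (real m))\<^sup>2"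
        using True by (intro mult_right_mono mult_left_mono) (auto simp: C_def)
      also have "\<dots> \<le> real m" using m1[of m] m by (simp add: mult.assoc)
      finally show ?thesis .
    next
      case False
      then have "sqrt (real m) \<le> real n" by simp
      then have "real m \<le> (real n)\<^sup>2" using sqrt_le_D by blast
      then have "ln (real m) \<le> ln ((real n)\<^sup>2)" using m1000 n by (subst ln_le_cancel_iff) auto
      also have "\<dots> = 2 * ln (real n)" using n by (simp add: ln_realpow)
      finally have l2: "ln (real m) \<le> 2 * ln (real n)" .
      have sq: "(ln (real m))\<^sup>2 \<le> (2 * ln (real n))\<^sup>2" using l2 ln0 by (intro power_mono) auto
      have n1: "ln (real n) \<ge> 1"
      proof -
        have "3 \<le> sqrt (real m)" using m1000 by (intro real_le_rsqrt) auto
        then have "exp 1 \<le> real n" using exp_le False by linarith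
        then show ?thesis using n by (simp add: ln_ge_iff)
      qed
      have "C * real n * (ln (real m))\<^sup>2 \<le> C * real n * (2 * ln (real n))\<^sup>2"
        using sq by (intro mult_left_mono) (auto simp: C_def)
      also have "\<dots> = 4 * C * real n * (ln (real n) ^ 2 * 1)" by (simp add: power_mult_distrib)
      also have "\<dots> \<le> 4 * C * real n * (ln (real n) ^ 2 * ln (real n))"
        using n1 by (intro mult_left_mono) (auto simp: C_def)
      also have "\<dots> = 4 * C * real n * ln (real n) ^ 3" by (simp add: power2_eq_square power3_eq_cube)
      finally show ?thesis using big by linarith
    qed
    have "1 * real n * 1 \<le> C * real n * (ln (real m))\<^sup>2"
      using ln0 by (intro mult_mono) (auto simp: C_def one_le_power)
    then have "real n \<le> real m" using main by linarith
    with main show ?thesis by simp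
  qed
  then show ?thesis
    unfolding C_def by (intro exI[of _ "4 * 2 ^ 52"] conjI exI[of _ "max m1 1000"]) auto
qed

section \<open>Cubic regularization for phase retrieval\<close>

theorem theorem3:
  shows "\<exists>c0>0. \<exists>c1>0. \<forall>(n::nat) (m::nat) (zstar::complex vec).
    zstar \<in> carrier_vec n \<longrightarrow> zstar \<noteq> 0\<^sub>v n \<longrightarrow>
    m \<ge> 1 \<longrightarrow> real m \<ge> c0 * real n * ln (real n) ^ 3 \<longrightarrow>
    (\<exists>E \<in> sets (complex_normal_sample m n).
       measure (complex_normal_sample m n) E \<ge> 1 - c1 / real m \<and>
       (\<forall>a \<in> E.
          let b = (\<lambda>j. cmod (zstar \<bullet>c a j));
              f = phase_retrieval_objective m n a b
          in \<forall>u0 \<in> carrier_vec (2 * n). \<forall>u.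
               CR_sequence (2 * n) f u0 u \<longrightarrow>
               (\<exists>w \<in> phase_orbit (map_vec Re zstar) (map_vec Im zstar).
                  Q_quadratic_convergent (2 * n) u w)))"
proof -
  obtain c0 :: real and m0 :: nat where c0: "c0 > 0" and m0: "m0 \<ge> 1000"
    and size: "\<And>n m. n \<ge> 1 \<Longrightarrow> m \<ge> m0 \<Longrightarrow> real m \<ge> c0 * real n * ln (real n) ^ 3 \<Longrightarrow>
      n \<le> m \<and> real m \<ge> 2 ^ 52 * real n * (ln (real m))\<^sup>2"
    using sample_size_condition by blast
  show ?thesis
  proof (rule exI[of _ c0], intro conjI c0, rule exI[of _ "real m0"], intro conjI allI impI)
    show "0 < real m0" using m0 by simp
    fix n m :: nat and zstar :: "complex vec"
    assume z: "zstar \<in> carrier_vec n" "zstar \<noteq> 0\<^sub>v n" and m: "m \<ge> 1"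
      and big: "real m \<ge> c0 * real n * ln (real n) ^ 3"
    let ?P = "complex_normal_sample m n"
    let ?C = "\<lambda>a. \<forall>u0 \<in> carrier_vec (2 * n). \<forall>u.
        CR_sequence (2 * n) (phase_retrieval_objective m n a (\<lambda>j. cmod (zstar \<bullet>c a j))) u0 u \<longrightarrow>
        (\<exists>w \<in> phase_orbit (map_vec Re zstar) (map_vec Im zstar). Q_quadratic_convergent (2 * n) u w)"
    have "\<exists>E \<in> sets ?P. measure ?P E \<ge> 1 - real m0 / real m \<and> (\<forall>a \<in> E. ?C a)"
    \<comment> \<open>For few samples the probability bound is vacuous.\<close>
    proof (cases "m < m0")
      case True
      then have "1 - real m0 / real m \<le> 0" using m by (simp add: field_simps)
      then show ?thesis by (intro bexI[of _ "{}"]) auto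
    next
      case False
      define x where "x = (\<lambda>i. zstar $ i / of_real (nrm n (($) zstar)))"
      have nz: "nrm n (($) zstar) > 0" and x1: "nsq n x = 1"
        using normalised_signal[OF z] by (simp_all add: x_def)
      have n: "n \<ge> 1" using nz by (cases n) (auto simp: nrm_def nsq_def)
      have "n \<le> m \<and> real m \<ge> 2 ^ 52 * real n * (ln (real m))\<^sup>2"
        using size n False big by simp
      then obtain E where E: "E \<in> sets ?P" "measure ?P E \<ge> 1 - 6 / real m"
        and reg: "\<And>a. a \<in> E \<Longrightarrow> (\<forall>j\<in>{1..m}. a j \<in> carrier_vec n) \<and> regular_sample n m (\<lambda>j. ($) (a j)) x"
        using regular_sample_probability[OF n _ _ _ x1, of m] m0 False by auto
      have "6 / real m \<le> real m0 / real m" using m0 by (intro divide_right_mono) auto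
      moreover have "?C a" if "a \<in> E" for a
        using cr_sequence_converges[OF m z, of a] reg[OF that] by (auto simp: x_def)
      ultimately show ?thesis using E by (intro bexI[of _ E]) auto
    qed
    then show "\<exists>E \<in> sets ?P. measure ?P E \<ge> 1 - real m0 / real m \<and>
       (\<forall>a \<in> E.
          let b = (\<lambda>j. cmod (zstar \<bullet>c a j));
              f = phase_retrieval_objective m n a b
          in \<forall>u0 \<in> carrier_vec (2 * n). \<forall>u.
               CR_sequence (2 * n) f u0 u \<longrightarrow>
               (\<exists>w \<in> phase_orbit (map_vec Re zstar) (map_vec Im zstar).
                  Q_quadratic_convergent (2 * n) u w))"
      unfolding Let_def .
  qed
qed

end
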